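(* Let $M$ be a compact $n$-dimensional differentiable manifold without boundary, $T\in(0,\infty)$, and let $(g_t)_{t\in[0,T]}$ be a family of Riemannian metrics on $M$ which is $C^1$ in $t$. Assume that there are nonnegative constants $k_1,k_2,k_3,k_4$ such that $$\mathrm{Ric}_t\ge -k_1,\qquad -k_2\le\partial_t g_t\le k_3,\qquad |\nabla(\partial_t g_t)|\le k_4$$ hold on $M\times[0,T]$. Let $u:M\times[0,T]\to\mathbb R$ be a smooth positive solution of the heat equation $\partial_t u=\tfrac12\Delta u$ on $M\times[0,T]$. Then for every $\alpha>1$, $$\frac{|\nabla u|^2}{u^2}-\alpha\frac{\Delta u}{u}\le n\alpha^2\left(\frac2t+\max\{k_2,k_3\}+k_3+\sqrt{2k_4}+\frac{k_1+k_4}{\alpha-1}\right)$$ holds at every $(x,t)\in M\times(0,T]$.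
   Context: $\mathrm{Ric}_t$ is the Ricci curvature tensor of $g_t$. The gradient/Levi-Civita connection $\nabla$, the (tensor) norm $|\cdot|$ and the Laplacian $\Delta$ at time $t$ are taken with respect to $g_t$. For a symmetric 2-tensor $h$ at time $t$ and a constant $c$, $h\ge c$ (resp. $h\le c$) means $h(X,X)\ge c\,g_t(X,X)$ (resp. $\le$) for all tangent vectors $X$. *)

theory Defs
  imports "HOL-Analysis.Analysis"
begin

section \<open>Smooth functions\<close>

text \<open>Only meaningful for open \<open>S\<close>. In finite dimension, continuity of all directional derivatives
  \<open>x \<mapsto> Df(x) v\<close> is continuity of \<open>Df\<close>.\<close>

fun Ck_on :: "nat \<Rightarrow> 'a::euclidean_space set \<Rightarrow> ('a \<Rightarrow> 'b::real_normed_vector) \<Rightarrow> bool" where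
  "Ck_on 0 S f \<longleftrightarrow> continuous_on S f"
| "Ck_on (Suc k) S f \<longleftrightarrow>
     (\<forall>x\<in>S. f differentiable (at x)) \<and> (\<forall>v. Ck_on k S (\<lambda>x. frechet_derivative f (at x) v))"

text \<open>Smoothness on an arbitrary subset means local smooth extendability; this is the usual notion
  on sets with boundary such as \<open>{0..T} \<times> V\<close>, and for open \<open>S\<close> it is ordinary smoothness.\<close>

definition smooth_on :: "'a::euclidean_space set \<Rightarrow> ('a \<Rightarrow> 'b::real_normed_vector) \<Rightarrow> bool" where
  "smooth_on S f \<longleftrightarrow>
     (\<forall>x\<in>S. \<exists>W F. open W \<and> x \<in> W \<and> (\<forall>k. Ck_on k W F) \<and> (\<forall>y\<in>S \<inter> W. F y = f y))"


section \<open>Smooth manifolds\<close>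

text \<open>The manifold is the whole type \<open>'m\<close>, its dimension is \<open>CARD('n)\<close>. A chart is a pair of its
  domain and its coordinate map (whose values outside the domain are irrelevant). Transition maps
  go between open subsets of \<open>real ^ 'n\<close>, so there is no boundary.\<close>

type_synonym ('m, 'n) chart = "'m set \<times> ('m \<Rightarrow> real ^ 'n)"

definition chart_inv :: "('m, 'n) chart \<Rightarrow> real ^ 'n \<Rightarrow> 'm" where
  "chart_inv c = inv_into (fst c) (snd c)"

definition is_chart :: "('m::topological_space, 'n::finite) chart \<Rightarrow> bool" where
  "is_chart c \<longleftrightarrow> open (fst c) \<and> open (snd c ` fst c) \<and>
     homeomorphism (fst c) (snd c ` fst c) (snd c) (chart_inv c)"

definition smooth_atlas :: "('m::topological_space, 'n::finite) chart set \<Rightarrow> bool" where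
  "smooth_atlas A \<longleftrightarrow> (\<forall>c\<in>A. is_chart c) \<and> (\<Union>c\<in>A. fst c) = UNIV \<and>
     (\<forall>c\<in>A. \<forall>d\<in>A. smooth_on (snd c ` (fst c \<inter> fst d)) (snd d \<circ> chart_inv c))"

definition smooth_fun_on ::
    "('m::topological_space, 'n::finite) chart set \<Rightarrow> 'm set \<Rightarrow> ('m \<Rightarrow> real) \<Rightarrow> bool" where
  "smooth_fun_on A N f \<longleftrightarrow> (\<forall>c\<in>A. smooth_on (snd c ` (fst c \<inter> N)) (f \<circ> chart_inv c))"

definition smooth_near ::
    "('m::topological_space, 'n::finite) chart set \<Rightarrow> 'm \<Rightarrow> ('m \<Rightarrow> real) \<Rightarrow> bool" where
  "smooth_near A p f \<longleftrightarrow> (\<exists>N. open N \<and> p \<in> N \<and> smooth_fun_on A N f)"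

text \<open>Smoothness of a time-dependent function on \<open>M \<times> [0,T]\<close>.\<close>

definition smooth_spacetime ::
    "('m::topological_space, 'n::finite) chart set \<Rightarrow> real \<Rightarrow> (real \<Rightarrow> 'm \<Rightarrow> real) \<Rightarrow> bool" where
  "smooth_spacetime A T u \<longleftrightarrow>
     (\<forall>c\<in>A. smooth_on ({0..T} \<times> snd c ` fst c) (\<lambda>(t, x). u t (chart_inv c x)))"


section \<open>Tangent vectors and 2-tensors\<close>

text \<open>Tangent vectors at \<open>p\<close> are derivations on the functions that are smooth near \<open>p\<close>. The value on
  other functions is fixed to be \<open>0\<close>, so that equality of tangent vectors is equality of
  functionals. Dependence on the germ only follows from the Leibniz rule.\<close>

type_synonym 'm tvec = "('m \<Rightarrow> real) \<Rightarrow> real"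

definition tangent_space ::
    "('m::topological_space, 'n::finite) chart set \<Rightarrow> 'm \<Rightarrow> 'm tvec set" where
  "tangent_space A p = {X.
     (\<forall>f. \<not> smooth_near A p f \<longrightarrow> X f = 0) \<and>
     (\<forall>f h a b. smooth_near A p f \<longrightarrow> smooth_near A p h \<longrightarrow>
        X (\<lambda>q. a * f q + b * h q) = a * X f + b * X h) \<and>
     (\<forall>f h. smooth_near A p f \<longrightarrow> smooth_near A p h \<longrightarrow>
        X (\<lambda>q. f q * h q) = X f * h p + f p * X h)}"

definition chart_partial ::
    "('m, 'n::finite) chart \<Rightarrow> 'n \<Rightarrow> ('m \<Rightarrow> real) \<Rightarrow> 'm \<Rightarrow> real" where
  "chart_partial c i f p = frechet_derivative (f \<circ> chart_inv c) (at (snd c p)) (axis i 1)"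

text \<open>The coordinate vector \<open>\<partial>\<^sub>i\<close> at \<open>p\<close>.\<close>

definition coord_vec ::
    "('m::topological_space, 'n::finite) chart set \<Rightarrow> ('m, 'n) chart \<Rightarrow> 'm \<Rightarrow> 'n \<Rightarrow> 'm tvec" where
  "coord_vec A c p i = (\<lambda>f. if smooth_near A p f then chart_partial c i f p else 0)"

type_synonym 'm tensor2 = "'m \<Rightarrow> 'm tvec \<Rightarrow> 'm tvec \<Rightarrow> real"

definition comps ::
    "('m::topological_space, 'n::finite) chart set \<Rightarrow> ('m, 'n) chart \<Rightarrow> 'm tensor2 \<Rightarrow>
     'm \<Rightarrow> real ^ 'n ^ 'n" where
  "comps A c h p = (\<chi> i j. h p (coord_vec A c p i) (coord_vec A c p j))"

definition symmetric_tensor2 ::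
    "('m::topological_space, 'n::finite) chart set \<Rightarrow> 'm tensor2 \<Rightarrow> bool" where
  "symmetric_tensor2 A h \<longleftrightarrow> (\<forall>p. \<forall>X\<in>tangent_space A p. \<forall>Y\<in>tangent_space A p.
     h p X Y = h p Y X \<and>
     (\<forall>Z\<in>tangent_space A p. \<forall>a b.
        h p (\<lambda>f. a * X f + b * Y f) Z = a * h p X Z + b * h p Y Z))"

definition riemannian_metric ::
    "('m::topological_space, 'n::finite) chart set \<Rightarrow> 'm tensor2 \<Rightarrow> bool" where
  "riemannian_metric A h \<longleftrightarrow> symmetric_tensor2 A h \<and>
     (\<forall>p. \<forall>X\<in>tangent_space A p. X \<noteq> (\<lambda>f. 0) \<longrightarrow> h p X X > 0) \<and>
     (\<forall>c\<in>A. \<forall>i j. smooth_fun_on A (fst c) (\<lambda>p. comps A c h p $ i $ j))"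

text \<open>The time derivative of \<open>g\<close>, one-sided at \<open>t = 0\<close> and \<open>t = T\<close>.\<close>

definition dt_tensor :: "real \<Rightarrow> (real \<Rightarrow> 'm tensor2) \<Rightarrow> real \<Rightarrow> 'm tensor2" where
  "dt_tensor T g t = (\<lambda>p X Y. vector_derivative (\<lambda>s. g s p X Y) (at t within {0..T}))"

text \<open>A family of metrics that is \<open>C\<^sup>1\<close> in \<open>t\<close>: the time derivative exists, is a \<open>C\<^sup>1\<close> tensor
  field in space, and it and its first spatial derivatives are continuous on \<open>M \<times> [0,T]\<close>.
  Spatial regularity of the time derivative is what gives its covariant derivative a meaning.\<close>

definition C1_metric_family ::
    "('m::topological_space, 'n::finite) chart set \<Rightarrow> real \<Rightarrow> (real \<Rightarrow> 'm tensor2) \<Rightarrow> bool" where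
  "C1_metric_family A T g \<longleftrightarrow>
     (\<forall>t\<in>{0..T}. riemannian_metric A (g t)) \<and>
     (\<forall>p. \<forall>X\<in>tangent_space A p. \<forall>Y\<in>tangent_space A p. \<forall>t\<in>{0..T}.
        (\<lambda>s. g s p X Y) differentiable (at t within {0..T})) \<and>
     (\<forall>c\<in>A. \<forall>i j.
        continuous_on ({0..T} \<times> fst c) (\<lambda>(t, p). comps A c (dt_tensor T g t) p $ i $ j) \<and>
        (\<forall>t\<in>{0..T}. Ck_on 1 (snd c ` fst c)
           ((\<lambda>p. comps A c (dt_tensor T g t) p $ i $ j) \<circ> chart_inv c)) \<and>
        (\<forall>k. continuous_on ({0..T} \<times> fst c)
           (\<lambda>(t, p). chart_partial c k (\<lambda>q. comps A c (dt_tensor T g t) q $ i $ j) p)))"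


section \<open>Levi-Civita connection and curvature in a chart\<close>

text \<open>Below \<open>h\<close> is a Riemannian metric, \<open>c\<close> is a chart and \<open>p\<close> lies in its domain. The scalars and
  tensors defined here do not depend on the chart used to compute them.\<close>

definition cometric ::
    "('m::topological_space, 'n::finite) chart set \<Rightarrow> ('m, 'n) chart \<Rightarrow> 'm tensor2 \<Rightarrow>
     'm \<Rightarrow> real ^ 'n ^ 'n" where
  "cometric A c h p = matrix_inv (comps A c h p)"

text \<open>\<open>christoffel A c h k i j\<close> is \<open>\<Gamma>\<^sup>k\<^sub>i\<^sub>j\<close>.\<close>

definition christoffel ::
    "('m::topological_space, 'n::finite) chart set \<Rightarrow> ('m, 'n) chart \<Rightarrow> 'm tensor2 \<Rightarrow>
     'n \<Rightarrow> 'n \<Rightarrow> 'n \<Rightarrow> 'm \<Rightarrow> real" where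
  "christoffel A c h k i j p = (1/2) * (\<Sum>l\<in>UNIV. cometric A c h p $ k $ l *
     (chart_partial c i (\<lambda>q. comps A c h q $ j $ l) p
      + chart_partial c j (\<lambda>q. comps A c h q $ i $ l) p
      - chart_partial c l (\<lambda>q. comps A c h q $ i $ j) p))"

text \<open>The \<open>l\<close>-th component of \<open>R(\<partial>\<^sub>i, \<partial>\<^sub>j) \<partial>\<^sub>k\<close>, where
  \<open>R(X, Y) Z = \<nabla>\<^sub>X \<nabla>\<^sub>Y Z - \<nabla>\<^sub>Y \<nabla>\<^sub>X Z - \<nabla>\<^bsub>[X, Y]\<^esub> Z\<close>.\<close>

definition riemann ::
    "('m::topological_space, 'n::finite) chart set \<Rightarrow> ('m, 'n) chart \<Rightarrow> 'm tensor2 \<Rightarrow>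
     'n \<Rightarrow> 'n \<Rightarrow> 'n \<Rightarrow> 'n \<Rightarrow> 'm \<Rightarrow> real" where
  "riemann A c h l k i j p =
     chart_partial c i (christoffel A c h l j k) p
     - chart_partial c j (christoffel A c h l i k) p
     + (\<Sum>m\<in>UNIV. christoffel A c h l i m p * christoffel A c h m j k p
                 - christoffel A c h l j m p * christoffel A c h m i k p)"

text \<open>\<open>Ric(Y, Z)\<close> is the trace of \<open>X \<mapsto> R(X, Y) Z\<close>; the components of a tangent vector are its
  values on the coordinate functions.\<close>

definition ricci ::
    "('m::topological_space, 'n::finite) chart set \<Rightarrow> ('m, 'n) chart \<Rightarrow> 'm tensor2 \<Rightarrow> 'm tensor2" where
  "ricci A c h p Y Z = (\<Sum>j\<in>UNIV. \<Sum>k\<in>UNIV. (\<Sum>i\<in>UNIV. riemann A c h i k i j p)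
     * Y (\<lambda>q. snd c q $ j) * Z (\<lambda>q. snd c q $ k))"

text \<open>\<open>(\<nabla>\<^sub>k b)(\<partial>\<^sub>i, \<partial>\<^sub>j)\<close>.\<close>

definition cov_deriv2 ::
    "('m::topological_space, 'n::finite) chart set \<Rightarrow> ('m, 'n) chart \<Rightarrow> 'm tensor2 \<Rightarrow> 'm tensor2 \<Rightarrow>
     'n \<Rightarrow> 'n \<Rightarrow> 'n \<Rightarrow> 'm \<Rightarrow> real" where
  "cov_deriv2 A c h b k i j p =
     chart_partial c k (\<lambda>q. comps A c b q $ i $ j) p
     - (\<Sum>l\<in>UNIV. christoffel A c h l k i p * comps A c b p $ l $ j)
     - (\<Sum>l\<in>UNIV. christoffel A c h l k j p * comps A c b p $ i $ l)"

definition norm_cov_deriv2 ::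
    "('m::topological_space, 'n::finite) chart set \<Rightarrow> ('m, 'n) chart \<Rightarrow> 'm tensor2 \<Rightarrow> 'm tensor2 \<Rightarrow>
     'm \<Rightarrow> real" where
  "norm_cov_deriv2 A c h b p = sqrt
     (\<Sum>k\<in>UNIV. \<Sum>i\<in>UNIV. \<Sum>j\<in>UNIV. \<Sum>k'\<in>UNIV. \<Sum>i'\<in>UNIV. \<Sum>j'\<in>UNIV.
        cometric A c h p $ k $ k' * cometric A c h p $ i $ i' * cometric A c h p $ j $ j'
        * cov_deriv2 A c h b k i j p * cov_deriv2 A c h b k' i' j' p)"

definition grad ::
    "('m::topological_space, 'n::finite) chart set \<Rightarrow> ('m, 'n) chart \<Rightarrow> 'm tensor2 \<Rightarrow>
     ('m \<Rightarrow> real) \<Rightarrow> 'm \<Rightarrow> 'm tvec" where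
  "grad A c h f p = (\<lambda>\<phi>. \<Sum>i\<in>UNIV.
     (\<Sum>j\<in>UNIV. cometric A c h p $ i $ j * chart_partial c j f p) * coord_vec A c p i \<phi>)"

definition tvec_norm :: "'m tensor2 \<Rightarrow> 'm \<Rightarrow> 'm tvec \<Rightarrow> real" where
  "tvec_norm h p X = sqrt (h p X X)"

text \<open>The trace of the Hessian \<open>\<nabla>df\<close>.\<close>

definition laplacian ::
    "('m::topological_space, 'n::finite) chart set \<Rightarrow> ('m, 'n) chart \<Rightarrow> 'm tensor2 \<Rightarrow>
     ('m \<Rightarrow> real) \<Rightarrow> 'm \<Rightarrow> real" where
  "laplacian A c h f p = (\<Sum>i\<in>UNIV. \<Sum>j\<in>UNIV. cometric A c h p $ i $ j *
     (chart_partial c i (chart_partial c j f) p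
      - (\<Sum>k\<in>UNIV. christoffel A c h k i j p * chart_partial c k f p)))"

end

theory Submission
  imports Defs
begin

text \<open>
  Write \<open>f = ln u\<close> and \<open>Q = |\<nabla>f|\<^sup>2 - 2 \<alpha> \<partial>\<^sub>t f\<close>, the left-hand side of the estimate. The Bochner
  formula and the evolution equations of \<open>g\<^sup>-\<^sup>1\<close> and of the Christoffel symbols give, with \<open>h = \<partial>\<^sub>t g\<close>,
  \<open>(\<Delta>/2 - \<partial>\<^sub>t) Q + \<langle>\<nabla>f, \<nabla>Q\<rangle> = |\<nabla>\<^sup>2f|\<^sup>2 - \<alpha> \<langle>h, \<nabla>\<^sup>2f\<rangle> + Ric(\<nabla>f, \<nabla>f) + (1 - \<alpha>) h(\<nabla>f, \<nabla>f)
  - \<alpha> (div h - \<nabla>(tr h)/2)(\<nabla>f)\<close>.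
  Let \<open>B\<close> be the bound without its term \<open>2/t\<close>. At a positive maximum of \<open>t (Q - B)\<close> the left-hand
  side is at most \<open>(Q - B)/t\<close>, while \<open>|\<nabla>\<^sup>2f|\<^sup>2 \<ge> (\<Delta>f)\<^sup>2/n\<close> and
  \<open>\<alpha> \<Delta>f = - (Q + (\<alpha> - 1) |\<nabla>f|\<^sup>2)\<close> make the right-hand side quadratic in \<open>Q\<close>; this forces
  \<open>t (Q - B) \<le> 2 n \<alpha>\<^sup>2\<close>.

  The Bochner formula is verified in arbitrary coordinates: with \<open>W\<^sup>i\<^sub>j = \<nabla>\<^sub>j \<nabla>\<^sup>if\<close> one has
  \<open>\<Delta>|\<nabla>f|\<^sup>2/2 = \<nabla>\<^sub>l(W\<^sup>l\<^sub>i \<nabla>\<^sup>if)\<close>, and only the Ricci identity for the vector field \<open>\<nabla>f\<close> is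
  needed, no symmetry of the curvature tensor.
\<close>

text \<open>The evolution equation of Q is never formed as an identity. At the maximum, \<nabla>Q =
  0 and the gradient of the heat equation express \<nabla>|\<nabla>f|^2 and \<nabla>\<Delta>f
  through the gradient of the time derivative of f, and these terms cancel. The obstacle is
  regularity: the metric is differentiable only once in time, and only on [0,T]. Time derivatives
  are taken relative to [0,T], the exchange of time and space derivatives of the metric rests on
  continuity of the space derivatives of h alone, and f is replaced by a local smooth extension that
  solves the heat equation only for times in [0,T]. The maximum may lie at t = T, so only left
  differences are compared. Constants: half of |\<nabla>^2 f|^2 absorbs the pairing of \<alpha> h
  with the Hessian, at the cost of n \<alpha>^2 max(k2,k3)^2 / 2; the other half leaves
  (\<Delta>f)^2 / (2n), hence the numerator in 2/t. Derivatives of h enter through traces, with a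
  factor sqrt n k4 |\<nabla>f|, and splitting this product produces both sqrt (2 k4) and k4 /
  (\<alpha> - 1).\<close>

abbreviation (input) sum_univ :: "('i::finite \<Rightarrow> 'a::comm_monoid_add) \<Rightarrow> 'a"  (binder "\<Sum>\<Sum>" 10)
  where "sum_univ f \<equiv> sum f UNIV"

section \<open>Calculus of \<open>C\<^sup>k\<close> functions\<close>

abbreviation ddir :: "'a::real_normed_vector \<Rightarrow> ('a \<Rightarrow> 'b::real_normed_vector) \<Rightarrow> 'a \<Rightarrow> 'b" where
  "ddir v f x \<equiv> frechet_derivative f (at x) v"

lemma ddir_eqI: "(f has_derivative f') (at x) \<Longrightarrow> ddir v f x = f' v"
  using frechet_derivative_at by metis

lemma has_derivative_ddir: "f differentiable (at x) \<Longrightarrow> (f has_derivative (\<lambda>v. ddir v f x)) (at x)"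
  using frechet_derivative_works by auto

lemma ddir_cong:
  assumes "open S" "x \<in> S" "\<And>y. y \<in> S \<Longrightarrow> f y = g y"
  shows "ddir v f x = ddir v g x"
proof -
  have "(f has_derivative f') (at x) \<longleftrightarrow> (g has_derivative f') (at x)" for f'
    using assms has_derivative_transform_within_open[of f f' x UNIV S g]
      has_derivative_transform_within_open[of g f' x UNIV S f] by auto
  then show ?thesis unfolding frechet_derivative_def by simp
qed

lemma differentiable_cong_open:
  assumes "open S" "x \<in> S" "\<And>y. y \<in> S \<Longrightarrow> f y = g y" "f differentiable (at x)"
  shows "g differentiable (at x)"
  using assms has_derivative_transform_within_open[of f _ x UNIV S g]
  unfolding differentiable_def by blast

lemma ddir_add: "f differentiable (at x) \<Longrightarrow> g differentiable (at x) \<Longrightarrow>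
    ddir v (\<lambda>y. f y + g y) x = ddir v f x + ddir v g x"
  by (rule ddir_eqI[OF has_derivative_add[OF has_derivative_ddir has_derivative_ddir]])

lemma ddir_diff: "f differentiable (at x) \<Longrightarrow> g differentiable (at x) \<Longrightarrow>
    ddir v (\<lambda>y. f y - g y) x = ddir v f x - ddir v g x"
  by (rule ddir_eqI[OF has_derivative_diff[OF has_derivative_ddir has_derivative_ddir]])

lemma ddir_mult:
  fixes f g :: "'a::real_normed_vector \<Rightarrow> real"
  shows "f differentiable (at x) \<Longrightarrow> g differentiable (at x) \<Longrightarrow>
    ddir v (\<lambda>y. f y * g y) x = f x * ddir v g x + ddir v f x * g x"
  by (rule ddir_eqI[OF has_derivative_mult[OF has_derivative_ddir has_derivative_ddir]])

lemma ddir_cmult: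
  fixes f :: "'a::real_normed_vector \<Rightarrow> real"
  shows "f differentiable (at x) \<Longrightarrow> ddir v (\<lambda>y. c * f y) x = c * ddir v f x"
  by (simp add: ddir_mult)

lemma ddir_sum:
  assumes "\<And>i. i \<in> I \<Longrightarrow> f i differentiable (at x)"
  shows "ddir v (\<lambda>y. \<Sum>i\<in>I. f i y) x = (\<Sum>i\<in>I. ddir v (f i) x)"
  by (rule ddir_eqI[OF has_derivative_sum]) (use assms has_derivative_ddir in auto)

lemma ddir_inverse:
  fixes f :: "'a::real_normed_vector \<Rightarrow> real"
  assumes "f differentiable (at x)" "f x \<noteq> 0"
  shows "ddir v (\<lambda>y. 1 / f y) x = - ddir v f x * (1 / f x) * (1 / f x)"
proof -
  have "((\<lambda>y. 1 / f y) has_derivative (\<lambda>v. - ddir v f x * (1 / f x) * (1 / f x))) (at x)"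
    by (rule derivative_eq_intros has_derivative_ddir[OF assms(1)] | use assms in \<open>simp add: divide_simps\<close>)+
  then show ?thesis by (rule ddir_eqI)
qed

lemma ddir_ln:
  fixes f :: "'a::real_normed_vector \<Rightarrow> real"
  assumes "f differentiable (at x)" "f x > 0"
  shows "ddir v (\<lambda>y. ln (f y)) x = ddir v f x * (1 / f x)" "(\<lambda>y. ln (f y)) differentiable (at x)"
proof -
  have "((\<lambda>y. ln (f y)) has_derivative (\<lambda>v. ddir v f x * (1 / f x))) (at x)"
    by (rule derivative_eq_intros has_derivative_ddir[OF assms(1)] | use assms in \<open>simp add: divide_simps\<close>)+
  then show "ddir v (\<lambda>y. ln (f y)) x = ddir v f x * (1 / f x)" "(\<lambda>y. ln (f y)) differentiable (at x)"
    by (auto dest: ddir_eqI simp: differentiable_def)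
qed

lemma Ck_on_subset: "Ck_on k S f \<Longrightarrow> S' \<subseteq> S \<Longrightarrow> Ck_on k S' f"
  by (induction k arbitrary: f) (auto intro: continuous_on_subset)

lemma Ck_on_cong:
  assumes "open S" "\<And>x. x \<in> S \<Longrightarrow> f x = g x"
  shows "Ck_on k S f \<longleftrightarrow> Ck_on k S g"
  using assms(2)
proof (induction k arbitrary: f g)
  case 0
  then show ?case by (auto cong: continuous_on_cong)
next
  case (Suc k)
  have 1: "Ck_on k S (ddir v f) = Ck_on k S (ddir v g)" for v
    by (rule Suc.IH) (rule ddir_cong[OF assms(1)], use Suc.prems in auto)
  have 2: "f differentiable at x \<longleftrightarrow> g differentiable at x" if "x \<in> S" for x
    using differentiable_cong_open[OF assms(1) that, of f g]
      differentiable_cong_open[OF assms(1) that, of g f] Suc.prems by auto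
  show ?case using 1 2 by auto
qed

lemma Ck_on_local:
  assumes "\<And>x. x \<in> S \<Longrightarrow> \<exists>W. open W \<and> x \<in> W \<and> Ck_on k W f"
  shows "Ck_on k S f"
  using assms
proof (induction k arbitrary: f)
  case 0
  then show ?case
    by (auto simp: continuous_on_eq_continuous_within)
       (metis at_within_interior continuous_at_imp_continuous_within interior_open)
next
  case (Suc k)
  show ?case
  proof (simp, intro conjI ballI allI)
    fix x assume "x \<in> S" then show "f differentiable (at x)" using Suc.prems by fastforce
  next
    fix v show "Ck_on k S (ddir v f)"
      by (rule Suc.IH) (use Suc.prems in fastforce)
  qed
qed

lemma Ck_on_SucD: "Ck_on (Suc k) S f \<Longrightarrow> Ck_on k S f"
proof (induction k arbitrary: f)
  case 0
  then show ?case
    by (auto intro!: continuous_at_imp_continuous_on differentiable_imp_continuous_within)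
next
  case (Suc k)
  then show ?case by (metis Ck_on.simps(2))
qed

lemma Ck_on_const: "Ck_on k S (\<lambda>x. c)"
  by (induction k arbitrary: c) (auto)

lemma Ck_on_add: "open S \<Longrightarrow> Ck_on k S f \<Longrightarrow> Ck_on k S g \<Longrightarrow> Ck_on k S (\<lambda>x. f x + g x)"
proof (induction k arbitrary: f g)
  case 0
  then show ?case by (auto intro: continuous_intros)
next
  case (Suc k)
  have "Ck_on k S (ddir v (\<lambda>x. f x + g x))" for v
    using Suc.IH[of "ddir v f" "ddir v g"] Suc.prems
    by (subst Ck_on_cong[OF Suc.prems(1), of _ "\<lambda>x. ddir v f x + ddir v g x"]) (auto simp: ddir_add)
  then show ?case using Suc.prems by auto
qed

lemma Ck_on_mult:
  fixes f g :: "'a::euclidean_space \<Rightarrow> real"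
  shows "open S \<Longrightarrow> Ck_on k S f \<Longrightarrow> Ck_on k S g \<Longrightarrow> Ck_on k S (\<lambda>x. f x * g x)"
proof (induction k arbitrary: f g)
  case 0
  then show ?case by (auto intro: continuous_intros)
next
  case (Suc k)
  have "Ck_on k S (ddir v (\<lambda>x. f x * g x))" for v
    using Suc.IH[of "ddir v f" g] Suc.IH[of f "ddir v g"] Suc.prems
      Ck_on_SucD[OF Suc.prems(2)] Ck_on_SucD[OF Suc.prems(3)]
    by (subst Ck_on_cong[OF Suc.prems(1), of _ "\<lambda>x. f x * ddir v g x + ddir v f x * g x"])
       (auto simp: ddir_mult intro: Ck_on_add)
  then show ?case using Suc.prems by auto
qed

lemma Ck_on_recip:
  fixes f :: "'a::euclidean_space \<Rightarrow> real"
  assumes S: "open S" and nz: "\<And>x. x \<in> S \<Longrightarrow> f x \<noteq> 0"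
  shows "Ck_on k S f \<Longrightarrow> Ck_on k S (\<lambda>x. 1 / f x)"
proof (induction k)
  case 0
  then show ?case using nz by (auto intro!: continuous_intros)
next
  case (Suc k)
  have "Ck_on k S (ddir v (\<lambda>x. 1 / f x))" for v
  proof (subst Ck_on_cong[OF S])
    \<comment> \<open>The derivative is written with two separate factors 1 / f, so that the product
      rule and the induction hypothesis for 1 / f at order k cover it.\<close>
    show "ddir v (\<lambda>x. 1 / f x) x = -1 * ddir v f x * (1 / f x) * (1 / f x)" if "x \<in> S" for x
      using ddir_inverse[of f x v] Suc.prems nz that by simp
    show "Ck_on k S (\<lambda>x. -1 * ddir v f x * (1 / f x) * (1 / f x))"
      using Suc.prems Suc.IH Ck_on_SucD[OF Suc.prems] by (intro Ck_on_mult S Ck_on_const) auto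
  qed
  then show ?case using Suc.prems nz by (auto intro: differentiable_divide)
qed

lemma Ck_on_ln:
  fixes f :: "'a::euclidean_space \<Rightarrow> real"
  assumes S: "open S" and pos: "\<And>x. x \<in> S \<Longrightarrow> f x > 0" and f: "Ck_on k S f"
  shows "Ck_on k S (\<lambda>x. ln (f x))"
proof (cases k)
  case 0
  then show ?thesis using f pos by (auto intro!: continuous_intros) (metis less_irrefl)
next
  case (Suc m)
  have "Ck_on m S (ddir v (\<lambda>x. ln (f x)))" for v
  proof (subst Ck_on_cong[OF S])
    show "ddir v (\<lambda>x. ln (f x)) x = ddir v f x * (1 / f x)" if "x \<in> S" for x
      using ddir_ln(1)[of f x v] f pos that Suc by simp
    show "Ck_on m S (\<lambda>x. ddir v f x * (1 / f x))"
      using f Suc Ck_on_SucD[of m S f] less_imp_neq[OF pos]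
      by (intro Ck_on_mult S Ck_on_recip) force+
  qed
  moreover have "(\<lambda>x. ln (f x)) differentiable (at x)" if "x \<in> S" for x
    using f Suc that pos[OF that] by (intro ddir_ln(2)) auto
  ultimately show ?thesis using Suc by auto
qed

lemma ddir_affine:
  assumes "bounded_linear l" "f differentiable (at (c + l x))"
  shows "ddir v (\<lambda>y. f (c + l y)) x = ddir (l v) f (c + l x)"
    and "(\<lambda>y. f (c + l y)) differentiable (at x)"
proof -
  have "((\<lambda>y. c + l y) has_derivative l) (at x)"
    using bounded_linear_imp_has_derivative[OF assms(1), of "at x"] by (auto intro!: derivative_eq_intros)
  from diff_chain_at[OF this has_derivative_ddir[OF assms(2)]]
  have "((\<lambda>y. f (c + l y)) has_derivative (\<lambda>v. ddir (l v) f (c + l x))) (at x)"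
    by (simp add: o_def)
  then show "ddir v (\<lambda>y. f (c + l y)) x = ddir (l v) f (c + l x)"
    and "(\<lambda>y. f (c + l y)) differentiable (at x)"
    by (auto dest: ddir_eqI simp: differentiable_def)
qed

text \<open>Affine substitutions are what freezing the time needs: the slice y -> G (t, y) is G
  composed with (t, 0) + (0, y). A derivative in direction v becomes one in the constant direction l
  v, so the induction on k closes.\<close>

lemma Ck_on_affine:
  fixes f :: "'a::euclidean_space \<Rightarrow> 'c::real_normed_vector" and l :: "'b::euclidean_space \<Rightarrow> 'a"
  assumes "bounded_linear l" "open S"
  shows "Ck_on k S f \<Longrightarrow> Ck_on k {y. c + l y \<in> S} (\<lambda>y. f (c + l y))"
proof (induction k arbitrary: f)
  case 0
  have "continuous_on {y. c + l y \<in> S} (\<lambda>y. c + l y)"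
    by (intro continuous_intros bounded_linear.continuous_on[OF assms(1)])
  then show ?case using 0 by (auto intro: continuous_on_compose2)
next
  case (Suc k)
  have cont: "continuous_on UNIV (\<lambda>y. c + l y)"
    by (intro continuous_intros bounded_linear.continuous_on[OF assms(1)])
  have op: "open {y. c + l y \<in> S}"
    using open_vimage[OF assms(2) cont] by (simp add: vimage_def)
  have "Ck_on k {y. c + l y \<in> S} (ddir v (\<lambda>y. f (c + l y)))" for v
  proof (subst Ck_on_cong[OF op])
    show "ddir v (\<lambda>y. f (c + l y)) x = ddir (l v) f (c + l x)" if "x \<in> {y. c + l y \<in> S}" for x
      by (rule ddir_affine(1)[OF assms(1)]) (use Suc.prems that in auto)
    show "Ck_on k {y. c + l y \<in> S} (\<lambda>y. ddir (l v) f (c + l y))"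
      by (rule Suc.IH) (use Suc.prems in auto)
  qed
  moreover have "(\<lambda>y. f (c + l y)) differentiable at x" if "x \<in> {y. c + l y \<in> S}" for x
    by (rule ddir_affine(2)[OF assms(1)]) (use Suc.prems that in auto)
  ultimately show ?case by auto
qed

lemma ddir_bounded_linear:
  assumes "bounded_linear l" "f differentiable (at x)"
  shows "ddir v (\<lambda>y. l (f y)) x = l (ddir v f x)" "(\<lambda>y. l (f y)) differentiable (at x)"
proof -
  have "((\<lambda>y. l (f y)) has_derivative (\<lambda>v. l (ddir v f x))) (at x)"
    by (rule bounded_linear.has_derivative[OF assms(1) has_derivative_ddir[OF assms(2)]])
  then show "ddir v (\<lambda>y. l (f y)) x = l (ddir v f x)" "(\<lambda>y. l (f y)) differentiable (at x)"
    by (auto dest: ddir_eqI simp: differentiable_def)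
qed

text \<open>Serves to pass from a transition map to its single coordinates.\<close>

lemma Ck_on_bounded_linear:
  assumes "bounded_linear l" "open S"
  shows "Ck_on k S f \<Longrightarrow> Ck_on k S (\<lambda>y. l (f y))"
proof (induction k arbitrary: f)
  case 0
  then show ?case by (auto intro: bounded_linear.continuous_on[OF assms(1)])
next
  case (Suc k)
  have "Ck_on k S (ddir v (\<lambda>y. l (f y)))" for v
  proof (subst Ck_on_cong[OF assms(2)])
    show "ddir v (\<lambda>y. l (f y)) x = l (ddir v f x)" if "x \<in> S" for x
      by (rule ddir_bounded_linear(1)[OF assms(1)]) (use Suc.prems that in auto)
    show "Ck_on k S (\<lambda>y. l (ddir v f y))"
      by (rule Suc.IH) (use Suc.prems in auto)
  qed
  moreover have "(\<lambda>y. l (f y)) differentiable at x" if "x \<in> S" for x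
    by (rule ddir_bounded_linear(2)[OF assms(1)]) (use Suc.prems that in auto)
  ultimately show ?case by auto
qed

text \<open>Openness is built in because a derivative at a point depends only on values nearby: on
  an open set, functions that agree pointwise have the same derivatives of all orders.\<close>

definition Cinf_on :: "'a::euclidean_space set \<Rightarrow> ('a \<Rightarrow> 'b::real_normed_vector) \<Rightarrow> bool" where
  "Cinf_on S f \<longleftrightarrow> open S \<and> (\<forall>k. Ck_on k S f)"

lemma Cinf_on_open: "Cinf_on S f \<Longrightarrow> open S"
  by (simp add: Cinf_on_def)

lemma Cinf_on_subset: "Cinf_on S f \<Longrightarrow> open S' \<Longrightarrow> S' \<subseteq> S \<Longrightarrow> Cinf_on S' f"
  by (auto simp: Cinf_on_def intro: Ck_on_subset)

lemma Cinf_on_cong: "(\<And>x. x \<in> S \<Longrightarrow> f x = g x) \<Longrightarrow> Cinf_on S f \<longleftrightarrow> Cinf_on S g"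
  using Ck_on_cong[of S f g] by (auto simp: Cinf_on_def)

lemma Cinf_on_const: "open S \<Longrightarrow> Cinf_on S (\<lambda>x. c)"
  by (auto simp: Cinf_on_def Ck_on_const)

lemma Cinf_on_add: "Cinf_on S f \<Longrightarrow> Cinf_on S g \<Longrightarrow> Cinf_on S (\<lambda>x. f x + g x)"
  unfolding Cinf_on_def by (simp add: Ck_on_add)

lemma Cinf_on_mult:
  fixes f g :: "'a::euclidean_space \<Rightarrow> real"
  shows "Cinf_on S f \<Longrightarrow> Cinf_on S g \<Longrightarrow> Cinf_on S (\<lambda>x. f x * g x)"
  unfolding Cinf_on_def by (simp add: Ck_on_mult)

lemma Cinf_on_cmult:
  fixes f :: "'a::euclidean_space \<Rightarrow> real"
  shows "Cinf_on S f \<Longrightarrow> Cinf_on S (\<lambda>x. c * f x)"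
  unfolding Cinf_on_def by (simp add: Ck_on_mult Ck_on_const)

lemma Cinf_on_diff:
  fixes f g :: "'a::euclidean_space \<Rightarrow> real"
  shows "Cinf_on S f \<Longrightarrow> Cinf_on S g \<Longrightarrow> Cinf_on S (\<lambda>x. f x - g x)"
  using Cinf_on_add[OF _ Cinf_on_cmult[of S g "-1"], of f] by simp

lemma Cinf_on_recip:
  fixes f :: "'a::euclidean_space \<Rightarrow> real"
  shows "Cinf_on S f \<Longrightarrow> (\<And>x. x \<in> S \<Longrightarrow> f x \<noteq> 0) \<Longrightarrow> Cinf_on S (\<lambda>x. 1 / f x)"
  unfolding Cinf_on_def by (blast intro: Ck_on_recip)

lemma Cinf_on_ln:
  fixes f :: "'a::euclidean_space \<Rightarrow> real"
  shows "Cinf_on S f \<Longrightarrow> (\<And>x. x \<in> S \<Longrightarrow> f x > 0) \<Longrightarrow> Cinf_on S (\<lambda>x. ln (f x))"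
  unfolding Cinf_on_def by (blast intro: Ck_on_ln)

lemma Cinf_on_sum:
  assumes "open S" "\<And>i. i \<in> I \<Longrightarrow> Cinf_on S (f i)"
  shows "Cinf_on S (\<lambda>x. \<Sum>i\<in>I. f i x)"
  using assms(2) by (induction I rule: infinite_finite_induct)
    (simp_all add: Cinf_on_const[OF assms(1)] Cinf_on_add)

lemma Cinf_on_prod:
  fixes f :: "'i \<Rightarrow> 'a::euclidean_space \<Rightarrow> real"
  assumes "open S" "\<And>i. i \<in> I \<Longrightarrow> Cinf_on S (f i)"
  shows "Cinf_on S (\<lambda>x. \<Prod>i\<in>I. f i x)"
  using assms(2) by (induction I rule: infinite_finite_induct)
    (simp_all add: Cinf_on_const[OF assms(1)] Cinf_on_mult)

lemma Cinf_on_iff_Suc: "Cinf_on S f \<longleftrightarrow> open S \<and> (\<forall>k. Ck_on (Suc k) S f)"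
  unfolding Cinf_on_def using Ck_on_SucD by blast

lemma Cinf_on_ddir: "Cinf_on S f \<Longrightarrow> Cinf_on S (ddir v f)"
  unfolding Cinf_on_iff_Suc[of S f] by (simp add: Cinf_on_def)

lemma Cinf_on_differentiable: "Cinf_on S f \<Longrightarrow> x \<in> S \<Longrightarrow> f differentiable (at x)"
  unfolding Cinf_on_iff_Suc by simp

lemma Cinf_on_continuous_on: "Cinf_on S f \<Longrightarrow> continuous_on S f"
  unfolding Cinf_on_def using Ck_on.simps(1)[of S f] by simp

lemma Cinf_on_local:
  assumes "open S" "\<And>x. x \<in> S \<Longrightarrow> \<exists>W. x \<in> W \<and> Cinf_on W f"
  shows "Cinf_on S f"
  unfolding Cinf_on_def using assms Ck_on_local[of S _ f] Cinf_on_def by (metis (no_types))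

text \<open>As S is open, the local extension and f coincide on a whole neighbourhood of the point,
  hence so do their derivatives.\<close>

lemma Cinf_on_smooth_on:
  assumes "smooth_on S f" "open S"
  shows "Cinf_on S f"
proof (rule Cinf_on_local[OF assms(2)])
  fix x assume x: "x \<in> S"
  then obtain W F where W: "open W" "x \<in> W" "\<forall>k. Ck_on k W F" "\<forall>y\<in>S \<inter> W. F y = f y"
    using assms(1) unfolding smooth_on_def by metis
  then have "Cinf_on (S \<inter> W) F" using assms(2) Ck_on_subset[of _ W F "S \<inter> W"] unfolding Cinf_on_def by (simp add: open_Int)
  then have "Cinf_on (S \<inter> W) f" using W Cinf_on_cong[of "S \<inter> W" F f] by auto
  then show "\<exists>W. x \<in> W \<and> Cinf_on W f" using W x by blast
qed

lemma smooth_on_Cinf: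
  assumes "Cinf_on S f"
  shows "smooth_on S f"
  unfolding smooth_on_def
proof
  fix x assume "x \<in> S"
  with assms show "\<exists>W F. open W \<and> x \<in> W \<and> (\<forall>k. Ck_on k W F) \<and> (\<forall>y\<in>S \<inter> W. F y = f y)"
    by (intro exI[of _ S] exI[of _ f]) (simp add: Cinf_on_def)
qed

section \<open>Exchange of mixed derivatives\<close>

text \<open>Here \<open>h\<close> is the t-derivative of \<open>\<alpha>\<close>, \<open>k\<close>
  the s-derivative of \<open>h\<close>, and \<open>\<beta>\<close> the s-derivative of
  \<open>\<alpha>\<close> at s = 0. Continuity of \<open>k\<close> is asked at the single point (t0,
  0), and \<open>I\<close> is merely convex, so t0 may be an end of the time interval. Both the
  symmetry of second derivatives and the time derivative of the first spatial derivatives of the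
  metric come from here.\<close>

lemma mixed_derivative_swap:
  fixes \<alpha> h k :: "real \<Rightarrow> real \<Rightarrow> real"
  assumes I: "convex I" "t0 \<in> I" and r: "r > 0"
    and dt: "\<And>t s. t \<in> I \<Longrightarrow> \<bar>t - t0\<bar> < r \<Longrightarrow> \<bar>s\<bar> < r \<Longrightarrow> ((\<lambda>t. \<alpha> t s) has_real_derivative h t s) (at t within I)"
    and ds: "\<And>t s. t \<in> I \<Longrightarrow> \<bar>t - t0\<bar> < r \<Longrightarrow> \<bar>s\<bar> < r \<Longrightarrow> (h t has_real_derivative k t s) (at s)"
    and k: "\<And>\<epsilon>. \<epsilon> > 0 \<Longrightarrow> \<exists>\<delta>>0. \<forall>t\<in>I. \<forall>s. \<bar>t - t0\<bar> < \<delta> \<longrightarrow> \<bar>s\<bar> < \<delta> \<longrightarrow> \<bar>k t s - k t0 0\<bar> \<le> \<epsilon>"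
    and \<beta>: "\<And>t. t \<in> I \<Longrightarrow> \<bar>t - t0\<bar> < r \<Longrightarrow> (\<alpha> t has_real_derivative \<beta> t) (at 0)"
  shows "(\<beta> has_real_derivative k t0 0) (at t0 within I)"
proof -
  have main: "\<bar>\<beta> t - \<beta> t0 - (t - t0) * k t0 0\<bar> \<le> \<epsilon> * \<bar>t - t0\<bar>"
    if e: "\<epsilon> > 0" and d: "\<delta> > 0" "\<delta> \<le> r" and K: "\<forall>t\<in>I. \<forall>s. \<bar>t - t0\<bar> < \<delta> \<longrightarrow> \<bar>s\<bar> < \<delta> \<longrightarrow> \<bar>k t s - k t0 0\<bar> \<le> \<epsilon>"
      and t: "t \<in> I" "\<bar>t - t0\<bar> < \<delta>" for \<epsilon> \<delta> t
  proof -
    define D where "D s = \<alpha> t s - \<alpha> t0 s" for s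
    \<comment> \<open>D s - D 0 is the second difference of \<open>\<alpha>\<close> over the
      rectangle with corners (t0, 0) and (t, s). The mean value inequality, in s inside and in t
      outside, compares it with s (t - t0) k(t0, 0) up to an error \<epsilon> |s| |t - t0|.\<close>
    have quot: "\<bar>(D s - D 0) / s - (t - t0) * k t0 0\<bar> \<le> \<epsilon> * \<bar>t - t0\<bar>" if s: "s \<noteq> 0" "\<bar>s\<bar> < \<delta>" for s
    proof -
      let ?k = "k t0 0"
      have inner: "norm ((h \<tau> s - s * ?k) - (h \<tau> 0 - 0 * ?k)) \<le> \<epsilon> * norm (s - 0)"
        if "\<tau> \<in> I" "\<bar>\<tau> - t0\<bar> < \<delta>" for \<tau>
      proof (rule field_differentiable_bound[where S = "ball 0 \<delta>" and f = "\<lambda>\<sigma>. h \<tau> \<sigma> - \<sigma> * ?k" and f' = "\<lambda>\<sigma>. k \<tau> \<sigma> - ?k"])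
        fix \<sigma> :: real assume "\<sigma> \<in> ball 0 \<delta>"
        then have \<sigma>: "\<bar>\<sigma>\<bar> < \<delta>" by simp
        have "(h \<tau> has_real_derivative k \<tau> \<sigma>) (at \<sigma> within ball 0 \<delta>)"
          using ds[of \<tau> \<sigma>] that \<sigma> d by (auto intro: DERIV_subset)
        then show "((\<lambda>\<sigma>. h \<tau> \<sigma> - \<sigma> * ?k) has_real_derivative k \<tau> \<sigma> - ?k) (at \<sigma> within ball 0 \<delta>)"
          by (auto intro!: derivative_eq_intros)
        show "norm (k \<tau> \<sigma> - ?k) \<le> \<epsilon>" using K that \<sigma> by simp
      qed (use s d in auto)
      have "norm ((\<alpha> t s - \<alpha> t 0 - t * (s * ?k)) - (\<alpha> t0 s - \<alpha> t0 0 - t0 * (s * ?k))) \<le> (\<epsilon> * \<bar>s\<bar>) * norm (t - t0)"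
      proof (rule field_differentiable_bound[where S = "I \<inter> ball t0 \<delta>" and f = "\<lambda>\<tau>. \<alpha> \<tau> s - \<alpha> \<tau> 0 - \<tau> * (s * ?k)"
            and f' = "\<lambda>\<tau>. h \<tau> s - h \<tau> 0 - s * ?k"])
        show "convex (I \<inter> ball t0 \<delta>)" using I by (intro convex_Int convex_ball)
        fix \<tau> assume "\<tau> \<in> I \<inter> ball t0 \<delta>"
        then have \<tau>: "\<tau> \<in> I" "\<bar>\<tau> - t0\<bar> < \<delta>" by (auto simp: dist_real_def)
        have "((\<lambda>\<tau>. \<alpha> \<tau> s') has_real_derivative h \<tau> s') (at \<tau> within I \<inter> ball t0 \<delta>)" if "\<bar>s'\<bar> < \<delta>" for s'
          by (rule DERIV_subset[OF dt]) (use \<tau> d that in auto)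
        from this[OF s(2)] this[of 0] d
        show "((\<lambda>\<tau>. \<alpha> \<tau> s - \<alpha> \<tau> 0 - \<tau> * (s * ?k)) has_real_derivative h \<tau> s - h \<tau> 0 - s * ?k) (at \<tau> within I \<inter> ball t0 \<delta>)"
          by (auto intro!: derivative_eq_intros)
        show "norm (h \<tau> s - h \<tau> 0 - s * ?k) \<le> \<epsilon> * \<bar>s\<bar>" using inner[OF \<tau>] by (simp add: algebra_simps)
      qed (use t d I in \<open>auto simp: dist_real_def\<close>)
      moreover have "(D s - D 0) / s - (t - t0) * ?k = ((\<alpha> t s - \<alpha> t 0 - t * (s * ?k)) - (\<alpha> t0 s - \<alpha> t0 0 - t0 * (s * ?k))) / s"
        using s by (simp add: D_def field_simps)
      ultimately show ?thesis using s by (simp add: abs_divide divide_le_eq mult_ac)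
    qed
    have "(D has_real_derivative (\<beta> t - \<beta> t0)) (at 0)"
      unfolding D_def by (intro DERIV_diff \<beta>) (use t d r I in auto)
    \<comment> \<open>The bound on the quotient is uniform in s, so it survives the limit s -> 0, in
      which the quotient becomes \<beta> t - \<beta> t0.\<close>
    then have lim: "((\<lambda>s. \<bar>(D s - D 0) / s - (t - t0) * k t0 0\<bar>) \<longlongrightarrow> \<bar>\<beta> t - \<beta> t0 - (t - t0) * k t0 0\<bar>) (at 0)"
      unfolding has_field_derivative_iff by (auto intro!: tendsto_intros)
    show ?thesis
    proof (rule tendsto_upperbound[OF lim])
      show "\<forall>\<^sub>F s in at 0. \<bar>(D s - D 0) / s - (t - t0) * k t0 0\<bar> \<le> \<epsilon> * \<bar>t - t0\<bar>"
        unfolding eventually_at by (rule exI[of _ \<delta>]) (use d quot in auto)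
    qed simp
  qed
  show ?thesis
    unfolding has_field_derivative_iff Lim_within
  proof (intro allI impI)
    fix e :: real assume "e > 0"
    then obtain \<delta> where d: "\<delta> > 0" "\<forall>t\<in>I. \<forall>s. \<bar>t - t0\<bar> < \<delta> \<longrightarrow> \<bar>s\<bar> < \<delta> \<longrightarrow> \<bar>k t s - k t0 0\<bar> \<le> e/2"
      using k[of "e/2"] by auto
    show "\<exists>d>0. \<forall>x\<in>I. 0 < dist x t0 \<and> dist x t0 < d \<longrightarrow> dist ((\<beta> x - \<beta> t0) / (x - t0)) (k t0 0) < e"
    proof (intro exI[of _ "min \<delta> r"] conjI ballI impI)
      show "min \<delta> r > 0" using d r by auto
      fix t assume t: "t \<in> I" "0 < dist t t0 \<and> dist t t0 < min \<delta> r"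
      have "\<bar>\<beta> t - \<beta> t0 - (t - t0) * k t0 0\<bar> \<le> e/2 * \<bar>t - t0\<bar>"
        by (rule main[of "e/2" "min \<delta> r"]) (use d r \<open>e > 0\<close> t in \<open>auto simp: dist_real_def\<close>)
      moreover have "(\<beta> t - \<beta> t0) / (t - t0) - k t0 0 = (\<beta> t - \<beta> t0 - (t - t0) * k t0 0) / (t - t0)"
        using t by (auto simp: field_simps)
      ultimately have "\<bar>(\<beta> t - \<beta> t0) / (t - t0) - k t0 0\<bar> \<le> e/2"
        using t by (simp add: abs_divide divide_le_eq)
      then show "dist ((\<beta> t - \<beta> t0) / (t - t0)) (k t0 0) < e" using \<open>e > 0\<close> by (simp add: dist_real_def)
    qed
  qed
qed

lemma has_real_derivative_line:
  assumes "f differentiable (at (x + s *\<^sub>R v))"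
  shows "((\<lambda>s. f (x + s *\<^sub>R v)) has_real_derivative ddir v f (x + s *\<^sub>R v)) (at s within S)"
proof -
  have "((\<lambda>s. x + s *\<^sub>R v) has_derivative (\<lambda>h. h *\<^sub>R v)) (at s)"
    by (auto intro!: derivative_eq_intros)
  from diff_chain_at[OF this has_derivative_ddir[OF assms]]
  have "((\<lambda>s. f (x + s *\<^sub>R v)) has_derivative (\<lambda>h. ddir (h *\<^sub>R v) f (x + s *\<^sub>R v))) (at s)"
    by (simp add: o_def)
  moreover have "ddir (h *\<^sub>R v) f (x + s *\<^sub>R v) = ddir v f (x + s *\<^sub>R v) * h" for h
    using linear_frechet_derivative[OF assms] by (simp add: linear_scale)
  ultimately show ?thesis
    by (simp add: has_field_derivative_def has_derivative_at_withinI)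
qed

text \<open>On the plane x + t v + s w this is the exchange of mixed derivatives with I = UNIV; the
  continuity it asks for holds because \<open>Cinf_on\<close> is closed under
  \<open>ddir\<close>.\<close>

lemma ddir_commute:
  fixes f :: "'a::euclidean_space \<Rightarrow> real"
  assumes f: "Cinf_on S f" and x: "x \<in> S"
  shows "ddir v (ddir w f) x = ddir w (ddir v f) x"
proof -
  define P where "P = (\<lambda>(t::real, s::real). x + t *\<^sub>R v + s *\<^sub>R w)"
  have contP: "continuous_on UNIV P" unfolding P_def split_beta by (intro continuous_intros)
  have op: "open (P -` S)" using open_vimage[OF Cinf_on_open[OF f] contP] .
  moreover have "(0,0) \<in> P -` S" using x by (simp add: P_def)
  ultimately obtain A B where AB: "open A" "open B" "0 \<in> A" "0 \<in> B" "A \<times> B \<subseteq> P -` S"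
    by (metis open_prod_elim mem_Sigma_iff)
  then obtain r1 r2 where r12: "r1 > 0" "ball 0 r1 \<subseteq> A" "r2 > 0" "ball 0 r2 \<subseteq> B"
    using open_contains_ball by metis
  define r where "r = min r1 r2"
  have r: "r > 0" "\<And>t s. \<bar>t\<bar> < r \<Longrightarrow> \<bar>s\<bar> < r \<Longrightarrow> x + t *\<^sub>R v + s *\<^sub>R w \<in> S"
  proof -
    show "r > 0" using r12 by (simp add: r_def)
    fix t s :: real assume "\<bar>t\<bar> < r" "\<bar>s\<bar> < r"
    then have "(t, s) \<in> A \<times> B" using r12 by (auto simp: r_def dist_real_def)
    then show "x + t *\<^sub>R v + s *\<^sub>R w \<in> S" using AB by (auto simp: P_def)
  qed
  note diff = Cinf_on_differentiable
  have fv: "Cinf_on S (ddir v f)" and fw: "Cinf_on S (ddir w f)" and fvw: "Cinf_on S (ddir w (ddir v f))"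
    using f by (auto intro: Cinf_on_ddir)
  have "((\<lambda>t. ddir w f (x + t *\<^sub>R v)) has_real_derivative ddir w (ddir v f) (x + 0 *\<^sub>R v + 0 *\<^sub>R w)) (at 0 within UNIV)"
  proof (rule mixed_derivative_swap[where \<alpha> = "\<lambda>t s. f (x + t *\<^sub>R v + s *\<^sub>R w)" and h = "\<lambda>t s. ddir v f (x + t *\<^sub>R v + s *\<^sub>R w)"
        and k = "\<lambda>t s. ddir w (ddir v f) (x + t *\<^sub>R v + s *\<^sub>R w)" and r = r])
    show "r > 0" by fact
    fix t s :: real assume ts: "\<bar>t - 0\<bar> < r" "\<bar>s\<bar> < r"
    then have inS: "x + t *\<^sub>R v + s *\<^sub>R w \<in> S" using r(2) by simp
    have eq: "x + t *\<^sub>R v + s *\<^sub>R w = (x + s *\<^sub>R w) + t *\<^sub>R v" for t by simp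
    show "((\<lambda>t. f (x + t *\<^sub>R v + s *\<^sub>R w)) has_real_derivative ddir v f (x + t *\<^sub>R v + s *\<^sub>R w)) (at t within UNIV)"
      using has_real_derivative_line[of f "x + s *\<^sub>R w" t v UNIV] diff[OF f inS] by (simp add: eq)
    show "((\<lambda>s. ddir v f (x + t *\<^sub>R v + s *\<^sub>R w)) has_real_derivative ddir w (ddir v f) (x + t *\<^sub>R v + s *\<^sub>R w)) (at s)"
      using has_real_derivative_line[of "ddir v f" "x + t *\<^sub>R v" s w UNIV] diff[OF fv inS] by simp
  next
    fix t assume "\<bar>t - 0\<bar> < r"
    then have inS: "x + t *\<^sub>R v + 0 *\<^sub>R w \<in> S" using r by (intro r(2)) auto
    show "((\<lambda>s. f (x + t *\<^sub>R v + s *\<^sub>R w)) has_real_derivative ddir w f (x + t *\<^sub>R v)) (at 0)"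
      using has_real_derivative_line[of f "x + t *\<^sub>R v" 0 w UNIV] diff[OF f inS] by simp
  next
    fix \<epsilon> :: real assume e: "\<epsilon> > 0"
    have "isCont (ddir w (ddir v f)) (P (0,0))"
      using Cinf_on_continuous_on[OF fvw] Cinf_on_open[OF f] x
      by (simp add: P_def continuous_on_eq_continuous_at)
    moreover have "isCont P (0,0)" using contP by (simp add: continuous_on_eq_continuous_at)
    ultimately have "isCont (\<lambda>p. ddir w (ddir v f) (P p)) (0,0)"
      using isCont_o2 by blast
    then obtain d where d: "d > 0" "\<And>p. dist p (0,0) < d \<Longrightarrow> dist (ddir w (ddir v f) (P p)) (ddir w (ddir v f) (P (0,0))) < \<epsilon>"
      using e unfolding continuous_at_eps_delta by metis
    show "\<exists>\<delta>>0. \<forall>t\<in>UNIV. \<forall>s. \<bar>t - 0\<bar> < \<delta> \<longrightarrow> \<bar>s\<bar> < \<delta> \<longrightarrow>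
       \<bar>ddir w (ddir v f) (x + t *\<^sub>R v + s *\<^sub>R w) - ddir w (ddir v f) (x + 0 *\<^sub>R v + 0 *\<^sub>R w)\<bar> \<le> \<epsilon>"
    proof (intro exI[of _ "d/2"] conjI ballI allI impI)
      show "d/2 > 0" using d by simp
      fix t s :: real assume "\<bar>t - 0\<bar> < d/2" "\<bar>s\<bar> < d/2"
      then have "dist (t,s) (0,0) < d"
        using norm_Pair_le[of t s] by (simp add: dist_norm)
      from d(2)[OF this] show "\<bar>ddir w (ddir v f) (x + t *\<^sub>R v + s *\<^sub>R w) - ddir w (ddir v f) (x + 0 *\<^sub>R v + 0 *\<^sub>R w)\<bar> \<le> \<epsilon>"
        by (simp add: P_def dist_real_def)
    qed
  qed auto
  moreover have "((\<lambda>t. ddir w f (x + t *\<^sub>R v)) has_real_derivative ddir v (ddir w f) x) (at 0)"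
    using has_real_derivative_line[of "ddir w f" x 0 v UNIV] diff[OF fw x] by simp
  ultimately show ?thesis using DERIV_unique by fastforce
qed

section \<open>Linear algebra of positive definite matrices\<close>

lemma sum_rotate: "(\<Sum>i\<in>A. \<Sum>j\<in>B. \<Sum>k\<in>C. f i j k) = (\<Sum>k\<in>C. \<Sum>i\<in>A. \<Sum>j\<in>B. f i j k)"
proof -
  have "(\<Sum>i\<in>A. \<Sum>j\<in>B. \<Sum>k\<in>C. f i j k) = (\<Sum>i\<in>A. \<Sum>k\<in>C. \<Sum>j\<in>B. f i j k)"
    by (rule sum.cong[OF refl], rule sum.swap)
  also have "\<dots> = (\<Sum>k\<in>C. \<Sum>i\<in>A. \<Sum>j\<in>B. f i j k)"
    by (rule sum.swap)
  finally show ?thesis .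
qed

lemma sum_swap_pairs:
  "(\<Sum>i\<in>A. \<Sum>j\<in>B. \<Sum>k\<in>C. \<Sum>l\<in>D. f i j k l) = (\<Sum>k\<in>C. \<Sum>l\<in>D. \<Sum>i\<in>A. \<Sum>j\<in>B. f i j k l)"
  unfolding sum_rotate[of "\<lambda>i j k. \<Sum>l\<in>D. f i j k l"] by (rule sum.cong[OF refl]) (rule sum_rotate)

section \<open>Decomposition of semidefinite forms into squares\<close>

text \<open>The form at v + c e_s as a polynomial in c; the conditionals are the coordinates of c
  e_s. The expansion serves to complete squares and, with a row of the matrix in place of v, to
  bound that row.\<close>

lemma quadratic_form_shift:
  fixes b :: "'n::finite \<Rightarrow> 'n \<Rightarrow> real"
  assumes sym: "\<And>i j. b i j = b j i"
  shows "(\<Sum>\<Sum>i j. (v i + (if i = s then c else 0)) * (v j + (if j = s then c else 0)) * b i j)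
    = (\<Sum>\<Sum>i j. v i * v j * b i j) + 2 * c * (\<Sum>\<Sum>j. b s j * v j) + c\<^sup>2 * b s s"
proof -
  have "(\<Sum>\<Sum>j. (v i + (if i = s then c else 0)) * (v j + (if j = s then c else 0)) * b i j)
     = (\<Sum>\<Sum>j. v i * v j * b i j) + (if i = s then c else 0) * (\<Sum>\<Sum>j. b s j * v j)
        + c * v i * b s i + (if i = s then c else 0) * c * b s s" for i
  proof -
    have "(\<Sum>\<Sum>j. (v i + (if i = s then c else 0)) * (v j + (if j = s then c else 0)) * b i j)
      = (\<Sum>\<Sum>j. v i * v j * b i j + (if i = s then c else 0) * (b s j * v j)
          + (if j = s then (v i + (if i = s then c else 0)) * c * b i s else 0))"
      by (intro sum.cong refl) (auto simp: algebra_simps)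
    also have "\<dots> = (\<Sum>\<Sum>j. v i * v j * b i j) + (if i = s then c else 0) * (\<Sum>\<Sum>j. b s j * v j)
       + (v i + (if i = s then c else 0)) * c * b i s"
      by (simp add: sum.distrib sum_distrib_left)
    also have "\<dots> = (\<Sum>\<Sum>j. v i * v j * b i j) + (if i = s then c else 0) * (\<Sum>\<Sum>j. b s j * v j)
        + c * v i * b s i + (if i = s then c else 0) * c * b s s"
      using sym[of i s] by (auto simp: algebra_simps)
    finally show ?thesis .
  qed
  note row = this
  have delta: "(\<Sum>\<Sum>i. (if i = s then c else 0) * x) = c * x" for x
    by (simp add: sum_distrib_right[symmetric])
  have lin: "(\<Sum>\<Sum>i. c * v i * b s i) = c * (\<Sum>\<Sum>j. b s j * v j)"
    by (simp add: sum_distrib_left mult_ac)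
  show ?thesis
    unfolding row sum.distrib lin delta mult.assoc[of "if _ then _ else _"] by (simp add: power2_eq_square)
qed

text \<open>Symmetric elimination as in the Cholesky decomposition, by induction on a set carrying
  the support. A vanishing pivot \<open>b s s\<close> forces its row to vanish; otherwise
  subtracting the rank-one form of \<open>w\<close> leaves a semidefinite form supported on the
  remaining indices.\<close>

lemma psd_sum_of_squares_on:
  fixes b :: "'n::finite \<Rightarrow> 'n \<Rightarrow> real"
  assumes "finite S"
  shows "(\<And>i j. b i j = b j i) \<Longrightarrow> (\<And>v. 0 \<le> (\<Sum>\<Sum>i j. v i * v j * b i j)) \<Longrightarrow>
    (\<And>i j. i \<notin> S \<Longrightarrow> b i j = 0) \<Longrightarrow> \<exists>E. \<forall>i j. b i j = (\<Sum>k\<in>S. E k i * E k j)"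
  using assms
proof (induction S arbitrary: b)
  case empty
  then show ?case by auto
next
  case (insert s S b)
  note sym = insert.prems(1) and psd = insert.prems(2) and supp = insert.prems(3)
  have shift: "0 \<le> (\<Sum>\<Sum>i j. v i * v j * b i j) + 2 * c * (\<Sum>\<Sum>j. b s j * v j) + c\<^sup>2 * b s s" for v c
    using psd[of "\<lambda>i. v i + (if i = s then c else 0)"] quadratic_form_shift[OF sym, where s = s] by simp
  have bss: "b s s \<ge> 0" using shift[of "\<lambda>_. 0" 1] by simp
  show ?case
  proof (cases "b s s = 0")
    case True
    have zero: "b s j = 0" for j
    proof (rule ccontr)
      assume nz: "b s j \<noteq> 0"
      have "0 \<le> b j j + 2 * c * b s j" for c
        using shift[of "\<lambda>i. if i = j then 1 else 0" c] True
        by (simp add: if_distrib[of "\<lambda>x. x * _"] if_distrib[of "\<lambda>x. _ * x"] cong: if_cong)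
      \<comment> \<open>This c gives b j j + 2 c b s j the value -1.\<close>
      from this[of "- (b j j + 1) / (2 * b s j)"] nz show False by (simp add: field_simps)
    qed
    have "b i j = 0" if "i \<notin> S" for i j using zero supp that by (cases "i = s") auto
    then obtain E where E: "\<forall>i j. b i j = (\<Sum>k\<in>S. E k i * E k j)"
      using insert.IH[OF sym psd] by auto
    have "b i j = (\<Sum>k\<in>insert s S. (if k = s then 0 else E k i) * (if k = s then 0 else E k j))" for i j
      using E insert.hyps by (auto intro!: sum.cong)
    then show ?thesis by (intro exI[of _ "\<lambda>k i. if k = s then 0 else E k i"]) auto
  next
    case False
    with bss have pos: "b s s > 0" by simp
    define w where "w j = b s j / sqrt (b s s)" for j
    define b' where "b' i j = b i j - w i * w j" for i j
    have ww: "w i * w j = b s i * b s j / b s s" for i j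
      using pos by (simp add: w_def)
    have psd': "0 \<le> (\<Sum>\<Sum>i j. v i * v j * b' i j)" for v
    proof -
      define \<beta> where "\<beta> = (\<Sum>\<Sum>j. b s j * v j)"
      have "(\<Sum>\<Sum>i j. v i * v j * (w i * w j)) = (\<Sum>\<Sum>i j. (b s i * v i) * (b s j * v j)) / b s s"
        unfolding ww by (simp add: sum_divide_distrib mult_ac)
      also have "\<dots> = \<beta>\<^sup>2 / b s s"
        unfolding \<beta>_def power2_eq_square sum_product ..
      finally have "(\<Sum>\<Sum>i j. v i * v j * b' i j) = (\<Sum>\<Sum>i j. v i * v j * b i j) - \<beta>\<^sup>2 / b s s"
        by (simp add: b'_def right_diff_distrib sum_subtractf)
      \<comment> \<open>The choice c = - \<beta> / b s s minimises the shifted form, and the minimum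
        is exactly the value of \<open>b'\<close> at v.\<close>
      moreover have "0 \<le> (\<Sum>\<Sum>i j. v i * v j * b i j) + 2 * (- \<beta> / b s s) * \<beta> + (- \<beta> / b s s)\<^sup>2 * b s s"
        using shift[of v "- \<beta> / b s s"] unfolding \<beta>_def .
      moreover have "2 * (- \<beta> / b s s) * \<beta> + (- \<beta> / b s s)\<^sup>2 * b s s = - (\<beta>\<^sup>2 / b s s)"
        using pos by (simp add: field_simps power2_eq_square)
      ultimately show ?thesis by linarith
    qed
    have "b' i j = 0" if "i \<notin> S" for i j
    proof (cases "i = s")
      case True then show ?thesis using pos by (simp add: b'_def ww)
    next
      case False
      then have "b i k = 0" for k using supp that by auto
      then show ?thesis using sym[of s i] by (simp add: b'_def ww)
    qed
    then obtain E where E: "\<forall>i j. b' i j = (\<Sum>k\<in>S. E k i * E k j)"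
      using insert.IH[of b'] psd' sym by (auto simp: b'_def mult.commute)
    have "b i j = (\<Sum>k\<in>insert s S. (if k = s then w i else E k i) * (if k = s then w j else E k j))" for i j
    proof -
      have "(\<Sum>k\<in>S. (if k = s then w i else E k i) * (if k = s then w j else E k j)) = b' i j"
        using E insert.hyps by (auto intro!: sum.cong)
      then show ?thesis using insert.hyps by (simp add: b'_def)
    qed
    then show ?thesis by (intro exI[of _ "\<lambda>k i. if k = s then w i else E k i"]) auto
  qed
qed

lemma psd_sum_of_squares:
  fixes b :: "'n::finite \<Rightarrow> 'n \<Rightarrow> real"
  assumes "\<And>i j. b i j = b j i" "\<And>v. 0 \<le> (\<Sum>\<Sum>i j. v i * v j * b i j)"
  obtains E :: "'n \<Rightarrow> 'n \<Rightarrow> real" where "\<And>i j. b i j = (\<Sum>\<Sum>k. E k i * E k j)"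
proof -
  have "\<exists>E :: 'n \<Rightarrow> 'n \<Rightarrow> real. \<forall>i j. b i j = (\<Sum>\<Sum>k. E k i * E k j)"
    by (rule psd_sum_of_squares_on) (use assms in simp_all)
  then show ?thesis using that by blast
qed

section \<open>Inverses of positive definite matrices and their regularity\<close>

lemma matrix_inv_right_left:
  fixes m :: "real ^ 'n ^ 'n"
  assumes "invertible m"
  shows "m ** matrix_inv m = mat 1" "matrix_inv m ** m = mat 1"
proof -
  have "m ** matrix_inv m = mat 1 \<and> matrix_inv m ** m = mat 1"
    using assms unfolding invertible_def matrix_inv_def by (rule someI_ex)
  then show "m ** matrix_inv m = mat 1" "matrix_inv m ** m = mat 1" by auto
qed

lemma posdef_matrix_inv:
  fixes m :: "real ^ 'n ^ 'n"
  assumes sym: "\<And>i j. m $ i $ j = m $ j $ i"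
    and pos: "\<And>v. v \<noteq> (\<lambda>_. 0) \<Longrightarrow> 0 < (\<Sum>\<Sum>i j. v i * v j * m $ i $ j)"
  shows "invertible m"
    and "\<And>i j. (\<Sum>\<Sum>k. m $ i $ k * matrix_inv m $ k $ j) = (if i = j then 1 else 0)"
    and "\<And>i j. (\<Sum>\<Sum>k. matrix_inv m $ i $ k * m $ k $ j) = (if i = j then 1 else 0)"
    and "\<And>i j. matrix_inv m $ i $ j = matrix_inv m $ j $ i"
    and "\<And>v. 0 \<le> (\<Sum>\<Sum>i j. v i * v j * matrix_inv m $ i $ j)"
proof -
  have "x = 0" if "m *v x = 0" for x
  proof (rule ccontr)
    assume "x \<noteq> 0"
    then have "(\<lambda>i. x $ i) \<noteq> (\<lambda>_. 0)" by (auto simp: vec_eq_iff fun_eq_iff)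
    from pos[OF this] have "0 < (\<Sum>\<Sum>i. x $ i * (m *v x) $ i)"
      by (simp add: matrix_vector_mult_def sum_distrib_left mult_ac)
    then show False using that by simp
  qed
  then show inv: "invertible m"
    using matrix_left_invertible_ker[of m] invertible_left_inverse[of m] by blast
  have r: "m ** matrix_inv m = mat 1" and l: "matrix_inv m ** m = mat 1"
    using inv by (simp_all add: matrix_inv_right_left)
  show R: "(\<Sum>\<Sum>k. m $ i $ k * matrix_inv m $ k $ j) = (if i = j then 1 else 0)" for i j
    using r unfolding matrix_matrix_mult_def mat_def by (auto simp: vec_eq_iff)
  show "(\<Sum>\<Sum>k. matrix_inv m $ i $ k * m $ k $ j) = (if i = j then 1 else 0)" for i j
    using l unfolding matrix_matrix_mult_def mat_def by (auto simp: vec_eq_iff)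
  have tm: "transpose m = m" using sym by (simp add: transpose_def vec_eq_iff)
  have "transpose (matrix_inv m) ** m = mat 1"
    using arg_cong[OF r, of transpose] by (simp add: matrix_transpose_mul tm transpose_mat)
  then have "transpose (matrix_inv m) = matrix_inv m"
    by (metis matrix_mul_assoc matrix_mul_lid matrix_mul_rid r)
  then show S: "matrix_inv m $ i $ j = matrix_inv m $ j $ i" for i j
    unfolding transpose_def vec_eq_iff by simp
  show "0 \<le> (\<Sum>\<Sum>i j. v i * v j * matrix_inv m $ i $ j)" for v
  proof -
    \<comment> \<open>With w = m^-1 v, the inverse form at v equals the form of m at w, which is
      nonnegative.\<close>
    define w where "w = (\<lambda>k. \<Sum>\<Sum>j. matrix_inv m $ k $ j * v j)"
    have mw: "(\<Sum>\<Sum>k. m $ i $ k * w k) = v i" for i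
    proof -
      have "(\<Sum>\<Sum>k. m $ i $ k * w k) = (\<Sum>\<Sum>j. (\<Sum>\<Sum>k. m $ i $ k * matrix_inv m $ k $ j) * v j)"
        unfolding w_def sum_distrib_left sum_distrib_right by (subst sum.swap) (simp add: mult_ac)
      also have "\<dots> = v i" by (simp add: R if_distrib[of "\<lambda>x. x * _"] cong: if_cong)
      finally show ?thesis .
    qed
    have "(\<Sum>\<Sum>i j. v i * v j * matrix_inv m $ i $ j) = (\<Sum>\<Sum>i. w i * v i)"
      unfolding w_def sum_distrib_right by (intro sum.cong refl) (simp add: mult_ac)
    also have "\<dots> = (\<Sum>\<Sum>i k. w i * w k * m $ i $ k)"
      by (subst mw[symmetric]) (simp add: sum_distrib_left mult_ac)
    also have "\<dots> \<ge> 0"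
      using pos[of w] by (cases "w = (\<lambda>_. 0)") (auto simp: less_imp_le)
    finally show ?thesis .
  qed
qed

text \<open>Each entry of the inverse is a quotient of polynomials in the entries of m. Continuity,
  smoothness in space and differentiability in time of the cometric are all read off from
  this.\<close>

lemma matrix_inv_cramer:
  fixes m :: "real ^ 'n ^ 'n"
  assumes "invertible m"
  shows "matrix_inv m $ i $ j = det (\<chi> p q. if q = i then (if p = j then 1 else 0) else m $ p $ q) / det m"
proof -
  have d: "det m \<noteq> 0" using assms invertible_det_nz by blast
  have "m *v (\<chi> k. matrix_inv m $ k $ j) = axis j 1"
    using matrix_inv_right_left(1)[OF assms]
    by (auto simp: matrix_matrix_mult_def matrix_vector_mult_def mat_def vec_eq_iff axis_def)
  then have "(\<chi> k. matrix_inv m $ k $ j) = (\<chi> k. det (\<chi> p q. if q = k then axis j 1 $ p else m $ p $ q) / det m)"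
    using cramer[OF d] by blast
  then have eq: "matrix_inv m $ i $ j = det (\<chi> p q. if q = i then axis j 1 $ p else m $ p $ q) / det m"
    by (simp add: vec_eq_iff)
  have ax: "axis j (1::real) $ p = (if p = j then 1 else 0)" for p by (simp add: axis_def)
  show ?thesis using eq unfolding ax .
qed

lemma continuous_on_matrix_inv:
  fixes m :: "'a::topological_space \<Rightarrow> real ^ 'n ^ 'n"
  assumes "\<And>i j. continuous_on S (\<lambda>x. m x $ i $ j)" "\<And>x. x \<in> S \<Longrightarrow> invertible (m x)"
  shows "continuous_on S (\<lambda>x. matrix_inv (m x) $ i $ j)"
proof -
  have "continuous_on S (\<lambda>x. if b then c else m x $ i $ j)" for b c i j
    using assms(1) by (cases b) auto
  then have "continuous_on S (\<lambda>x. det (\<chi> p q. if q = i then (if p = j then 1 else 0) else m x $ p $ q))"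
    unfolding det_def by (auto intro!: continuous_on_sum continuous_on_mult continuous_on_prod continuous_on_const)
  moreover have "continuous_on S (\<lambda>x. det (m x))"
    unfolding det_def by (intro continuous_on_sum continuous_on_mult continuous_on_prod continuous_on_const assms)
  ultimately have "continuous_on S (\<lambda>x. det (\<chi> p q. if q = i then (if p = j then 1 else 0) else m x $ p $ q) / det (m x))"
    using assms invertible_det_nz by (intro continuous_on_divide) auto
  then show ?thesis
    by (rule continuous_on_eq) (simp add: matrix_inv_cramer[OF assms(2)])
qed

lemma Cinf_on_matrix_inv:
  fixes m :: "'a::euclidean_space \<Rightarrow> real ^ 'n ^ 'n"
  assumes S: "open S" and m: "\<And>i j. Cinf_on S (\<lambda>x. m x $ i $ j)" "\<And>x. x \<in> S \<Longrightarrow> invertible (m x)"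
  shows "Cinf_on S (\<lambda>x. matrix_inv (m x) $ i $ j)"
proof -
  have "Cinf_on S (\<lambda>x. if b then c else m x $ i $ j)" for b c i j
    using m(1) Cinf_on_const[OF S] by (cases b) auto
  then have "Cinf_on S (\<lambda>x. det (\<chi> p q. if q = i then (if p = j then 1 else 0) else m x $ p $ q))"
    unfolding det_def by (simp add: Cinf_on_sum Cinf_on_cmult Cinf_on_prod S)
  moreover have "Cinf_on S (\<lambda>x. 1 / det (m x))"
  proof (rule Cinf_on_recip)
    show "Cinf_on S (\<lambda>x. det (m x))"
      unfolding det_def by (simp add: Cinf_on_sum Cinf_on_cmult Cinf_on_prod S m)
  qed (use m invertible_det_nz in auto)
  ultimately have "Cinf_on S (\<lambda>x. det (\<chi> p q. if q = i then (if p = j then 1 else 0) else m x $ p $ q) * (1 / det (m x)))"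
    by (rule Cinf_on_mult)
  then show ?thesis
    by (subst Cinf_on_cong) (simp_all add: matrix_inv_cramer[OF m(2)])
qed

text \<open>Only the existence of a derivative; its value is found later by differentiating the
  product of the matrix with its inverse.\<close>

lemma differentiable_matrix_inv:
  fixes m :: "real \<Rightarrow> real ^ 'n ^ 'n"
  assumes m: "\<And>i j. (\<lambda>t. m t $ i $ j) differentiable (at t within S)" "\<And>t. t \<in> S \<Longrightarrow> invertible (m t)" and t: "t \<in> S"
  shows "(\<lambda>t. matrix_inv (m t) $ i $ j) differentiable (at t within S)"
proof -
  have prod: "(\<lambda>t. \<Prod>i\<in>I. f i t) differentiable (at t within S)"
    if "\<And>i. f i differentiable (at t within S)" for f :: "'n \<Rightarrow> real \<Rightarrow> real" and I
    using that by (induction I rule: infinite_finite_induct) (auto intro: differentiable_mult)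
  have "(\<lambda>t. if b then c else m t $ i $ j) differentiable (at t within S)" for b c i j
    using m(1) by (cases b) auto
  then have "(\<lambda>t. det (\<chi> p q. if q = i then (if p = j then 1 else 0) else m t $ p $ q) / det (m t)) differentiable (at t within S)"
    using m t unfolding det_def
    by (intro differentiable_divide differentiable_sum ballI differentiable_mult differentiable_const)
       (simp_all add: prod invertible_det_nz flip: det_def)
  then obtain D where "((\<lambda>t. det (\<chi> p q. if q = i then (if p = j then 1 else 0) else m t $ p $ q) / det (m t)) has_derivative D) (at t within S)"
    unfolding differentiable_def by blast
  then have "((\<lambda>t. matrix_inv (m t) $ i $ j) has_derivative D) (at t within S)"
    by (rule has_derivative_transform[OF t, rotated]) (rule matrix_inv_cramer[OF m(2)])
  then show ?thesis unfolding differentiable_def by blast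
qed

section \<open>Contractions in an orthonormal frame\<close>

text \<open>When the cometric is written as b i j = sum over k of E k i E k j, the rows of
  \<open>E\<close> are the coordinates of an orthonormal frame e_p, and \<open>frame1 E x p\<close>
  is the value of the covector x on e_p. \<open>frame2\<close> and \<open>frame3\<close> do the same
  for covariant tensors of rank two and three.\<close>

definition frame1 :: "('n::finite \<Rightarrow> 'n \<Rightarrow> real) \<Rightarrow> ('n \<Rightarrow> real) \<Rightarrow> 'n \<Rightarrow> real" where
  "frame1 E x p = (\<Sum>\<Sum>i. E p i * x i)"

definition frame2 :: "('n::finite \<Rightarrow> 'n \<Rightarrow> real) \<Rightarrow> ('n \<Rightarrow> 'n \<Rightarrow> real) \<Rightarrow> 'n \<Rightarrow> 'n \<Rightarrow> real" where
  "frame2 E X p q = frame1 E (\<lambda>i. frame1 E (X i) q) p"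

definition frame3 :: "('n::finite \<Rightarrow> 'n \<Rightarrow> real) \<Rightarrow> ('n \<Rightarrow> 'n \<Rightarrow> 'n \<Rightarrow> real) \<Rightarrow> 'n \<Rightarrow> 'n \<Rightarrow> 'n \<Rightarrow> real" where
  "frame3 E X p q r = frame1 E (\<lambda>i. frame2 E (X i) q r) p"

lemma frame1_sum: "frame1 E (\<lambda>i. \<Sum>k\<in>I. X i k) p = (\<Sum>k\<in>I. frame1 E (\<lambda>i. X i k) p)"
  unfolding frame1_def sum_distrib_left by (rule sum.swap)

lemma frame1_swap: "frame1 E (\<lambda>i. frame1 E (X i) q) p = frame1 E (\<lambda>j. frame1 E (\<lambda>i. X i j) p) q"
  unfolding frame1_def sum_distrib_left by (subst sum.swap) (simp add: mult_ac)

lemma frame2_sym: "(\<And>i j. X i j = X j i) \<Longrightarrow> frame2 E X p q = frame2 E X q p"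
  unfolding frame2_def by (subst frame1_swap) simp

context
  fixes b E :: "'n::finite \<Rightarrow> 'n \<Rightarrow> real"
  assumes b: "\<And>i j. b i j = (\<Sum>\<Sum>k. E k i * E k j)"
begin

text \<open>Inserting the decomposition of b turns a contraction with the cometric into a plain sum
  over frame components. The versions of higher rank keep the sums nested pair by pair, so that this
  one can be applied to each index pair in turn.\<close>

lemma contract1: "(\<Sum>\<Sum>i j. b i j * (x i * y j)) = (\<Sum>\<Sum>p. frame1 E x p * frame1 E y p)"
proof -
  have "(\<Sum>\<Sum>i j. b i j * (x i * y j)) = (\<Sum>\<Sum>i j p. (E p i * x i) * (E p j * y j))"
    unfolding b sum_distrib_right by (simp add: mult_ac)
  also have "\<dots> = (\<Sum>\<Sum>p i j. (E p i * x i) * (E p j * y j))"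
    by (rule sum_rotate)
  finally show ?thesis unfolding frame1_def sum_product .
qed

lemma contract1_diag: "(\<Sum>\<Sum>i j. b i j * X i j) = (\<Sum>\<Sum>p. frame2 E X p p)"
proof -
  have "(\<Sum>\<Sum>i j. b i j * X i j) = (\<Sum>\<Sum>i p j. E p i * (E p j * X i j))"
    unfolding b sum_distrib_right by (rule sum.cong[OF refl], subst sum.swap) (simp add: mult_ac)
  also have "\<dots> = (\<Sum>\<Sum>p i j. E p i * (E p j * X i j))"
    by (rule sum.swap)
  finally show ?thesis unfolding frame2_def frame1_def sum_distrib_left .
qed

lemma contract2:
  "(\<Sum>\<Sum>i k. b i k * (\<Sum>\<Sum>j l. b j l * (X i j * Y k l)))
    = (\<Sum>\<Sum>p q. frame2 E X p q * frame2 E Y p q)"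
proof -
  have "(\<Sum>\<Sum>i k. b i k * (\<Sum>\<Sum>j l. b j l * (X i j * Y k l)))
     = (\<Sum>\<Sum>i k q. b i k * (frame1 E (X i) q * frame1 E (Y k) q))"
    unfolding contract1 sum_distrib_left ..
  also have "\<dots> = (\<Sum>\<Sum>q i k. b i k * (frame1 E (X i) q * frame1 E (Y k) q))"
    by (rule sum_rotate)
  also have "\<dots> = (\<Sum>\<Sum>q p. frame2 E X p q * frame2 E Y p q)"
    unfolding contract1 frame2_def ..
  finally show ?thesis by (subst sum.swap)
qed

lemma contract3:
  "(\<Sum>\<Sum>i i'. b i i' * (\<Sum>\<Sum>j j'. b j j' * (\<Sum>\<Sum>k k'. b k k' * (X i j k * Y i' j' k'))))
    = (\<Sum>\<Sum>p q r. frame3 E X p q r * frame3 E Y p q r)"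
proof -
  have "(\<Sum>\<Sum>i i'. b i i' * (\<Sum>\<Sum>j j'. b j j' * (\<Sum>\<Sum>k k'. b k k' * (X i j k * Y i' j' k'))))
     = (\<Sum>\<Sum>i i' q r. b i i' * (frame2 E (X i) q r * frame2 E (Y i') q r))"
    by (simp only: contract2) (simp only: sum_distrib_left)
  also have "\<dots> = (\<Sum>\<Sum>q r i i'. b i i' * (frame2 E (X i) q r * frame2 E (Y i') q r))"
    by (rule sum_swap_pairs)
  also have "\<dots> = (\<Sum>\<Sum>q r p. frame3 E X p q r * frame3 E Y p q r)"
    unfolding contract1 frame3_def ..
  also have "\<dots> = (\<Sum>\<Sum>q p r. frame3 E X p q r * frame3 E Y p q r)"
    by (rule sum.cong[OF refl], rule sum.swap)
  finally show ?thesis by (subst sum.swap)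
qed

text \<open>As a is inverse to b, the matrix a E^T is a left inverse of the square matrix E, hence
  also a right inverse; E a E^T = 1 says that the rows of E are orthonormal for a.\<close>

lemma frame_orthonormal:
  assumes ab: "\<And>i j. (\<Sum>\<Sum>k. a i k * b k j) = (if i = j then 1 else 0)"
  shows "(\<Sum>\<Sum>i j. a i j * ((\<Sum>\<Sum>p. E p i * c p) * (\<Sum>\<Sum>q. E q j * d q))) = (\<Sum>\<Sum>p. c p * d p)"
proof -
  define Am Em :: "real ^ 'n ^ 'n" where "Am = (\<chi> i j. a i j)" and "Em = (\<chi> p i. E p i)"
  have "(Am ** transpose Em) ** Em = mat 1"
  proof -
    have "(transpose Em ** Em) $ i $ j = b i j" for i j
      unfolding b by (simp add: Em_def matrix_matrix_mult_def transpose_def)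
    then have "(Am ** (transpose Em ** Em)) $ i $ j = (mat 1 :: real ^ 'n ^ 'n) $ i $ j" for i j
      using ab[of i j] by (simp add: Am_def matrix_matrix_mult_def mat_def)
    then show ?thesis by (simp add: vec_eq_iff matrix_mul_assoc)
  qed
  then have "Em ** (Am ** transpose Em) = mat 1"
    using matrix_left_right_inverse by blast
  then have on: "(\<Sum>\<Sum>i. E p i * (\<Sum>\<Sum>j. a i j * E q j)) = (if p = q then 1 else 0)" for p q
    unfolding Am_def Em_def matrix_matrix_mult_def transpose_def mat_def by (auto simp: vec_eq_iff)
  have "(\<Sum>\<Sum>i j. a i j * ((\<Sum>\<Sum>p. E p i * c p) * (\<Sum>\<Sum>q. E q j * d q)))
     = (\<Sum>\<Sum>i j p q. c p * d q * (E p i * (a i j * E q j)))"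
    by (simp only: sum_product) (simp only: sum_distrib_left mult_ac)
  also have "\<dots> = (\<Sum>\<Sum>p q i j. c p * d q * (E p i * (a i j * E q j)))"
    by (rule sum_swap_pairs)
  also have "\<dots> = (\<Sum>\<Sum>p q. c p * d q * (\<Sum>\<Sum>i. E p i * (\<Sum>\<Sum>j. a i j * E q j)))"
    by (simp add: sum_distrib_left)
  also have "\<dots> = (\<Sum>\<Sum>p. c p * d p)"
    unfolding on by (simp add: if_distrib[of "\<lambda>x. _ * x"] cong: if_cong)
  finally show ?thesis .
qed

end

section \<open>Norm estimates\<close>

text \<open>It is enough that each row, of squared length m, has length at most K. The values of the
  form at row i plus and minus s e_i differ by 4 s m, while the squared lengths of these two vectors
  add up to 2 (m + s^2).\<close>

lemma frobenius_bound:
  fixes h :: "'n::finite \<Rightarrow> 'n \<Rightarrow> real"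
  assumes sym: "\<And>i j. h i j = h j i" and K: "K \<ge> 0"
    and bnd: "\<And>v. \<bar>\<Sum>\<Sum>i j. v i * v j * h i j\<bar> \<le> K * (\<Sum>\<Sum>i. (v i)\<^sup>2)"
  shows "(\<Sum>\<Sum>i j. (h i j)\<^sup>2) \<le> real CARD('n) * K\<^sup>2"
proof -
  have "(\<Sum>\<Sum>j. (h i j)\<^sup>2) \<le> K\<^sup>2" for i
  proof -
    define m where "m = (\<Sum>\<Sum>j. (h i j)\<^sup>2)"
    define q where "q v = (\<Sum>\<Sum>k j. v k * v j * h k j)" for v
    have m0: "m \<ge> 0" unfolding m_def by (simp add: sum_nonneg)
    have mm: "(\<Sum>\<Sum>j. h i j * h i j) = m" by (simp add: m_def power2_eq_square)
    have key: "4 * s * m \<le> 2 * K * (s\<^sup>2 + m)" for s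
    proof -
      define v where "v c j = h i j + (if j = i then c else 0)" for c j
      have qv: "q (v c) = q (h i) + 2 * c * m + c\<^sup>2 * h i i" for c
        unfolding q_def v_def quadratic_form_shift[OF sym] mm ..
      have nv: "(\<Sum>\<Sum>j. (v c j)\<^sup>2) = m + 2 * c * h i i + c\<^sup>2" for c
      proof -
        have "(\<Sum>\<Sum>j. (v c j)\<^sup>2) = (\<Sum>\<Sum>j. (h i j)\<^sup>2 + (if j = i then 2 * c * h i i + c\<^sup>2 else 0))"
          unfolding v_def by (intro sum.cong refl) (auto simp: power2_eq_square algebra_simps)
        then show ?thesis by (simp add: sum.distrib m_def)
      qed
      have "q (v s) \<le> K * (m + 2 * s * h i i + s\<^sup>2)" "- q (v (-s)) \<le> K * (m - 2 * s * h i i + s\<^sup>2)"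
        using bnd[of "v s"] bnd[of "v (-s)"] nv[of s] nv[of "-s"] unfolding q_def by auto
      then have "q (v s) - q (v (-s)) \<le> K * (m + 2 * s * h i i + s\<^sup>2) + K * (m - 2 * s * h i i + s\<^sup>2)" by linarith
      then show ?thesis using qv[of s] qv[of "-s"] by (simp add: algebra_simps)
    qed
    have "m \<le> K\<^sup>2"
    proof (cases "m = 0")
      case False
      then have "m > 0" using m0 by simp
      \<comment> \<open>s = sqrt m balances the two terms s^2 and m.\<close>
      have "4 * sqrt m * m \<le> 2 * K * (m + m)" using key[of "sqrt m"] m0 by simp
      then have "sqrt m * m \<le> K * m" by simp
      then have "sqrt m \<le> K" using \<open>m > 0\<close> by simp
      then have "(sqrt m)\<^sup>2 \<le> K\<^sup>2" using m0 by (intro power_mono) auto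
      then show ?thesis using m0 by simp
    qed (use K in simp)
    then show ?thesis by (simp add: m_def)
  qed
  from sum_mono[of UNIV, OF this] show ?thesis by simp
qed

lemma sum_diag_square_le:
  fixes X :: "'n::finite \<Rightarrow> 'n \<Rightarrow> real"
  shows "(\<Sum>\<Sum>p. X p p)\<^sup>2 \<le> real CARD('n) * (\<Sum>\<Sum>p q. (X p q)\<^sup>2)"
proof -
  have "(\<Sum>\<Sum>p. X p p)\<^sup>2 \<le> real CARD('n) * (\<Sum>\<Sum>p. (X p p)\<^sup>2)"
    using Cauchy_Schwarz_ineq_sum[of "\<lambda>_. 1" "\<lambda>p. X p p" UNIV] by simp
  also have "\<dots> \<le> real CARD('n) * (\<Sum>\<Sum>p q. (X p q)\<^sup>2)"
    by (intro mult_left_mono sum_mono member_le_sum) auto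
  finally show ?thesis .
qed

text \<open>Cauchy-Schwarz twice: for the trace, which costs the factor n under the root, and for
  the pairing of the traced covector with F.\<close>

lemma trace_contraction_bound:
  fixes N :: "'n::finite \<Rightarrow> 'n \<Rightarrow> 'n \<Rightarrow> real"
  assumes N: "(\<Sum>\<Sum>p q r. (N p q r)\<^sup>2) \<le> k\<^sup>2" and k: "k \<ge> 0"
  shows "\<bar>\<Sum>\<Sum>r. (\<Sum>\<Sum>p. N r p p) * F r\<bar> \<le> sqrt (real CARD('n)) * k * sqrt (\<Sum>\<Sum>r. (F r)\<^sup>2)"
proof -
  have "(\<Sum>\<Sum>r. (\<Sum>\<Sum>p. N r p p)\<^sup>2) \<le> (\<Sum>\<Sum>r. real CARD('n) * (\<Sum>\<Sum>p q. (N r p q)\<^sup>2))"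
    by (intro sum_mono sum_diag_square_le)
  also have "\<dots> \<le> real CARD('n) * k\<^sup>2"
    unfolding sum_distrib_left[symmetric] by (intro mult_left_mono N) simp
  finally have 1: "(\<Sum>\<Sum>r. (\<Sum>\<Sum>p. N r p p)\<^sup>2) \<le> real CARD('n) * k\<^sup>2" .
  have "(\<Sum>\<Sum>r. (\<Sum>\<Sum>p. N r p p) * F r)\<^sup>2 \<le> (\<Sum>\<Sum>r. (\<Sum>\<Sum>p. N r p p)\<^sup>2) * (\<Sum>\<Sum>r. (F r)\<^sup>2)"
    by (rule Cauchy_Schwarz_ineq_sum)
  also have "\<dots> \<le> real CARD('n) * k\<^sup>2 * (\<Sum>\<Sum>r. (F r)\<^sup>2)"
    by (intro mult_right_mono 1 sum_nonneg) auto
  finally have "sqrt ((\<Sum>\<Sum>r. (\<Sum>\<Sum>p. N r p p) * F r)\<^sup>2) \<le> sqrt (real CARD('n) * k\<^sup>2 * (\<Sum>\<Sum>r. (F r)\<^sup>2))"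
    by (rule real_sqrt_le_mono)
  then show ?thesis using k by (simp add: real_sqrt_mult)
qed

text \<open>All data live at one point: \<open>a\<close> is the metric, \<open>b\<close> the
  cometric, \<open>H\<close> the Hessian of a function, \<open>f\<close> its differential,
  \<open>F\<close> its gradient and \<open>y\<close> the squared length of the gradient;
  \<open>h\<close> is the time derivative of the metric and \<open>N\<close> the covariant
  derivative of \<open>h\<close>. In an orthonormal frame every contraction is a Euclidean sum, to
  which elementary inequalities apply.\<close>

lemma frame_bounds:
  fixes a b H h :: "'n::finite \<Rightarrow> 'n \<Rightarrow> real" and N :: "'n \<Rightarrow> 'n \<Rightarrow> 'n \<Rightarrow> real" and f F :: "'n \<Rightarrow> real"
  assumes bsym: "\<And>i j. b i j = b j i" and bpsd: "\<And>v. 0 \<le> (\<Sum>\<Sum>i j. v i * v j * b i j)"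
    and ab: "\<And>i j. (\<Sum>\<Sum>k. a i k * b k j) = (if i = j then 1 else 0)"
    and Hsym: "\<And>i j. H i j = H j i" and hsym: "\<And>i j. h i j = h j i"
    and F: "\<And>i. F i = (\<Sum>\<Sum>j. b i j * f j)"
    and K: "K \<ge> 0" and hK: "\<And>v. \<bar>\<Sum>\<Sum>i j. h i j * (v i * v j)\<bar> \<le> K * (\<Sum>\<Sum>i j. a i j * (v i * v j))"
    and k4: "k4 \<ge> 0"
    and N: "sqrt (\<Sum>\<Sum>k i j k' i' j'. b k k' * b i i' * b j j' * N k i j * N k' i' j') \<le> k4"
  defines "y \<equiv> (\<Sum>\<Sum>i. f i * F i)"
    and "n \<equiv> real CARD('n)"
  shows "y \<ge> 0" "(\<Sum>\<Sum>i j. a i j * (F i * F j)) = y"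
    "(\<Sum>\<Sum>l i. (\<Sum>\<Sum>k. b l k * H k i) * (\<Sum>\<Sum>k. b i k * H k l))
      - \<alpha> * (\<Sum>\<Sum>i j. (\<Sum>\<Sum>k l. b i k * h k l * b l j) * H i j)
      \<ge> (\<Sum>\<Sum>i j. b i j * H i j)\<^sup>2 / (2 * n) - \<alpha>\<^sup>2 * n * K\<^sup>2 / 2"
    "\<bar>\<Sum>\<Sum>i j l. b i j * F l * (N i j l - N l i j / 2)\<bar> \<le> 3 / 2 * sqrt n * k4 * sqrt y"
proof -
  obtain E :: "'n \<Rightarrow> 'n \<Rightarrow> real" where b: "\<And>i j. b i j = (\<Sum>\<Sum>k. E k i * E k j)"
    using psd_sum_of_squares[OF bsym bpsd] by blast
  note c1 = contract1[of b, OF b] and c1d = contract1_diag[of b, OF b]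
    and c2 = contract2[of b, OF b] and c3 = contract3[of b, OF b] and on = frame_orthonormal[of b, OF b ab]
  define Ft where "Ft = frame1 E f"
  have FE: "F i = (\<Sum>\<Sum>p. E p i * Ft p)" for i
    unfolding F b Ft_def frame1_def sum_distrib_left sum_distrib_right by (subst sum.swap) (simp add: mult_ac)
  have y: "y = (\<Sum>\<Sum>p. (Ft p)\<^sup>2)"
    using c1[of f f] unfolding y_def F Ft_def power2_eq_square by (simp add: sum_distrib_left mult_ac)
  then show "y \<ge> 0" by (simp add: sum_nonneg)
  show "(\<Sum>\<Sum>i j. a i j * (F i * F j)) = y"
    unfolding FE on y by (simp add: power2_eq_square)
  define Ht ht where "Ht = frame2 E H" and "ht = frame2 E h"
  have Htsym: "Ht p q = Ht q p" for p q unfolding Ht_def by (rule frame2_sym[OF Hsym])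
  have htsym: "ht p q = ht q p" for p q unfolding ht_def by (rule frame2_sym[OF hsym])
  \<comment> \<open>By symmetry of H, the trace of the square of b H is the squared norm of the
    Hessian.\<close>
  have WW: "(\<Sum>\<Sum>l i. (\<Sum>\<Sum>k. b l k * H k i) * (\<Sum>\<Sum>k. b i k * H k l)) = (\<Sum>\<Sum>p q. Ht p q * Ht p q)"
  proof -
    have s1: "(\<Sum>\<Sum>i. (\<Sum>\<Sum>k. b l k * H k i) * (\<Sum>\<Sum>k. b i k * H k l))
       = (\<Sum>\<Sum>k. b l k * (\<Sum>\<Sum>i m. b i m * (H l m * H k i)))" for l
    proof -
      have "(\<Sum>\<Sum>i. (\<Sum>\<Sum>k. b l k * H k i) * (\<Sum>\<Sum>k. b i k * H k l))
        = (\<Sum>\<Sum>i k m. b l k * (b i m * (H l m * H k i)))"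
        unfolding sum_product by (simp add: Hsym[of l] mult_ac)
      also have "\<dots> = (\<Sum>\<Sum>k i m. b l k * (b i m * (H l m * H k i)))"
        by (rule sum.swap)
      finally show ?thesis by (simp add: sum_distrib_left)
    qed
    have s2: "(\<Sum>\<Sum>i m. b i m * (H l m * H k i)) = (\<Sum>\<Sum>i m. b i m * (H l i * H k m))" for l k
      by (subst sum.swap) (simp add: bsym)
    show ?thesis unfolding Ht_def c2[symmetric] s1 s2 ..
  qed
  have bhbH: "(\<Sum>\<Sum>i j. (\<Sum>\<Sum>k l. b i k * h k l * b l j) * H i j) = (\<Sum>\<Sum>p q. Ht p q * ht p q)"
  proof -
    have "(\<Sum>\<Sum>i j. (\<Sum>\<Sum>k l. b i k * h k l * b l j) * H i j)
      = (\<Sum>\<Sum>i j k l. b i k * (b j l * (H i j * h k l)))"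
      unfolding sum_distrib_right by (simp add: bsym mult_ac)
    also have "\<dots> = (\<Sum>\<Sum>i k j l. b i k * (b j l * (H i j * h k l)))"
      by (rule sum.cong[OF refl], rule sum.swap)
    finally show ?thesis unfolding Ht_def ht_def c2[symmetric] by (simp add: sum_distrib_left)
  qed
  have tr: "(\<Sum>\<Sum>i j. b i j * H i j) = (\<Sum>\<Sum>p. Ht p p)"
    unfolding c1d Ht_def ..
  have hnorm: "(\<Sum>\<Sum>p q. (ht p q)\<^sup>2) \<le> n * K\<^sup>2"
    unfolding n_def
  proof (rule frobenius_bound[OF htsym K])
    fix v :: "'n \<Rightarrow> real"
    define V where "V i = (\<Sum>\<Sum>p. E p i * v p)" for i
    have "(\<Sum>\<Sum>i j. h i j * (V i * V j)) = (\<Sum>\<Sum>p q. v p * v q * ht p q)"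
    proof -
      have "(\<Sum>\<Sum>i j. h i j * (V i * V j)) = (\<Sum>\<Sum>i j p q. v p * v q * (E p i * (E q j * h i j)))"
        unfolding V_def by (simp only: sum_product) (simp only: sum_distrib_left mult_ac)
      also have "\<dots> = (\<Sum>\<Sum>p q i j. v p * v q * (E p i * (E q j * h i j)))"
        by (rule sum_swap_pairs)
      finally show ?thesis unfolding ht_def frame2_def frame1_def by (simp only: sum_distrib_left)
    qed
    moreover have "(\<Sum>\<Sum>i j. a i j * (V i * V j)) = (\<Sum>\<Sum>p. (v p)\<^sup>2)"
      unfolding V_def on by (simp add: power2_eq_square)
    ultimately show "\<bar>\<Sum>\<Sum>i j. v i * v j * ht i j\<bar> \<le> K * (\<Sum>\<Sum>i. (v i)\<^sup>2)"
      using hK[of V] by simp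
  qed
  show "(\<Sum>\<Sum>l i. (\<Sum>\<Sum>k. b l k * H k i) * (\<Sum>\<Sum>k. b i k * H k l))
      - \<alpha> * (\<Sum>\<Sum>i j. (\<Sum>\<Sum>k l. b i k * h k l * b l j) * H i j)
      \<ge> (\<Sum>\<Sum>i j. b i j * H i j)\<^sup>2 / (2 * n) - \<alpha>\<^sup>2 * n * K\<^sup>2 / 2"
  proof -
    have n: "n > 0" by (simp add: n_def)
    have "(\<Sum>\<Sum>p. Ht p p)\<^sup>2 \<le> n * (\<Sum>\<Sum>p q. (Ht p q)\<^sup>2)"
      unfolding n_def by (rule sum_diag_square_le)
    then have 1: "(\<Sum>\<Sum>p. Ht p p)\<^sup>2 / (2 * n) \<le> (\<Sum>\<Sum>p q. (Ht p q)\<^sup>2) / 2"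
      using n by (simp add: field_simps)
    have 2: "\<alpha>\<^sup>2 * (\<Sum>\<Sum>p q. (ht p q)\<^sup>2) / 2 \<le> \<alpha>\<^sup>2 * n * K\<^sup>2 / 2"
      using mult_left_mono[OF hnorm, of "\<alpha>\<^sup>2"] by (simp add: mult.assoc)
    \<comment> \<open>Half of the squared Hessian absorbs the mixed term; the other half is what
      yields the squared trace over 2 n.\<close>
    have "Ht p q * Ht p q - \<alpha> * (Ht p q * ht p q) \<ge> (Ht p q)\<^sup>2 / 2 - \<alpha>\<^sup>2 * (ht p q)\<^sup>2 / 2" for p q
    proof -
      have "0 \<le> (Ht p q - \<alpha> * ht p q)\<^sup>2" by simp
      then show ?thesis by (simp add: power2_eq_square algebra_simps)
    qed
    then have "(\<Sum>\<Sum>p q. (Ht p q)\<^sup>2 / 2 - \<alpha>\<^sup>2 * (ht p q)\<^sup>2 / 2) \<le> (\<Sum>\<Sum>p q. Ht p q * Ht p q - \<alpha> * (Ht p q * ht p q))"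
      by (intro sum_mono)
    then have "(\<Sum>\<Sum>p q. (Ht p q)\<^sup>2) / 2 - \<alpha>\<^sup>2 * (\<Sum>\<Sum>p q. (ht p q)\<^sup>2) / 2
       \<le> (\<Sum>\<Sum>p q. Ht p q * Ht p q) - \<alpha> * (\<Sum>\<Sum>p q. Ht p q * ht p q)"
      by (simp only: sum_subtractf sum_distrib_left sum_divide_distrib)
    with 1 2 show ?thesis unfolding WW bhbH tr by linarith
  qed
  define Nt where "Nt = frame3 E N"
  have Nn: "(\<Sum>\<Sum>p q r. (Nt p q r)\<^sup>2) \<le> k4\<^sup>2"
  proof -
    let ?f = "\<lambda>k i j k' i' j'. b k k' * b i i' * b j j' * N k i j * N k' i' j'"
    let ?g = "\<lambda>k i j k' i' j'. b k k' * (b i i' * (b j j' * (N k i j * N k' i' j')))"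
    have "(\<Sum>\<Sum>k i j k' i' j'. ?f k i j k' i' j')
      = (\<Sum>\<Sum>k i k' j i' j'. ?g k i j k' i' j')"
      unfolding mult.assoc by (rule sum.cong[OF refl], rule sum.cong[OF refl], rule sum.swap)
    also have "\<dots> = (\<Sum>\<Sum>k k' i j i' j'. ?g k i j k' i' j')"
      by (rule sum.cong[OF refl], rule sum.swap)
    also have "\<dots> = (\<Sum>\<Sum>k k' i i' j j'. ?g k i j k' i' j')"
      by (rule sum.cong[OF refl], rule sum.cong[OF refl], rule sum.cong[OF refl], rule sum.swap)
    also have "\<dots> = (\<Sum>\<Sum>p q r. Nt p q r * Nt p q r)"
      unfolding Nt_def c3[symmetric] by (simp only: sum_distrib_left)
    finally have "sqrt (\<Sum>\<Sum>p q r. (Nt p q r)\<^sup>2) \<le> k4"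
      using N by (simp add: power2_eq_square)
    then show ?thesis by (rule sqrt_le_D)
  qed
  \<comment> \<open>For any M, the trace over the first two slots is paired with the gradient. The
    two instances are the divergence of h and, with slots permuted, the differential of its
    trace.\<close>
  have A: "(\<Sum>\<Sum>i j l. b i j * (F l * M i j l)) = (\<Sum>\<Sum>r. (\<Sum>\<Sum>p. frame3 E (\<lambda>l i j. M i j l) r p p) * Ft r)" for M
  proof -
    have "(\<Sum>\<Sum>i j l. b i j * (F l * M i j l)) = (\<Sum>\<Sum>l i j. b i j * (F l * M i j l))"
      by (rule sum_rotate)
    also have "\<dots> = (\<Sum>\<Sum>l. F l * (\<Sum>\<Sum>i j. b i j * M i j l))"
      by (simp only: sum_distrib_left mult_ac)
    also have "\<dots> = (\<Sum>\<Sum>l. (\<Sum>\<Sum>r. E r l * Ft r) * (\<Sum>\<Sum>p. frame2 E (\<lambda>i j. M i j l) p p))"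
      unfolding c1d FE ..
    also have "\<dots> = (\<Sum>\<Sum>l r. Ft r * (E r l * (\<Sum>\<Sum>p. frame2 E (\<lambda>i j. M i j l) p p)))"
      by (simp only: sum_distrib_right mult_ac)
    also have "\<dots> = (\<Sum>\<Sum>r l. Ft r * (E r l * (\<Sum>\<Sum>p. frame2 E (\<lambda>i j. M i j l) p p)))"
      by (rule sum.swap)
    also have "\<dots> = (\<Sum>\<Sum>r. frame1 E (\<lambda>l. \<Sum>\<Sum>p. frame2 E (\<lambda>i j. M i j l) p p) r * Ft r)"
      by (simp only: sum_distrib_left[symmetric] mult.commute
          frame1_def[of E "\<lambda>l. \<Sum>\<Sum>p. frame2 E (\<lambda>i j. M i j l) p p"])
    finally show ?thesis unfolding frame3_def frame1_sum .
  qed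
  have r1: "frame3 E (\<lambda>l i j. N i j l) r p p = Nt p p r" for r p
    unfolding Nt_def frame3_def frame2_def
    by (subst frame1_swap, subst (2) frame1_swap, rule refl)
  have t2: "\<bar>\<Sum>\<Sum>r. (\<Sum>\<Sum>p. Nt r p p) * Ft r\<bar> \<le> sqrt n * k4 * sqrt y"
    unfolding n_def y by (rule trace_contraction_bound[OF Nn k4])
  have t1: "\<bar>\<Sum>\<Sum>r. (\<Sum>\<Sum>p. Nt p p r) * Ft r\<bar> \<le> sqrt n * k4 * sqrt y"
  proof -
    have "(\<Sum>\<Sum>p q r. (Nt q r p)\<^sup>2) = (\<Sum>\<Sum>q p r. (Nt q r p)\<^sup>2)"
      by (rule sum.swap)
    also have "\<dots> = (\<Sum>\<Sum>q r p. (Nt q r p)\<^sup>2)"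
      by (rule sum.cong[OF refl], rule sum.swap)
    finally have "(\<Sum>\<Sum>p q r. (Nt q r p)\<^sup>2) \<le> k4\<^sup>2" using Nn by simp
    from trace_contraction_bound[of "\<lambda>p q r. Nt q r p", OF this k4] show ?thesis
      unfolding n_def y .
  qed
  have "(\<Sum>\<Sum>i j l. b i j * F l * (N i j l - N l i j / 2))
     = (\<Sum>\<Sum>i j l. b i j * (F l * N i j l)) - (\<Sum>\<Sum>i j l. b i j * (F l * N l i j)) / 2"
    by (simp only: sum_divide_distrib sum_subtractf[symmetric]) (simp add: algebra_simps)
  also have "\<dots> = (\<Sum>\<Sum>r. (\<Sum>\<Sum>p. Nt p p r) * Ft r) - (\<Sum>\<Sum>r. (\<Sum>\<Sum>p. Nt r p p) * Ft r) / 2"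
    unfolding A r1 Nt_def ..
  \<comment> \<open>The divergence contributes 1 and half the differential of the trace contributes
    1/2, whence 3/2.\<close>
  finally show "\<bar>\<Sum>\<Sum>i j l. b i j * F l * (N i j l - N l i j / 2)\<bar> \<le> 3 / 2 * sqrt n * k4 * sqrt y"
    using t1 t2 by (simp add: abs_if split: if_splits)
qed

section \<open>Riemannian geometry in a coordinate domain\<close>

abbreviation pd :: "'n::finite \<Rightarrow> (real ^ 'n \<Rightarrow> real) \<Rightarrow> real ^ 'n \<Rightarrow> real" where
  "pd i f x \<equiv> ddir (axis i 1) f x"

text \<open>From here on the geometry is that of a matrix-valued metric \<open>a\<close> on an open
  subset of R^n, to which the calculus of \<open>Cinf_on\<close> applies directly. The chart notions
  of the theorem are matched with these formulas afterwards.\<close>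

definition Gam :: "(real ^ 'n \<Rightarrow> real ^ 'n ^ 'n) \<Rightarrow> 'n::finite \<Rightarrow> 'n \<Rightarrow> 'n \<Rightarrow> real ^ 'n \<Rightarrow> real" where
  "Gam a k i j x = (1/2) * (\<Sum>\<Sum>l. matrix_inv (a x) $ k $ l *
     (pd i (\<lambda>y. a y $ j $ l) x + pd j (\<lambda>y. a y $ i $ l) x - pd l (\<lambda>y. a y $ i $ j) x))"

definition Rm :: "(real ^ 'n \<Rightarrow> real ^ 'n ^ 'n) \<Rightarrow> 'n::finite \<Rightarrow> 'n \<Rightarrow> 'n \<Rightarrow> 'n \<Rightarrow> real ^ 'n \<Rightarrow> real" where
  "Rm a l k i j x = pd i (Gam a l j k) x - pd j (Gam a l i k) x
     + (\<Sum>\<Sum>m. Gam a l i m x * Gam a m j k x - Gam a l j m x * Gam a m i k x)"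

definition Hs :: "(real ^ 'n \<Rightarrow> real ^ 'n ^ 'n) \<Rightarrow> (real ^ 'n \<Rightarrow> real) \<Rightarrow> 'n::finite \<Rightarrow> 'n \<Rightarrow> real ^ 'n \<Rightarrow> real" where
  "Hs a f i j x = pd i (pd j f) x - (\<Sum>\<Sum>k. Gam a k i j x * pd k f x)"

definition Lap :: "(real ^ 'n \<Rightarrow> real ^ 'n ^ 'n) \<Rightarrow> (real ^ 'n::finite \<Rightarrow> real) \<Rightarrow> real ^ 'n \<Rightarrow> real" where
  "Lap a f x = (\<Sum>\<Sum>i j. matrix_inv (a x) $ i $ j * Hs a f i j x)"

definition gradv :: "(real ^ 'n \<Rightarrow> real ^ 'n ^ 'n) \<Rightarrow> (real ^ 'n \<Rightarrow> real) \<Rightarrow> 'n::finite \<Rightarrow> real ^ 'n \<Rightarrow> real" where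
  "gradv a f i x = (\<Sum>\<Sum>j. matrix_inv (a x) $ i $ j * pd j f x)"

definition grad2 :: "(real ^ 'n \<Rightarrow> real ^ 'n ^ 'n) \<Rightarrow> (real ^ 'n::finite \<Rightarrow> real) \<Rightarrow> real ^ 'n \<Rightarrow> real" where
  "grad2 a f x = (\<Sum>\<Sum>i. pd i f x * gradv a f i x)"

text \<open>With one index up and one down, traces and products of this tensor involve no metric.
  Once \<open>pd_gradv\<close> is known, the Bochner formula takes no further derivative of the
  cometric.\<close>

definition Wm :: "(real ^ 'n \<Rightarrow> real ^ 'n ^ 'n) \<Rightarrow> (real ^ 'n \<Rightarrow> real) \<Rightarrow> 'n::finite \<Rightarrow> 'n \<Rightarrow> real ^ 'n \<Rightarrow> real" where
  "Wm a f i j x = (\<Sum>\<Sum>k. matrix_inv (a x) $ i $ k * Hs a f k j x)"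

text \<open>Multiplying (b a)' = 0 by b from the right isolates b'. The arrays are abstract because
  the spatial and the time derivative of the cometric are both obtained this way.\<close>

lemma inverse_derivative_algebra:
  fixes a b da db :: "'n::finite \<Rightarrow> 'n \<Rightarrow> real"
  assumes "\<And>i j. (\<Sum>\<Sum>m. b i m * da m j + db i m * a m j) = 0"
    and ab: "\<And>i j. (\<Sum>\<Sum>k. a i k * b k j) = (if i = j then 1 else 0)"
  shows "db i q = - (\<Sum>\<Sum>m j. b i m * da m j * b j q)"
proof -
  have "0 = (\<Sum>\<Sum>j. (\<Sum>\<Sum>m. b i m * da m j + db i m * a m j) * b j q)"
    using assms(1) by simp
  also have "\<dots> = (\<Sum>\<Sum>j m. b i m * da m j * b j q) + (\<Sum>\<Sum>j m. db i m * (a m j * b j q))"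
    by (simp add: sum_distrib_right sum.distrib distrib_right mult.assoc)
  also have "(\<Sum>\<Sum>j m. db i m * (a m j * b j q)) = (\<Sum>\<Sum>m. db i m * (\<Sum>\<Sum>j. a m j * b j q))"
    by (subst sum.swap) (simp only: sum_distrib_left)
  also have "\<dots> = db i q"
    unfolding ab by (simp add: if_distrib[of "\<lambda>x. _ * x"] cong: if_cong)
  also have "(\<Sum>\<Sum>j m. b i m * da m j * b j q) = (\<Sum>\<Sum>m j. b i m * da m j * b j q)"
    by (rule sum.swap)
  finally show ?thesis by simp
qed

text \<open>\<open>G\<close> stands for the Christoffel symbols, \<open>dG p k i j\<close> for the
  p-derivative of \<open>G k i j\<close>, \<open>F\<close> for the gradient, \<open>D l m\<close>
  for the l-derivative of \<open>F m\<close>, and \<open>S l i\<close> for the second derivative of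
  \<open>F l\<close> in the directions l and i. The left-hand side is the divergence of the field W
  F; the right-hand side is the derivative of the Laplacian along F, the Ricci term and the trace of
  W W. The second derivatives of F agree on both sides, so only terms with G and dG have to be
  matched.\<close>

lemma bochner_algebra:
  fixes G :: "'n::finite \<Rightarrow> 'n \<Rightarrow> 'n \<Rightarrow> real" and dG :: "'n \<Rightarrow> 'n \<Rightarrow> 'n \<Rightarrow> 'n \<Rightarrow> real"
  assumes Gsym: "\<And>k i j. G k i j = G k j i"
    and D: "\<And>l m. D l m = W m l - (\<Sum>\<Sum>k. G m l k * F k)"
  shows "(\<Sum>\<Sum>l i. W l i * D l i + (S l i + (\<Sum>\<Sum>m. G l i m * D l m + dG l l i m * F m)) * F i)
      + (\<Sum>\<Sum>l m. G l l m * (\<Sum>\<Sum>i. W m i * F i))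
    = (\<Sum>\<Sum>i. F i * (\<Sum>\<Sum>l. S l i + (\<Sum>\<Sum>m. G l l m * D i m + dG i l l m * F m)))
      + (\<Sum>\<Sum>j k. (\<Sum>\<Sum>i. dG i i j k - dG j i i k + (\<Sum>\<Sum>m. G i i m * G m j k - G i j m * G m i k)) * F j * F k)
      + (\<Sum>\<Sum>l i. W l i * W i l)"
proof -
  have L: "(\<Sum>\<Sum>l i. W l i * D l i + (S l i + (\<Sum>\<Sum>m. G l i m * D l m + dG l l i m * F m)) * F i)
      = (\<Sum>\<Sum>l i. W l i * W i l) - (\<Sum>\<Sum>l i k. W l i * (G i l k * F k))
       + (\<Sum>\<Sum>l i. S l i * F i) + (\<Sum>\<Sum>l i m. W m l * (G l i m * F i))
       - (\<Sum>\<Sum>l i m k. G l i m * G m l k * F i * F k)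
       + (\<Sum>\<Sum>l i m. dG l l i m * F i * F m)"
    unfolding D
    by (simp add: sum.distrib sum_subtractf sum_distrib_left sum_distrib_right distrib_left distrib_right
        left_diff_distrib right_diff_distrib mult_ac)
  \<comment> \<open>Torsion-freeness enters here: after relabelling, the two terms that pair W, G
    and F cancel.\<close>
  have e1: "(\<Sum>\<Sum>l i m. W m l * (G l i m * F i)) = (\<Sum>\<Sum>l i k. W l i * (G i l k * F k))"
  proof -
    have "(\<Sum>\<Sum>l i m. W m l * (G l i m * F i)) = (\<Sum>\<Sum>l m i. W m l * (G l i m * F i))"
      by (rule sum.cong[OF refl], rule sum.swap)
    also have "\<dots> = (\<Sum>\<Sum>m l i. W m l * (G l i m * F i))"
      by (rule sum.swap)
    also have "\<dots> = (\<Sum>\<Sum>m l i. W m l * (G l m i * F i))"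
      by (intro sum.cong refl) (metis Gsym)
    finally show ?thesis .
  qed
  have e2: "(\<Sum>\<Sum>l m. G l l m * (\<Sum>\<Sum>i. W m i * F i)) = (\<Sum>\<Sum>i l m. F i * (G l l m * W m i))"
  proof -
    have "(\<Sum>\<Sum>l m. G l l m * (\<Sum>\<Sum>i. W m i * F i)) = (\<Sum>\<Sum>l m i. F i * (G l l m * W m i))"
      by (simp add: sum_distrib_left mult_ac)
    also have "\<dots> = (\<Sum>\<Sum>l i m. F i * (G l l m * W m i))"
      by (rule sum.cong[OF refl], rule sum.swap)
    also have "\<dots> = (\<Sum>\<Sum>i l m. F i * (G l l m * W m i))"
      by (rule sum.swap)
    finally show ?thesis .
  qed
  have R1: "(\<Sum>\<Sum>i. F i * (\<Sum>\<Sum>l. S l i + (\<Sum>\<Sum>m. G l l m * D i m + dG i l l m * F m)))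
    = (\<Sum>\<Sum>i l. S l i * F i) + (\<Sum>\<Sum>i l m. F i * (G l l m * W m i))
      - (\<Sum>\<Sum>i l m k. G l l m * G m i k * F i * F k)
      + (\<Sum>\<Sum>i l m. dG i l l m * F i * F m)"
    unfolding D
    by (simp add: sum.distrib sum_subtractf sum_distrib_left sum_distrib_right distrib_left distrib_right
        left_diff_distrib right_diff_distrib mult_ac)
  have R2: "(\<Sum>\<Sum>j k. (\<Sum>\<Sum>i. dG i i j k - dG j i i k + (\<Sum>\<Sum>m. G i i m * G m j k - G i j m * G m i k)) * F j * F k)
    = (\<Sum>\<Sum>j k i. dG i i j k * F j * F k) - (\<Sum>\<Sum>j k i. dG j i i k * F j * F k)
      + (\<Sum>\<Sum>j k i m. G i i m * G m j k * F j * F k)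
      - (\<Sum>\<Sum>j k i m. G i j m * G m i k * F j * F k)"
    by (simp add: sum.distrib sum_subtractf sum_distrib_left sum_distrib_right distrib_left distrib_right
        left_diff_distrib right_diff_distrib mult_ac)
  have s4: "(\<Sum>\<Sum>i l m k. f i l m k) = (\<Sum>\<Sum>i k l m. f i l m k)"
    for f :: "'n \<Rightarrow> 'n \<Rightarrow> 'n \<Rightarrow> 'n \<Rightarrow> real"
    by (rule sum.cong[OF refl]) (rule sum_rotate)
  have e3: "(\<Sum>\<Sum>l i. S l i * F i) = (\<Sum>\<Sum>i l. S l i * F i)"
    by (rule sum.swap)
  have e4: "(\<Sum>\<Sum>l i m. dG l l i m * F i * F m) = (\<Sum>\<Sum>j k i. dG i i j k * F j * F k)"
    by (rule sum_rotate[symmetric])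
  have e5: "(\<Sum>\<Sum>i l m. dG i l l m * F i * F m) = (\<Sum>\<Sum>j k i. dG j i i k * F j * F k)"
    by (rule sum.cong[OF refl], rule sum.swap)
  have e6: "(\<Sum>\<Sum>i l m k. G l l m * G m i k * F i * F k)
     = (\<Sum>\<Sum>j k i m. G i i m * G m j k * F j * F k)"
    by (rule s4)
  have e7: "(\<Sum>\<Sum>l i m k. G l i m * G m l k * F i * F k)
     = (\<Sum>\<Sum>j k i m. G i j m * G m i k * F j * F k)"
    by (subst sum.swap) (rule s4)
  show ?thesis unfolding L R1 R2 e1 e2 e3 e4 e5 e6 e7 by simp
qed

locale local_metric =
  fixes U :: "(real ^ 'n::finite) set" and a :: "real ^ 'n \<Rightarrow> real ^ 'n ^ 'n"
  assumes U: "open U"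
    and a: "\<And>i j. Cinf_on U (\<lambda>x. a x $ i $ j)"
    and a_sym: "\<And>x i j. x \<in> U \<Longrightarrow> a x $ i $ j = a x $ j $ i"
    and a_pos: "\<And>x v. x \<in> U \<Longrightarrow> v \<noteq> (\<lambda>_. 0) \<Longrightarrow> 0 < (\<Sum>\<Sum>i j. v i * v j * a x $ i $ j)"
begin

abbreviation b :: "'n \<Rightarrow> 'n \<Rightarrow> real ^ 'n \<Rightarrow> real" where "b i j x \<equiv> matrix_inv (a x) $ i $ j"

lemma pd_sym: "x \<in> U \<Longrightarrow> pd k (\<lambda>y. a y $ i $ j) x = pd k (\<lambda>y. a y $ j $ i) x"
  by (rule ddir_cong[OF U]) (auto intro: a_sym)

lemma b_facts:
  assumes "x \<in> U"
  shows "invertible (a x)"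
    "(\<Sum>\<Sum>k. a x $ i $ k * b k j x) = (if i = j then 1 else 0)"
    "(\<Sum>\<Sum>k. b i k x * a x $ k $ j) = (if i = j then 1 else 0)"
    "b i j x = b j i x"
    "0 \<le> (\<Sum>\<Sum>i j. v i * v j * b i j x)"
  using posdef_matrix_inv[OF a_sym a_pos, OF assms assms] by blast+

lemma Cb: "Cinf_on U (b i j)"
  by (rule Cinf_on_matrix_inv[OF U a b_facts(1)])

lemmas Cinf_intros = Cb a U Cinf_on_sum Cinf_on_cmult Cinf_on_mult Cinf_on_add Cinf_on_diff Cinf_on_ddir Cinf_on_const

lemma CGam: "Cinf_on U (Gam a k i j)"
  unfolding Gam_def[abs_def] by (intro Cinf_intros)

lemma Gam_sym:
  assumes "x \<in> U"
  shows "Gam a k i j x = Gam a k j i x"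
proof -
  have "pd l (\<lambda>y. a y $ i $ j) x = pd l (\<lambda>y. a y $ j $ i) x" for l by (rule pd_sym[OF assms])
  then show ?thesis unfolding Gam_def by (simp add: add.commute)
qed

lemmas dif = Cinf_on_differentiable

text \<open>The cometric is parallel. Of the six derivatives of the metric inside the two
  Christoffel terms, four cancel in pairs and the other two coincide by symmetry.\<close>

lemma pd_b:
  assumes x: "x \<in> U"
  shows "pd k (b i j) x = - (\<Sum>\<Sum>l. Gam a i k l x * b l j x) - (\<Sum>\<Sum>l. Gam a j k l x * b i l x)"
proof -
  have "(\<Sum>\<Sum>m. b i m x * pd k (\<lambda>y. a y $ m $ j) x + pd k (b i m) x * a x $ m $ j) = 0" for i j
  proof -
    have "pd k (\<lambda>y. \<Sum>\<Sum>m. b i m y * a y $ m $ j) x = pd k (\<lambda>y. if i = j then 1 else 0) x"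
      by (rule ddir_cong[OF U x]) (rule b_facts)
    then have "pd k (\<lambda>y. \<Sum>\<Sum>m. b i m y * a y $ m $ j) x = 0" by simp
    moreover have "pd k (\<lambda>y. \<Sum>\<Sum>m. b i m y * a y $ m $ j) x = (\<Sum>\<Sum>m. pd k (\<lambda>y. b i m y * a y $ m $ j) x)"
      by (rule ddir_sum) (intro dif[OF _ x] Cinf_intros)
    moreover have "pd k (\<lambda>y. b i m y * a y $ m $ j) x = b i m x * pd k (\<lambda>y. a y $ m $ j) x + pd k (b i m) x * a x $ m $ j" for m
      by (rule ddir_mult) (intro dif[OF _ x] Cinf_intros)+
    ultimately show ?thesis by simp
  qed
  from inverse_derivative_algebra[OF this b_facts(2)[OF x]]
  have 1: "pd k (b i j) x = - (\<Sum>\<Sum>m l. b i m x * pd k (\<lambda>y. a y $ m $ l) x * b l j x)" .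
  let ?A = "\<lambda>k l m. pd k (\<lambda>y. a y $ l $ m) x"
  have g1: "(\<Sum>\<Sum>l. Gam a i k l x * b l j x) = (\<Sum>\<Sum>m l. 1/2 * b i m x * b l j x * (?A k l m + ?A l k m - ?A m k l))"
    unfolding Gam_def sum_distrib_left sum_distrib_right
    by (subst sum.swap) (simp add: mult_ac)
  have g2: "(\<Sum>\<Sum>l. Gam a j k l x * b i l x) = (\<Sum>\<Sum>m l. 1/2 * b i m x * b l j x * (?A k m l + ?A m k l - ?A l k m))"
    unfolding Gam_def sum_distrib_left sum_distrib_right
    by (simp add: b_facts(4)[OF x, of j] mult_ac)
  have "(\<Sum>\<Sum>l. Gam a i k l x * b l j x) + (\<Sum>\<Sum>l. Gam a j k l x * b i l x) = (\<Sum>\<Sum>m l. b i m x * ?A k m l * b l j x)"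
    unfolding g1 g2 sum.distrib[symmetric]
  proof (intro sum.cong refl)
    fix m l
    have "?A k l m = ?A k m l" by (rule pd_sym[OF x])
    then show "1/2 * b i m x * b l j x * (?A k l m + ?A l k m - ?A m k l) + 1/2 * b i m x * b l j x * (?A k m l + ?A m k l - ?A l k m)
      = b i m x * ?A k m l * b l j x" by (simp add: algebra_simps)
  qed
  then show ?thesis using 1 by simp
qed

context
  fixes f :: "real ^ 'n \<Rightarrow> real"
  assumes f: "Cinf_on U f"
begin

lemma Hs_sym: "x \<in> U \<Longrightarrow> Hs a f i j x = Hs a f j i x"
  unfolding Hs_def by (simp add: ddir_commute[OF f] Gam_sym[of x _ i j])

lemma CHs: "Cinf_on U (Hs a f i j)"
  unfolding Hs_def[abs_def] by (intro Cinf_intros CGam f)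

lemma Cgradv: "Cinf_on U (gradv a f i)"
  unfolding gradv_def[abs_def] by (intro Cinf_intros f)

lemma Cgrad2: "Cinf_on U (grad2 a f)"
  unfolding grad2_def[abs_def] by (intro Cinf_intros f Cgradv)

lemma CWm: "Cinf_on U (Wm a f i j)"
  unfolding Wm_def[abs_def] by (intro Cinf_intros CHs)

text \<open>Since the cometric is parallel, raising the index of df commutes with covariant
  differentiation: the covariant derivative of the gradient is the Hessian with an index
  raised.\<close>

lemma pd_gradv:
  assumes x: "x \<in> U"
  shows "pd j (gradv a f i) x = Wm a f i j x - (\<Sum>\<Sum>l. Gam a i j l x * gradv a f l x)"
proof -
  have "pd j (gradv a f i) x = (\<Sum>\<Sum>k. pd j (\<lambda>y. b i k y * pd k f y) x)"
    unfolding gradv_def[abs_def] by (rule ddir_sum) (intro dif[OF _ x] Cinf_intros f)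
  also have "\<dots> = (\<Sum>\<Sum>k. b i k x * pd j (pd k f) x + pd j (b i k) x * pd k f x)"
    by (intro sum.cong refl ddir_mult) (intro dif[OF _ x] Cinf_intros f)+
  also have "\<dots> = (\<Sum>\<Sum>k. b i k x * pd k (pd j f) x)
     - (\<Sum>\<Sum>k l. Gam a i j l x * b l k x * pd k f x)
     - (\<Sum>\<Sum>k l. Gam a k j l x * b i l x * pd k f x)"
    by (simp add: pd_b[OF x] ddir_commute[OF f x, of "axis j 1"] sum.distrib sum_subtractf sum_distrib_right
        left_diff_distrib sum_negf)
  also have "(\<Sum>\<Sum>k l. Gam a i j l x * b l k x * pd k f x) = (\<Sum>\<Sum>l. Gam a i j l x * gradv a f l x)"
    unfolding gradv_def by (subst sum.swap) (simp add: sum_distrib_left mult_ac)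
  also have "(\<Sum>\<Sum>k l. Gam a k j l x * b i l x * pd k f x) = (\<Sum>\<Sum>l. b i l x * (\<Sum>\<Sum>k. Gam a k l j x * pd k f x))"
    by (subst sum.swap) (simp add: sum_distrib_left Gam_sym[OF x, of _ j] mult_ac)
  finally show ?thesis
    unfolding Wm_def Hs_def by (simp add: right_diff_distrib sum_subtractf)
qed

lemma Wm_eq:
  assumes x: "x \<in> U"
  shows "Wm a f i j x = pd j (gradv a f i) x + (\<Sum>\<Sum>l. Gam a i j l x * gradv a f l x)"
  using pd_gradv[OF x] by simp

text \<open>The Laplacian as divergence of the gradient. In this form it can be differentiated once
  more, and applied to |\<nabla>f|^2.\<close>

lemma Lap_eq:
  assumes x: "x \<in> U"
  shows "Lap a f x = (\<Sum>\<Sum>l. pd l (gradv a f l) x + (\<Sum>\<Sum>m. Gam a l l m x * gradv a f m x))"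
proof -
  have "Lap a f x = (\<Sum>\<Sum>i. Wm a f i i x)"
    unfolding Lap_def Wm_def by (intro sum.cong refl) (simp add: Hs_sym[OF x])
  then show ?thesis by (simp add: Wm_eq[OF x])
qed

lemma pd_grad2:
  assumes x: "x \<in> U"
  shows "pd j (grad2 a f) x = 2 * (\<Sum>\<Sum>i. Hs a f j i x * gradv a f i x)"
proof -
  have "pd j (grad2 a f) x = (\<Sum>\<Sum>i. pd j (\<lambda>y. pd i f y * gradv a f i y) x)"
    unfolding grad2_def[abs_def] by (rule ddir_sum) (intro dif[OF _ x] Cinf_intros f Cgradv)
  also have "\<dots> = (\<Sum>\<Sum>i. pd i f x * pd j (gradv a f i) x + pd j (pd i f) x * gradv a f i x)"
    by (intro sum.cong refl ddir_mult) (intro dif[OF _ x] Cinf_intros f Cgradv)+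
  also have "\<dots> = (\<Sum>\<Sum>i. pd i f x * Wm a f i j x) - (\<Sum>\<Sum>i l. pd i f x * (Gam a i j l x * gradv a f l x))
     + (\<Sum>\<Sum>i. pd j (pd i f) x * gradv a f i x)"
    by (simp add: pd_gradv[OF x] sum.distrib right_diff_distrib sum_subtractf sum_distrib_left)
  also have "(\<Sum>\<Sum>i. pd i f x * Wm a f i j x) = (\<Sum>\<Sum>i. Hs a f j i x * gradv a f i x)"
    unfolding Wm_def gradv_def sum_distrib_left
    by (subst sum.swap) (simp add: b_facts(4)[OF x] Hs_sym[OF x, of j] mult_ac)
  also have "(\<Sum>\<Sum>i l. pd i f x * (Gam a i j l x * gradv a f l x)) = (\<Sum>\<Sum>l. (\<Sum>\<Sum>i. Gam a i j l x * pd i f x) * gradv a f l x)"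
    by (subst sum.swap) (simp add: sum_distrib_left sum_distrib_right mult_ac)
  finally show ?thesis
    unfolding Hs_def by (simp add: left_diff_distrib sum_subtractf)
qed

lemma gradv_grad2:
  assumes x: "x \<in> U"
  shows "gradv a (grad2 a f) l x = 2 * (\<Sum>\<Sum>i. Wm a f l i x * gradv a f i x)"
proof -
  have "gradv a (grad2 a f) l x = (\<Sum>\<Sum>j i. 2 * (b l j x * Hs a f j i x * gradv a f i x))"
    unfolding gradv_def[of a "grad2 a f"] by (simp add: pd_grad2[OF x] sum_distrib_left mult_ac)
  also have "\<dots> = 2 * (\<Sum>\<Sum>i. Wm a f l i x * gradv a f i x)"
    unfolding Wm_def by (subst sum.swap) (simp add: sum_distrib_left sum_distrib_right mult_ac)
  finally show ?thesis .
qed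

end

lemma bochner:
  assumes f: "Cinf_on U f" and x: "x \<in> U"
  shows "Lap a (grad2 a f) x / 2 = (\<Sum>\<Sum>i. gradv a f i x * pd i (Lap a f) x)
    + (\<Sum>\<Sum>j k. (\<Sum>\<Sum>i. Rm a i k i j x) * gradv a f j x * gradv a f k x)
    + (\<Sum>\<Sum>l i. Wm a f l i x * Wm a f i l x)"
proof -
  note C = CGam Cgradv[OF f] CWm[OF f]
  let ?F = "\<lambda>i. gradv a f i x" and ?W = "\<lambda>i j. Wm a f i j x" and ?G = "\<lambda>k i j. Gam a k i j x"
  let ?D = "\<lambda>l m. pd l (gradv a f m) x" and ?dG = "\<lambda>p k i j. pd p (Gam a k i j) x"
  let ?S = "\<lambda>l i. pd l (pd i (gradv a f l)) x"
  have dW: "pd l (Wm a f l i) x = ?S l i + (\<Sum>\<Sum>m. ?G l i m * ?D l m + ?dG l l i m * ?F m)" for l i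
  proof -
    have "pd l (Wm a f l i) x = pd l (\<lambda>y. pd i (gradv a f l) y + (\<Sum>\<Sum>m. Gam a l i m y * gradv a f m y)) x"
      by (rule ddir_cong[OF U x]) (rule Wm_eq[OF f])
    also have "\<dots> = ?S l i + pd l (\<lambda>y. \<Sum>\<Sum>m. Gam a l i m y * gradv a f m y) x"
      by (rule ddir_add) (intro dif[OF _ x] Cinf_intros C)+
    also have "pd l (\<lambda>y. \<Sum>\<Sum>m. Gam a l i m y * gradv a f m y) x = (\<Sum>\<Sum>m. pd l (\<lambda>y. Gam a l i m y * gradv a f m y) x)"
      by (rule ddir_sum) (intro dif[OF _ x] Cinf_intros C)
    also have "\<dots> = (\<Sum>\<Sum>m. ?G l i m * ?D l m + ?dG l l i m * ?F m)"
      by (intro sum.cong refl ddir_mult) (intro dif[OF _ x] Cinf_intros C)+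
    finally show ?thesis .
  qed
  have dL: "pd i (Lap a f) x = (\<Sum>\<Sum>l. ?S l i + (\<Sum>\<Sum>m. ?G l l m * ?D i m + ?dG i l l m * ?F m))" for i
  proof -
    have "pd i (Lap a f) x = pd i (\<lambda>y. \<Sum>\<Sum>l. pd l (gradv a f l) y + (\<Sum>\<Sum>m. Gam a l l m y * gradv a f m y)) x"
      by (rule ddir_cong[OF U x]) (rule Lap_eq[OF f])
    also have "\<dots> = (\<Sum>\<Sum>l. pd i (\<lambda>y. pd l (gradv a f l) y + (\<Sum>\<Sum>m. Gam a l l m y * gradv a f m y)) x)"
      by (rule ddir_sum) (intro dif[OF _ x] Cinf_intros C)
    also have "\<dots> = (\<Sum>\<Sum>l. ?S l i + (\<Sum>\<Sum>m. ?G l l m * ?D i m + ?dG i l l m * ?F m))"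
    proof (intro sum.cong refl)
      fix l
      have "pd i (\<lambda>y. pd l (gradv a f l) y + (\<Sum>\<Sum>m. Gam a l l m y * gradv a f m y)) x
        = pd i (pd l (gradv a f l)) x + pd i (\<lambda>y. \<Sum>\<Sum>m. Gam a l l m y * gradv a f m y) x"
        by (rule ddir_add) (intro dif[OF _ x] Cinf_intros C)+
      \<comment> \<open>Commuting the partial derivatives produces the same array \<open>?S\<close>
        as in the derivative of W; this is why the second derivatives of the gradient disappear from
        the comparison.\<close>
      also have "pd i (pd l (gradv a f l)) x = ?S l i"
        by (rule ddir_commute[OF Cgradv[OF f] x])
      also have "pd i (\<lambda>y. \<Sum>\<Sum>m. Gam a l l m y * gradv a f m y) x = (\<Sum>\<Sum>m. pd i (\<lambda>y. Gam a l l m y * gradv a f m y) x)"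
        by (rule ddir_sum) (intro dif[OF _ x] Cinf_intros C)
      also have "\<dots> = (\<Sum>\<Sum>m. ?G l l m * ?D i m + ?dG i l l m * ?F m)"
        by (intro sum.cong refl ddir_mult) (intro dif[OF _ x] Cinf_intros C)+
      finally show "pd i (\<lambda>y. pd l (gradv a f l) y + (\<Sum>\<Sum>m. Gam a l l m y * gradv a f m y)) x
        = ?S l i + (\<Sum>\<Sum>m. ?G l l m * ?D i m + ?dG i l l m * ?F m)" .
    qed
    finally show ?thesis .
  qed
  have dg: "pd l (gradv a (grad2 a f) l) x = 2 * (\<Sum>\<Sum>i. ?W l i * ?D l i + pd l (Wm a f l i) x * ?F i)" for l
  proof -
    have "pd l (gradv a (grad2 a f) l) x = pd l (\<lambda>y. 2 * (\<Sum>\<Sum>i. Wm a f l i y * gradv a f i y)) x"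
      by (rule ddir_cong[OF U x]) (rule gradv_grad2[OF f])
    also have "\<dots> = 2 * pd l (\<lambda>y. \<Sum>\<Sum>i. Wm a f l i y * gradv a f i y) x"
      by (rule ddir_cmult) (intro dif[OF _ x] Cinf_intros C)
    also have "pd l (\<lambda>y. \<Sum>\<Sum>i. Wm a f l i y * gradv a f i y) x = (\<Sum>\<Sum>i. pd l (\<lambda>y. Wm a f l i y * gradv a f i y) x)"
      by (rule ddir_sum) (intro dif[OF _ x] Cinf_intros C)
    also have "\<dots> = (\<Sum>\<Sum>i. ?W l i * ?D l i + pd l (Wm a f l i) x * ?F i)"
      by (intro sum.cong refl ddir_mult) (intro dif[OF _ x] Cinf_intros C)+
    finally show ?thesis .
  qed
  have "Lap a (grad2 a f) x / 2 = (\<Sum>\<Sum>l i. ?W l i * ?D l i + (?S l i + (\<Sum>\<Sum>m. ?G l i m * ?D l m + ?dG l l i m * ?F m)) * ?F i)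
      + (\<Sum>\<Sum>l m. ?G l l m * (\<Sum>\<Sum>i. ?W m i * ?F i))"
    unfolding Lap_eq[OF Cgrad2[OF f] x] dg gradv_grad2[OF f x] dW
    by (simp add: sum.distrib sum_distrib_left add_divide_distrib sum_divide_distrib)
  also have "\<dots> = (\<Sum>\<Sum>i. ?F i * (\<Sum>\<Sum>l. ?S l i + (\<Sum>\<Sum>m. ?G l l m * ?D i m + ?dG i l l m * ?F m)))
      + (\<Sum>\<Sum>j k. (\<Sum>\<Sum>i. ?dG i i j k - ?dG j i i k + (\<Sum>\<Sum>m. ?G i i m * ?G m j k - ?G i j m * ?G m i k)) * ?F j * ?F k)
      + (\<Sum>\<Sum>l i. ?W l i * ?W i l)"
    by (rule bochner_algebra) (rule Gam_sym[OF x], rule pd_gradv[OF f x])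
  finally show ?thesis unfolding dL Rm_def .
qed

end

section \<open>The evolution of the Harnack quantity\<close>

text \<open>The coordinate expression of (\<nabla>_k h)(\<partial>_i, \<partial>_j); the first index
  is the direction of differentiation.\<close>

definition Ncov :: "(real ^ 'n \<Rightarrow> real ^ 'n ^ 'n) \<Rightarrow> (real ^ 'n \<Rightarrow> real ^ 'n ^ 'n) \<Rightarrow> 'n::finite \<Rightarrow> 'n \<Rightarrow> 'n \<Rightarrow> real ^ 'n \<Rightarrow> real" where
  "Ncov a h k i j x = pd k (\<lambda>y. h y $ i $ j) x
     - (\<Sum>\<Sum>l. Gam a l k i x * h x $ l $ j) - (\<Sum>\<Sum>l. Gam a l k j x * h x $ i $ l)"

section \<open>Derivative tests at a maximum\<close>

lemma linear_ddir_axis: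
  fixes f :: "real ^ 'n::finite \<Rightarrow> real"
  assumes "f differentiable (at x)"
  shows "ddir v f x = (\<Sum>\<Sum>i. v $ i * pd i f x)"
proof -
  have lin: "linear (frechet_derivative f (at x))" by (rule linear_frechet_derivative[OF assms])
  have "ddir v f x = ddir (\<Sum>\<Sum>i. v $ i *\<^sub>R axis i 1) f x"
    using basis_expansion[of v] by (simp add: scalar_mult_eq_scaleR)
  also have "\<dots> = (\<Sum>\<Sum>i. v $ i * pd i f x)"
    by (simp add: linear_sum[OF lin] linear_cmul[OF lin])
  finally show ?thesis .
qed

text \<open>If the second derivative along w were positive, the first derivative, which vanishes at
  x, would be positive just beyond x on this line, and the mean value theorem would produce a larger
  value of q.\<close>

lemma local_max_second_derivative:
  fixes q :: "real ^ 'n::finite \<Rightarrow> real"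
  assumes q: "Cinf_on U q" and x: "x \<in> U" and mx: "\<And>y. y \<in> U \<Longrightarrow> q y \<le> q x"
  shows "pd i q x = 0" and "(\<Sum>\<Sum>i j. v i * v j * pd i (pd j q) x) \<le> 0"
proof -
  have dq: "q differentiable (at y)" if "y \<in> U" for y by (rule Cinf_on_differentiable[OF q that])
  obtain e where e: "e > 0" "ball x e \<subseteq> U"
    using Cinf_on_open[OF q] x open_contains_ball by blast
  have zero: "ddir w q x = 0" for w
  proof -
    have "frechet_derivative q (at x) = (\<lambda>v. 0)"
      by (rule differential_zero_maxmin[OF x Cinf_on_open[OF q] has_derivative_ddir[OF dq[OF x]]])
         (use mx in auto)
    then show ?thesis by simp
  qed
  then show "pd i q x = 0" .
  define w :: "real ^ 'n" where "w = (\<chi> i. v i)"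
  have "ddir w (ddir w q) x = (\<Sum>\<Sum>i. v i * pd i (ddir w q) x)"
    by (subst linear_ddir_axis) (auto intro: Cinf_on_differentiable Cinf_on_ddir q x simp: w_def)
  also have "\<dots> = (\<Sum>\<Sum>i. v i * pd i (\<lambda>y. \<Sum>\<Sum>j. v j * pd j q y) x)"
  proof (intro sum.cong refl arg_cong2[where f = "(*)"])
    fix i
    show "pd i (ddir w q) x = pd i (\<lambda>y. \<Sum>\<Sum>j. v j * pd j q y) x"
      by (rule ddir_cong[OF Cinf_on_open[OF q] x], subst linear_ddir_axis[OF dq]) (auto simp: w_def)
  qed
  also have "\<dots> = (\<Sum>\<Sum>i j. v i * v j * pd i (pd j q) x)"
  proof -
    have "pd i (\<lambda>y. \<Sum>\<Sum>j. v j * pd j q y) x = (\<Sum>\<Sum>j. v j * pd i (pd j q) x)" for i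
    proof -
      have "pd i (\<lambda>y. \<Sum>\<Sum>j. v j * pd j q y) x = (\<Sum>\<Sum>j. pd i (\<lambda>y. v j * pd j q y) x)"
        by (rule ddir_sum) (intro Cinf_on_differentiable[OF _ x] Cinf_on_cmult Cinf_on_ddir q)
      also have "\<dots> = (\<Sum>\<Sum>j. v j * pd i (pd j q) x)"
        by (intro sum.cong refl ddir_cmult) (intro Cinf_on_differentiable[OF _ x] Cinf_on_ddir q)
      finally show ?thesis .
    qed
    then show ?thesis by (simp add: sum_distrib_left mult.assoc)
  qed
  finally have eq: "ddir w (ddir w q) x = (\<Sum>\<Sum>i j. v i * v j * pd i (pd j q) x)" .
  have "ddir w (ddir w q) x \<le> 0"
  proof (rule ccontr)
    assume "\<not> ddir w (ddir w q) x \<le> 0"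
    then have pos: "ddir w (ddir w q) x > 0" by simp
    have "w \<noteq> 0"
      using pos linear_0[OF linear_frechet_derivative[OF Cinf_on_differentiable[OF Cinf_on_ddir[OF q] x]]] by auto
    then have nw: "norm w > 0" by simp
    have inU: "x + s *\<^sub>R w \<in> U" if "\<bar>s\<bar> < e / norm w" for s
    proof -
      have "\<bar>s\<bar> * norm w < e" using that nw by (simp add: pos_less_divide_eq)
      then have "x + s *\<^sub>R w \<in> ball x e" by (simp add: dist_norm)
      then show ?thesis using e by blast
    qed
    have "((\<lambda>s. ddir w q (x + s *\<^sub>R w)) has_real_derivative ddir w (ddir w q) x) (at 0)"
      using has_real_derivative_line[of "ddir w q" x 0 w UNIV] Cinf_on_differentiable[OF Cinf_on_ddir[OF q] x] by simp
    from DERIV_pos_inc_right[OF this pos] obtain d where d: "d > 0" "\<And>s. s > 0 \<Longrightarrow> s < d \<Longrightarrow> ddir w q (x + s *\<^sub>R w) > 0"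
      using zero by auto
    define s where "s = min (d/2) (e / norm w / 2)"
    have s: "s > 0" "s < d" "s < e / norm w"
      using d e nw by (auto simp: s_def min_def field_simps)
    have "\<exists>z. 0 < z \<and> z < s \<and> q (x + s *\<^sub>R w) - q (x + 0 *\<^sub>R w) = (s - 0) * ddir w q (x + z *\<^sub>R w)"
      by (rule MVT2[OF s(1)], rule has_real_derivative_line, rule dq, rule inU) (use s in auto)
    then obtain z where "0 < z" "z < s" "q (x + s *\<^sub>R w) - q x = s * ddir w q (x + z *\<^sub>R w)" by auto
    moreover have "ddir w q (x + z *\<^sub>R w) > 0" using d calculation s by auto
    ultimately have "q (x + s *\<^sub>R w) > q x" using s by (metis diff_gt_0_iff_gt mult_pos_pos)
    moreover have "q (x + s *\<^sub>R w) \<le> q x" using s by (intro mx inU) auto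
    ultimately show False by simp
  qed
  with eq show "(\<Sum>\<Sum>i j. v i * v j * pd i (pd j q) x) \<le> 0" by simp
qed

text \<open>Only values to the left of t are compared, so the maximum may occur at t = T, where the
  derivative is one-sided.\<close>

lemma left_derivative_nonneg:
  fixes \<phi> :: "real \<Rightarrow> real"
  assumes "(\<phi> has_real_derivative D) (at t within {0..T})" "0 < t" "t \<le> T" "open I" "t \<in> I"
    and "\<And>s. s \<in> I \<Longrightarrow> s \<in> {0..T} \<Longrightarrow> \<phi> s \<le> \<phi> t"
  shows "D \<ge> 0"
proof (rule ccontr)
  assume "\<not> D \<ge> 0"
  then have "D < 0" by simp
  from has_real_derivative_neg_dec_left[OF assms(1) this]
  obtain d where d: "d > 0" "\<And>h. h > 0 \<Longrightarrow> t - h \<in> {0..T} \<Longrightarrow> h < d \<Longrightarrow> \<phi> t < \<phi> (t - h)" by auto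
  obtain e where e: "e > 0" "ball t e \<subseteq> I" using assms(4,5) open_contains_ball by blast
  define h where "h = min t (min (d/2) (e/2))"
  have h: "h > 0" "h < d" "h \<le> t" "h < e" using d e assms(2) by (auto simp: h_def min_def)
  then have "t - h \<in> I" "t - h \<in> {0..T}" using e assms(2,3) by (auto simp: dist_real_def intro!: subsetD[OF e(2)])
  with d(2)[of h] h assms(6)[of "t - h"] show False by auto
qed

lemma has_real_derivative_unique_within:
  fixes \<phi> :: "real \<Rightarrow> real"
  assumes "(\<phi> has_real_derivative D) (at t within {0..T})" "(\<phi> has_real_derivative D') (at t within {0..T})" "0 \<le> t" "t \<le> T" "0 < T"
  shows "D = D'"
  using vector_derivative_unique_within_closed_interval[of 0 T t \<phi> D D'] assms
  by (simp add: has_real_derivative_iff_has_vector_derivative)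

lemma local_metric_subset: "local_metric U a \<Longrightarrow> open V \<Longrightarrow> V \<subseteq> U \<Longrightarrow> local_metric V a"
  unfolding local_metric_def using Cinf_on_subset by blast

lemma slice_ddir:
  fixes G :: "real \<times> (real ^ 'n::finite) \<Rightarrow> real"
  assumes "G differentiable (at (t, x))"
  shows "pd j (\<lambda>y. G (t, y)) x = ddir (0, axis j 1) G (t, x)"
proof -
  have "bounded_linear (\<lambda>y :: real ^ 'n. (0 :: real, y))" by (intro bounded_linear_Pair bounded_linear_zero bounded_linear_ident)
  from ddir_affine(1)[OF this, of G "(t, 0)" x "axis j 1"] assms show ?thesis by simp
qed

lemma slice_Cinf:
  fixes G :: "real \<times> (real ^ 'n::finite) \<Rightarrow> real"
  assumes G: "Cinf_on (I \<times> U) G" and t: "t \<in> I" and U: "open U"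
  shows "Cinf_on U (\<lambda>y. G (t, y))"
proof -
  have bl: "bounded_linear (\<lambda>y :: real ^ 'n. (0 :: real, y))" by (intro bounded_linear_Pair bounded_linear_zero bounded_linear_ident)
  have "{y. (t, 0) + (0, y) \<in> I \<times> U} = U" using t by auto
  then have "Ck_on k U (\<lambda>y. G (t, y))" for k
    using Ck_on_affine[OF bl Cinf_on_open[OF G], of k G "(t, 0)"] G unfolding Cinf_on_def by simp
  then show ?thesis using U by (simp add: Cinf_on_def)
qed

lemma slice_time:
  fixes G :: "real \<times> (real ^ 'n::finite) \<Rightarrow> real"
  assumes "G differentiable (at (t, x))"
  shows "((\<lambda>s. G (s, x)) has_real_derivative ddir (1, 0) G (t, x)) (at t within S)"
  using has_real_derivative_line[of G "(0, x)" t "(1, 0)" S] assms by simp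

section \<open>First variation of the connection and of the Laplacian\<close>

text \<open>What a family that is once differentiable in time provides in a chart. Joint continuity
  of the spatial derivatives of \<open>h\<close> is the condition under which a spatial derivative
  of the metric may be differentiated in time.\<close>

locale evolving_metric =
  fixes U :: "(real ^ 'n::finite) set" and a h :: "real \<Rightarrow> real ^ 'n \<Rightarrow> real ^ 'n ^ 'n" and T :: real
  assumes metric: "\<And>t. t \<in> {0..T} \<Longrightarrow> local_metric U (a t)"
    and da: "\<And>t x i j. t \<in> {0..T} \<Longrightarrow> x \<in> U \<Longrightarrow>
      ((\<lambda>s. a s x $ i $ j) has_real_derivative h t x $ i $ j) (at t within {0..T})"
    and h_diff: "\<And>t x i j. t \<in> {0..T} \<Longrightarrow> x \<in> U \<Longrightarrow> (\<lambda>y. h t y $ i $ j) differentiable (at x)"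
    and h_cont: "\<And>i j k. continuous_on ({0..T} \<times> U) (\<lambda>(t, x). pd k (\<lambda>y. h t y $ i $ j) x)"

text \<open>The fixed point (t, x) is where the maximum will be located: t = T is allowed, t = 0 is
  not.\<close>

locale evolving_metric_at = evolving_metric U a h T
  for U :: "(real ^ 'n::finite) set" and a h :: "real \<Rightarrow> real ^ 'n \<Rightarrow> real ^ 'n ^ 'n" and T :: real +
  fixes t x
  assumes t: "0 < t" "t \<le> T" and x: "x \<in> U"
begin

abbreviation bb :: "'n \<Rightarrow> 'n \<Rightarrow> real" where "bb i j \<equiv> matrix_inv (a t x) $ i $ j"

abbreviation dbb :: "'n \<Rightarrow> 'n \<Rightarrow> real" where
  "dbb i j \<equiv> - (\<Sum>\<Sum>m l. bb i m * h t x $ m $ l * bb l j)"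

lemma tT: "t \<in> {0..T}" "0 < T" using t by auto

sublocale M: local_metric U "a t" by (rule metric[OF tT(1)])

lemma uniq: "(\<phi> has_real_derivative D) (at t within {0..T}) \<Longrightarrow> (\<phi> has_real_derivative D') (at t within {0..T}) \<Longrightarrow> D = D'"
  by (rule has_real_derivative_unique_within[OF _ _ less_imp_le[OF t(1)] t(2) tT(2)])

lemma h_sym: "h t x $ i $ j = h t x $ j $ i"
proof (rule uniq)
  show "((\<lambda>s. a s x $ i $ j) has_real_derivative h t x $ i $ j) (at t within {0..T})" by (rule da[OF tT(1) x])
  show "((\<lambda>s. a s x $ i $ j) has_real_derivative h t x $ j $ i) (at t within {0..T})"
    by (rule has_field_derivative_transform_within[OF da[OF tT(1) x], of 1])
       (use tT local_metric.a_sym[OF metric x] in auto)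
qed

text \<open>Cramer's rule gives some derivative; differentiating b a = 1 on [0,T], with uniqueness
  of derivatives relative to that interval, identifies it.\<close>

lemma dt_b: "((\<lambda>s. matrix_inv (a s x) $ i $ j) has_real_derivative dbb i j) (at t within {0..T})"
proof -
  have "\<exists>d. \<forall>i j. ((\<lambda>s. matrix_inv (a s x) $ i $ j) has_real_derivative d i j) (at t within {0..T})"
  proof -
    have "(\<lambda>s. matrix_inv (a s x) $ i $ j) differentiable (at t within {0..T})" for i j
    proof (rule differentiable_matrix_inv)
      show "(\<lambda>s. a s x $ i $ j) differentiable (at t within {0..T})" for i j
        unfolding real_differentiable_def using da[OF tT(1) x] by blast
    qed (use tT local_metric.b_facts(1)[OF metric x] in auto)
    then have "\<exists>d. ((\<lambda>s. matrix_inv (a s x) $ i $ j) has_real_derivative d) (at t within {0..T})" for i j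
      unfolding real_differentiable_def .
    then show ?thesis by metis
  qed
  then obtain d where d: "\<And>i j. ((\<lambda>s. matrix_inv (a s x) $ i $ j) has_real_derivative d i j) (at t within {0..T})"
    by blast
  have "(\<Sum>\<Sum>m. bb i m * h t x $ m $ j + d i m * a t x $ m $ j) = 0" for i j
  proof (rule uniq)
    show "((\<lambda>s. \<Sum>\<Sum>m. matrix_inv (a s x) $ i $ m * a s x $ m $ j) has_real_derivative
      (\<Sum>\<Sum>m. bb i m * h t x $ m $ j + d i m * a t x $ m $ j)) (at t within {0..T})"
      by (rule DERIV_sum) (rule DERIV_cong[OF DERIV_mult[OF d da[OF tT(1) x]]], simp add: algebra_simps)
    show "((\<lambda>s. \<Sum>\<Sum>m. matrix_inv (a s x) $ i $ m * a s x $ m $ j) has_real_derivative 0) (at t within {0..T})"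
      by (rule has_field_derivative_transform_within[OF DERIV_const[of "if i = j then 1 else 0"], of 1])
         (use tT local_metric.b_facts(3)[OF metric x] in auto)
  qed
  from inverse_derivative_algebra[OF this M.b_facts(2)[OF x], of i j] d[of i j] show ?thesis by simp
qed

text \<open>Exchange of derivatives on the coordinate line through x in direction k, with [0,T] as
  the convex set.\<close>

lemma dt_pd_a: "((\<lambda>s. pd k (\<lambda>y. a s y $ i $ j) x) has_real_derivative pd k (\<lambda>y. h t y $ i $ j) x) (at t within {0..T})"
proof -
  obtain e where e: "e > 0" "ball x e \<subseteq> U" using M.U x open_contains_ball by blast
  let ?e = "axis k (1 :: real) :: real ^ 'n"
  have inU: "x + s *\<^sub>R ?e \<in> U" if "\<bar>s\<bar> < e" for s
    using that e by (auto simp: dist_norm norm_axis_1 intro!: subsetD[OF e(2)])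
  have "((\<lambda>s. pd k (\<lambda>y. a s y $ i $ j) x) has_real_derivative pd k (\<lambda>y. h t y $ i $ j) (x + 0 *\<^sub>R ?e)) (at t within {0..T})"
  proof (rule mixed_derivative_swap[where \<alpha> = "\<lambda>t s. a t (x + s *\<^sub>R ?e) $ i $ j" and h = "\<lambda>t s. h t (x + s *\<^sub>R ?e) $ i $ j"
      and k = "\<lambda>t s. pd k (\<lambda>y. h t y $ i $ j) (x + s *\<^sub>R ?e)" and r = e])
    show "convex {0..T}" "t \<in> {0..T}" "e > 0" using tT e by auto
    show "((\<lambda>s'. a s' (x + s *\<^sub>R ?e) $ i $ j) has_real_derivative h t' (x + s *\<^sub>R ?e) $ i $ j) (at t' within {0..T})"
      if "t' \<in> {0..T}" "\<bar>s\<bar> < e" for t' s using da[OF that(1) inU[OF that(2)]] .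
    show "((\<lambda>s. h t' (x + s *\<^sub>R ?e) $ i $ j) has_real_derivative pd k (\<lambda>y. h t' y $ i $ j) (x + s *\<^sub>R ?e)) (at s)"
      if "t' \<in> {0..T}" "\<bar>s\<bar> < e" for t' s
      by (rule has_real_derivative_line) (rule h_diff[OF that(1) inU[OF that(2)]])
    show "((\<lambda>s. a t' (x + s *\<^sub>R ?e) $ i $ j) has_real_derivative pd k (\<lambda>y. a t' y $ i $ j) x) (at 0)" if "t' \<in> {0..T}" for t'
      using has_real_derivative_line[of "\<lambda>y. a t' y $ i $ j" x 0 ?e UNIV]
        Cinf_on_differentiable[OF local_metric.a[OF metric[OF that]] x] by simp
    fix \<epsilon> :: real assume "\<epsilon> > 0"
    then obtain d where d: "d > 0" "\<And>p. p \<in> {0..T} \<times> U \<Longrightarrow> dist p (t, x) < d \<Longrightarrow>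
        dist ((\<lambda>(t, x). pd k (\<lambda>y. h t y $ i $ j) x) p) (pd k (\<lambda>y. h t y $ i $ j) x) < \<epsilon>"
      using h_cont[of i j k, unfolded continuous_on_iff, rule_format, of "(t, x)" \<epsilon>] tT x by auto
    show "\<exists>\<delta>>0. \<forall>t'\<in>{0..T}. \<forall>s. \<bar>t' - t\<bar> < \<delta> \<longrightarrow> \<bar>s\<bar> < \<delta> \<longrightarrow>
       \<bar>pd k (\<lambda>y. h t' y $ i $ j) (x + s *\<^sub>R ?e) - pd k (\<lambda>y. h t y $ i $ j) (x + 0 *\<^sub>R ?e)\<bar> \<le> \<epsilon>"
    proof (intro exI[of _ "min e (d/2)"] conjI ballI allI impI)
      show "min e (d/2) > 0" using e d by simp
      fix t' s assume *: "t' \<in> {0..T}" "\<bar>t' - t\<bar> < min e (d/2)" "\<bar>s\<bar> < min e (d/2)"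
      have "dist (t', x + s *\<^sub>R ?e) (t, x) < d"
        using * norm_Pair_le[of "t' - t" "s *\<^sub>R ?e"] by (simp add: dist_norm norm_axis_1)
      from d(2)[OF _ this] * inU[of s] show "\<bar>pd k (\<lambda>y. h t' y $ i $ j) (x + s *\<^sub>R ?e) - pd k (\<lambda>y. h t y $ i $ j) (x + 0 *\<^sub>R ?e)\<bar> \<le> \<epsilon>"
        by (simp add: dist_real_def)
    qed
  qed
  then show ?thesis by simp
qed

text \<open>Although the Christoffel symbols are not a tensor, their time derivative is one: the
  terms that arise from differentiating the cometric are exactly the corrections that turn the
  partial derivatives of \<open>h\<close> into covariant ones.\<close>

lemma dt_Gam: "((\<lambda>s. Gam (a s) k i j x) has_real_derivative
   (1/2) * (\<Sum>\<Sum>l. bb k l * (Ncov (a t) (h t) i j l x + Ncov (a t) (h t) j i l x - Ncov (a t) (h t) l i j x))) (at t within {0..T})"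
proof -
  let ?A = "\<lambda>s l. pd i (\<lambda>y. a s y $ j $ l) x + pd j (\<lambda>y. a s y $ i $ l) x - pd l (\<lambda>y. a s y $ i $ j) x"
  let ?H = "\<lambda>l. pd i (\<lambda>y. h t y $ j $ l) x + pd j (\<lambda>y. h t y $ i $ l) x - pd l (\<lambda>y. h t y $ i $ j) x"
  let ?G = "\<lambda>k. Gam (a t) k i j x"
  have "((\<lambda>s. Gam (a s) k i j x) has_real_derivative (1/2) * (\<Sum>\<Sum>l. dbb k l * ?A t l + ?H l * bb k l)) (at t within {0..T})"
    unfolding Gam_def by (intro DERIV_cmult DERIV_sum DERIV_mult dt_b DERIV_add DERIV_diff dt_pd_a)
  moreover have "(1/2) * (\<Sum>\<Sum>l. dbb k l * ?A t l + ?H l * bb k l)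
     = (1/2) * (\<Sum>\<Sum>l. bb k l * (Ncov (a t) (h t) i j l x + Ncov (a t) (h t) j i l x - Ncov (a t) (h t) l i j x))"
  proof -
    \<comment> \<open>Of the six correction terms four cancel, by symmetry of \<open>h\<close> and
      of the Christoffel symbols, and the remaining two are equal; hence the factor 2.\<close>
    have N: "Ncov (a t) (h t) i j l x + Ncov (a t) (h t) j i l x - Ncov (a t) (h t) l i j x = ?H l - 2 * (\<Sum>\<Sum>m. ?G m * h t x $ l $ m)" for l
    proof -
      have "(\<Sum>\<Sum>m. Gam (a t) m i l x * h t x $ j $ m) = (\<Sum>\<Sum>m. Gam (a t) m l i x * h t x $ m $ j)"
        "(\<Sum>\<Sum>m. Gam (a t) m j l x * h t x $ i $ m) = (\<Sum>\<Sum>m. Gam (a t) m l j x * h t x $ i $ m)"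
        "(\<Sum>\<Sum>m. Gam (a t) m j i x * h t x $ m $ l) = (\<Sum>\<Sum>m. ?G m * h t x $ l $ m)"
        "(\<Sum>\<Sum>m. ?G m * h t x $ m $ l) = (\<Sum>\<Sum>m. ?G m * h t x $ l $ m)"
        by (intro sum.cong refl arg_cong2[where f = "(*)"] h_sym M.Gam_sym[OF x])+
      then show ?thesis unfolding Ncov_def by simp
    qed
    have "(1/2) * (\<Sum>\<Sum>l. dbb k l * ?A t l) = - (\<Sum>\<Sum>m. bb k m * (\<Sum>\<Sum>q. ?G q * h t x $ m $ q))"
    proof -
      have "(1/2) * (\<Sum>\<Sum>l. dbb k l * ?A t l) = - (\<Sum>\<Sum>l m q. bb k m * (h t x $ m $ q * ((1/2) * (bb q l * ?A t l))))"
        unfolding sum_distrib_left sum_distrib_right sum_negf[symmetric] by (intro sum.cong refl) (simp add: sum_distrib_left sum_distrib_right sum_negf mult_ac)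
      also have "(\<Sum>\<Sum>l m q. bb k m * (h t x $ m $ q * ((1/2) * (bb q l * ?A t l))))
        = (\<Sum>\<Sum>m q l. bb k m * (h t x $ m $ q * ((1/2) * (bb q l * ?A t l))))"
        by (rule sum_rotate[symmetric])
      also have "\<dots> = (\<Sum>\<Sum>m. bb k m * (\<Sum>\<Sum>q. ?G q * h t x $ m $ q))"
        unfolding Gam_def by (simp only: sum_distrib_left mult_ac)
      finally show ?thesis .
    qed
    moreover define S where "S m = (\<Sum>\<Sum>q. ?G q * h t x $ m $ q)" for m
    moreover define Hv where "Hv l = ?H l" for l
    ultimately show ?thesis unfolding N sum.distrib distrib_left
      by (simp add: right_diff_distrib sum_subtractf sum_distrib_left mult_ac)
  qed
  ultimately show ?thesis by simp
qed

text \<open>The first derivatives vanish, so the Christoffel terms drop out; decomposing the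
  cometric into squares leaves a sum of second derivatives along straight lines.\<close>

lemma Lap_le_zero_at_max:
  assumes q: "Cinf_on U q" and mx: "\<And>y. y \<in> U \<Longrightarrow> q y \<le> q x"
  shows "Lap (a t) q x \<le> 0"
proof -
  obtain E :: "'n \<Rightarrow> 'n \<Rightarrow> real" where E: "\<And>i j. bb i j = (\<Sum>\<Sum>k. E k i * E k j)"
    using psd_sum_of_squares[of bb] M.b_facts(4,5)[OF x] by blast
  have "Lap (a t) q x = (\<Sum>\<Sum>i j k. E k i * E k j * pd i (pd j q) x)"
    unfolding Lap_def Hs_def E by (simp add: local_max_second_derivative(1)[OF q x mx] sum_distrib_right)
  also have "\<dots> = (\<Sum>\<Sum>k i j. E k i * E k j * pd i (pd j q) x)"
    by (rule sum_rotate)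
  also have "\<dots> \<le> 0"
    by (intro sum_nonpos local_max_second_derivative(2)[OF q x mx])
  finally show ?thesis .
qed

lemma Lap_diff_cmult:
  assumes p: "Cinf_on U p" and q: "Cinf_on U q"
  shows "Lap (a t) (\<lambda>y. p y - c * q y) x = Lap (a t) p x - c * Lap (a t) q x"
proof -
  have 1: "pd j (\<lambda>y. p y - c * q y) y = pd j p y - c * pd j q y" if "y \<in> U" for j y
  proof -
    have "pd j (\<lambda>y. p y - c * q y) y = pd j p y - pd j (\<lambda>y. c * q y) y"
      by (rule ddir_diff) (intro Cinf_on_differentiable[OF _ that] Cinf_on_cmult p q)+
    also have "pd j (\<lambda>y. c * q y) y = c * pd j q y"
      by (rule ddir_cmult) (rule Cinf_on_differentiable[OF q that])
    finally show ?thesis .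
  qed
  have 2: "pd i (pd j (\<lambda>y. p y - c * q y)) x = pd i (pd j p) x - c * pd i (pd j q) x" for i j
  proof -
    have "pd i (pd j (\<lambda>y. p y - c * q y)) x = pd i (\<lambda>y. pd j p y - c * pd j q y) x"
      by (rule ddir_cong[OF M.U x 1])
    also have "\<dots> = pd i (pd j p) x - pd i (\<lambda>y. c * pd j q y) x"
      by (rule ddir_diff) (intro Cinf_on_differentiable[OF _ x] Cinf_on_cmult Cinf_on_ddir p q)+
    also have "pd i (\<lambda>y. c * pd j q y) x = c * pd i (pd j q) x"
      by (rule ddir_cmult) (intro Cinf_on_differentiable[OF _ x] Cinf_on_ddir q)
    finally show ?thesis .
  qed
  have "Hs (a t) (\<lambda>y. p y - c * q y) i j x = Hs (a t) p i j x - c * Hs (a t) q i j x" for i j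
    unfolding Hs_def 2 1[OF x] by (simp add: right_diff_distrib sum_subtractf sum_distrib_left mult_ac)
  then show ?thesis
    unfolding Lap_def by (simp add: right_diff_distrib sum_subtractf sum_distrib_left mult_ac)
qed

context
  fixes I :: "real set" and G :: "real \<times> (real ^ 'n) \<Rightarrow> real"
  assumes I: "open I" "t \<in> I" and G: "Cinf_on (I \<times> U) G"
begin

text \<open>In the application \<open>G\<close> is, in one chart, the logarithm of a smooth
  extension of u across the ends of [0,T]. As it is smooth on an open set of space-time, its time
  and space derivatives commute even at t = T.\<close>

abbreviation Gs :: "real \<Rightarrow> real ^ 'n \<Rightarrow> real" where "Gs s \<equiv> \<lambda>y. G (s, y)"
abbreviation Gt :: "real ^ 'n \<Rightarrow> real" where "Gt \<equiv> \<lambda>y. ddir (1, 0) G (t, y)"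
abbreviation Fv :: "'n \<Rightarrow> real" where "Fv i \<equiv> gradv (a t) (Gs t) i x"

lemma G_diff: "s \<in> I \<Longrightarrow> y \<in> U \<Longrightarrow> Cinf_on (I \<times> U) K \<Longrightarrow> K differentiable (at (s, y))"
  by (rule Cinf_on_differentiable) auto

lemma pd_Gs: "s \<in> I \<Longrightarrow> y \<in> U \<Longrightarrow> pd j (Gs s) y = ddir (0, axis j 1) G (s, y)"
  by (rule slice_ddir[OF G_diff[OF _ _ G]])

lemma pd_pd_Gs:
  assumes "s \<in> I"
  shows "pd i (pd j (Gs s)) x = ddir (0, axis i 1) (ddir (0, axis j 1) G) (s, x)"
proof -
  have "pd i (pd j (Gs s)) x = pd i (\<lambda>y. ddir (0, axis j 1) G (s, y)) x"
    by (rule ddir_cong[OF M.U x pd_Gs[OF assms]])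
  also have "\<dots> = ddir (0, axis i 1) (ddir (0, axis j 1) G) (s, x)"
    by (rule slice_ddir[OF G_diff[OF assms x Cinf_on_ddir[OF G]]])
  finally show ?thesis .
qed

lemma near_I: "\<exists>d>0. \<forall>s. dist s t < d \<longrightarrow> s \<in> I"
  using I open_dist[of I] by auto

lemma dt_slice:
  assumes "Cinf_on (I \<times> U) K" "\<And>s. s \<in> I \<Longrightarrow> \<phi> s = K (s, x)"
  shows "(\<phi> has_real_derivative ddir (1, 0) K (t, x)) (at t within {0..T})"
proof -
  obtain d where d: "d > 0" "\<And>s. dist s t < d \<Longrightarrow> s \<in> I" using near_I by blast
  show ?thesis
    by (rule has_field_derivative_transform_within[OF slice_time[OF G_diff[OF I(2) x assms(1)]] d(1) tT(1)])
       (simp add: assms(2) d(2))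
qed

lemma dt_pd_G: "((\<lambda>s. pd j (Gs s) x) has_real_derivative pd j Gt x) (at t within {0..T})"
proof -
  have "((\<lambda>s. pd j (Gs s) x) has_real_derivative ddir (1, 0) (ddir (0, axis j 1) G) (t, x)) (at t within {0..T})"
    by (rule dt_slice[OF Cinf_on_ddir[OF G] pd_Gs[OF _ x]])
  also have "ddir (1, 0) (ddir (0, axis j 1) G) (t, x) = ddir (0, axis j 1) (ddir (1, 0) G) (t, x)"
    by (rule ddir_commute[OF G]) (use I x in auto)
  also have "\<dots> = pd j Gt x"
    by (rule slice_ddir[symmetric, OF G_diff[OF I(2) x Cinf_on_ddir[OF G]]])
  finally show ?thesis .
qed

lemma dt_pd_pd_G: "((\<lambda>s. pd i (pd j (Gs s)) x) has_real_derivative pd i (pd j Gt) x) (at t within {0..T})"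
proof -
  have "((\<lambda>s. pd i (pd j (Gs s)) x) has_real_derivative ddir (1, 0) (ddir (0, axis i 1) (ddir (0, axis j 1) G)) (t, x)) (at t within {0..T})"
    by (rule dt_slice[OF Cinf_on_ddir[OF Cinf_on_ddir[OF G]] pd_pd_Gs])
  also have "ddir (1, 0) (ddir (0, axis i 1) (ddir (0, axis j 1) G)) (t, x) = ddir (0, axis i 1) (ddir (1, 0) (ddir (0, axis j 1) G)) (t, x)"
    by (rule ddir_commute[OF Cinf_on_ddir[OF G]]) (use I x in auto)
  also have "\<dots> = ddir (0, axis i 1) (ddir (0, axis j 1) (ddir (1, 0) G)) (t, x)"
    by (rule ddir_cong[OF Cinf_on_open[OF G]]) (use I x in \<open>auto intro: ddir_commute[OF G]\<close>)
  also have "\<dots> = pd i (\<lambda>y. ddir (0, axis j 1) (ddir (1, 0) G) (t, y)) x"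
    by (rule slice_ddir[symmetric, OF G_diff[OF I(2) x Cinf_on_ddir[OF Cinf_on_ddir[OF G]]]])
  also have "\<dots> = pd i (pd j Gt) x"
    by (rule ddir_cong[OF M.U x]) (rule slice_ddir[symmetric, OF G_diff[OF I(2) _ Cinf_on_ddir[OF G]]])
  finally show ?thesis .
qed

text \<open>In invariant terms, the three sums are h(\<nabla>f, \<nabla>f), the inner product of h
  with the Hessian of f, and (div h - d(tr h)/2)(\<nabla>f).\<close>

abbreviation "hFF \<equiv> \<Sum>\<Sum>i j. h t x $ i $ j * (Fv i * Fv j)"
abbreviation "bhbH \<equiv> \<Sum>\<Sum>i j. (\<Sum>\<Sum>k l. bb i k * h t x $ k $ l * bb l j) * Hs (a t) (Gs t) i j x"
abbreviation "DT \<equiv> \<Sum>\<Sum>i j l. bb i j * Fv l * (Ncov (a t) (h t) i j l x - Ncov (a t) (h t) l i j x / 2)"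

lemma dt_grad2: "((\<lambda>s. grad2 (a s) (Gs s) x) has_real_derivative 2 * (\<Sum>\<Sum>i. Fv i * pd i Gt x) - hFF) (at t within {0..T})"
proof -
  let ?f = "\<lambda>i. pd i (Gs t) x" and ?p = "\<lambda>i. pd i Gt x"
  have "((\<lambda>s. grad2 (a s) (Gs s) x) has_real_derivative
      (\<Sum>\<Sum>i. ?p i * (\<Sum>\<Sum>j. bb i j * ?f j) + (\<Sum>\<Sum>j. dbb i j * ?f j + ?p j * bb i j) * ?f i)) (at t within {0..T})"
    unfolding grad2_def gradv_def by (intro DERIV_sum DERIV_mult dt_pd_G dt_b)
  moreover have "(\<Sum>\<Sum>i. ?p i * (\<Sum>\<Sum>j. bb i j * ?f j) + (\<Sum>\<Sum>j. dbb i j * ?f j + ?p j * bb i j) * ?f i)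
    = 2 * (\<Sum>\<Sum>i. Fv i * ?p i) - hFF"
  proof -
    have 1: "(\<Sum>\<Sum>i. ?p i * (\<Sum>\<Sum>j. bb i j * ?f j)) = (\<Sum>\<Sum>i. Fv i * ?p i)"
      unfolding gradv_def by (simp add: mult_ac)
    have 2: "(\<Sum>\<Sum>i. (\<Sum>\<Sum>j. ?p j * bb i j) * ?f i) = (\<Sum>\<Sum>i. Fv i * ?p i)"
      unfolding gradv_def sum_distrib_right by (subst sum.swap) (simp add: M.b_facts(4)[OF x] mult_ac)
    have 3: "(\<Sum>\<Sum>i. (\<Sum>\<Sum>j. dbb i j * ?f j) * ?f i) = - hFF"
    proof -
      have "(\<Sum>\<Sum>i. (\<Sum>\<Sum>j. dbb i j * ?f j) * ?f i)
        = - (\<Sum>\<Sum>i j m l. h t x $ m $ l * ((bb m i * ?f i) * (bb l j * ?f j)))"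
        by (simp add: sum_distrib_left sum_distrib_right sum_negf M.b_facts(4)[OF x, of _ "_ :: 'n"] mult_ac)
      also have "(\<Sum>\<Sum>i j m l. h t x $ m $ l * ((bb m i * ?f i) * (bb l j * ?f j)))
        = (\<Sum>\<Sum>m l i j. h t x $ m $ l * ((bb m i * ?f i) * (bb l j * ?f j)))"
        by (rule sum_swap_pairs)
      also have "\<dots> = hFF"
        unfolding gradv_def by (simp only: sum_product) (simp only: sum_distrib_left)
      finally show ?thesis .
    qed
    show ?thesis by (simp only: sum.distrib distrib_right 1 2 3)
  qed
  ultimately show ?thesis by simp
qed

text \<open>The cometric contributes the pairing of h with the Hessian; \<open>DT\<close> is the
  trace of the varied Christoffel symbols, applied to df.\<close>

lemma dt_Lap: "((\<lambda>s. Lap (a s) (Gs s) x) has_real_derivative Lap (a t) Gt x - bhbH - DT) (at t within {0..T})"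
proof -
  let ?f = "\<lambda>i. pd i (Gs t) x" and ?p = "\<lambda>i. pd i Gt x" and ?N = "\<lambda>i j l. Ncov (a t) (h t) i j l x"
  let ?dG = "\<lambda>k i j. (1/2) * (\<Sum>\<Sum>l. bb k l * (?N i j l + ?N j i l - ?N l i j))"
  have "((\<lambda>s. Lap (a s) (Gs s) x) has_real_derivative
     (\<Sum>\<Sum>i j. dbb i j * Hs (a t) (Gs t) i j x
       + (pd i (pd j Gt) x - (\<Sum>\<Sum>k. ?dG k i j * ?f k + ?p k * Gam (a t) k i j x)) * bb i j)) (at t within {0..T})"
    unfolding Lap_def Hs_def by (intro DERIV_sum DERIV_mult DERIV_diff dt_pd_G dt_pd_pd_G dt_b dt_Gam)
  moreover have "(\<Sum>\<Sum>i j. dbb i j * Hs (a t) (Gs t) i j x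
       + (pd i (pd j Gt) x - (\<Sum>\<Sum>k. ?dG k i j * ?f k + ?p k * Gam (a t) k i j x)) * bb i j)
     = Lap (a t) Gt x - bhbH - DT"
  proof -
    have 1: "(\<Sum>\<Sum>i j. dbb i j * Hs (a t) (Gs t) i j x) = - bhbH"
      by (simp add: sum_negf)
    have s: "(\<Sum>\<Sum>k. ?dG k i j * ?f k) = (1/2) * (\<Sum>\<Sum>l. Fv l * (?N i j l + ?N j i l - ?N l i j))" for i j
    proof -
      have "(\<Sum>\<Sum>k. ?dG k i j * ?f k) = (\<Sum>\<Sum>k l. (1/2) * ((bb l k * ?f k) * (?N i j l + ?N j i l - ?N l i j)))"
        unfolding sum_distrib_left sum_distrib_right by (intro sum.cong refl) (simp add: M.b_facts(4)[OF x, of _ "_ :: 'n"] mult_ac)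
      also have "\<dots> = (\<Sum>\<Sum>l k. (1/2) * ((bb l k * ?f k) * (?N i j l + ?N j i l - ?N l i j)))"
        by (rule sum.swap)
      finally show ?thesis unfolding gradv_def by (simp only: sum_distrib_left[symmetric] sum_distrib_right[symmetric])
    qed
    have 2: "(\<Sum>\<Sum>i j. (\<Sum>\<Sum>k. ?dG k i j * ?f k) * bb i j) = DT"
    proof -
      have "(\<Sum>\<Sum>i j. (\<Sum>\<Sum>k. ?dG k i j * ?f k) * bb i j)
        = (\<Sum>\<Sum>i j. (1/2) * (\<Sum>\<Sum>l. Fv l * (?N i j l + ?N j i l - ?N l i j)) * bb i j)"
        by (simp only: s)
      also have "\<dots> = (\<Sum>\<Sum>i j l. bb i j * Fv l * ?N i j l / 2) + (\<Sum>\<Sum>i j l. bb i j * Fv l * ?N j i l / 2)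
          - (\<Sum>\<Sum>i j l. bb i j * Fv l * ?N l i j / 2)"
        unfolding sum_distrib_left sum_distrib_right sum.distrib[symmetric] sum_subtractf[symmetric]
        by (intro sum.cong refl) (simp add: field_simps)
      \<comment> \<open>By symmetry of the cometric these two halves are equal and add up to one
        full divergence of h.\<close>
      also have "(\<Sum>\<Sum>i j l. bb i j * Fv l * ?N j i l / 2) = (\<Sum>\<Sum>i j l. bb i j * Fv l * ?N i j l / 2)"
        by (subst sum.swap) (intro sum.cong refl arg_cong2[where f = "(*)"] arg_cong2[where f = "(/)"] M.b_facts(4)[OF x])
      also have "(\<Sum>\<Sum>i j l. bb i j * Fv l * ?N i j l / 2) + (\<Sum>\<Sum>i j l. bb i j * Fv l * ?N i j l / 2)
          - (\<Sum>\<Sum>i j l. bb i j * Fv l * ?N l i j / 2) = DT"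
        unfolding sum.distrib[symmetric] sum_subtractf[symmetric]
        by (intro sum.cong refl) (simp add: right_diff_distrib)
      finally show ?thesis .
    qed
    have "(\<Sum>\<Sum>i j. dbb i j * Hs (a t) (Gs t) i j x
       + (pd i (pd j Gt) x - (\<Sum>\<Sum>k. ?dG k i j * ?f k + ?p k * Gam (a t) k i j x)) * bb i j)
      = (\<Sum>\<Sum>i j. dbb i j * Hs (a t) (Gs t) i j x) + Lap (a t) Gt x
        - (\<Sum>\<Sum>i j. (\<Sum>\<Sum>k. ?dG k i j * ?f k) * bb i j)"
      unfolding Lap_def Hs_def[of "a t" Gt] sum.distrib[symmetric] sum_subtractf[symmetric]
      by (intro sum.cong refl) (simp add: sum.distrib algebra_simps)
    then show ?thesis using 1 2 by simp
  qed
  ultimately show ?thesis by simp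
qed

section \<open>The inequality at a space-time maximum\<close>

text \<open>Three facts are combined: the Laplacian of Q is nonpositive, its gradient vanishes, and
  t (Q - B) has a nonnegative time derivative from the left. The pairing \<open>X\<close> of
  \<nabla>f with the gradient of the time derivative of f enters the Bochner formula and the time
  derivative of Q with the same factor 2 (1 - \<alpha>), so it cancels.\<close>

lemma max_inequality:
  fixes \<alpha> B :: real
  assumes heat: "\<And>s y. s \<in> I \<Longrightarrow> s \<in> {0..T} \<Longrightarrow> y \<in> U \<Longrightarrow> 2 * ddir (1, 0) G (s, y) = Lap (a s) (Gs s) y + grad2 (a s) (Gs s) y"
    and mx: "\<And>s y. s \<in> I \<Longrightarrow> s \<in> {0..T} \<Longrightarrow> y \<in> U \<Longrightarrow>
        s * (grad2 (a s) (Gs s) y - 2 * \<alpha> * ddir (1, 0) G (s, y) - B) \<le> t * (grad2 (a t) (Gs t) x - 2 * \<alpha> * ddir (1, 0) G (t, x) - B)"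
  shows "(grad2 (a t) (Gs t) x - 2 * \<alpha> * ddir (1, 0) G (t, x) - B) / t
    \<ge> (\<Sum>\<Sum>l i. Wm (a t) (Gs t) l i x * Wm (a t) (Gs t) i l x)
      + (\<Sum>\<Sum>j k. (\<Sum>\<Sum>i. Rm (a t) i k i j x) * Fv j * Fv k)
      + (1 - \<alpha>) * hFF - \<alpha> * bhbH - \<alpha> * DT"
proof -
  define Q0 where "Q0 y = grad2 (a t) (Gs t) y - (2 * \<alpha>) * Gt y" for y
  have CGs: "Cinf_on U (Gs t)" by (rule slice_Cinf[OF G I(2) M.U])
  have CGt: "Cinf_on U Gt" by (rule slice_Cinf[OF Cinf_on_ddir[OF G] I(2) M.U])
  have CQ: "Cinf_on U Q0" unfolding Q0_def[abs_def] by (intro Cinf_on_diff Cinf_on_cmult CGt M.Cgrad2[OF CGs])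
  have mQ: "Q0 y \<le> Q0 x" if "y \<in> U" for y
  proof -
    have "t * (Q0 y - B) \<le> t * (Q0 x - B)" using mx[OF I(2) tT(1) that] by (simp add: Q0_def)
    then show ?thesis using t by simp
  qed
  define X where "X = (\<Sum>\<Sum>i. Fv i * pd i Gt x)"
  have "0 \<ge> Lap (a t) Q0 x / 2" using Lap_le_zero_at_max[OF CQ mQ] by simp
  also have "Lap (a t) Q0 x / 2 = Lap (a t) (grad2 (a t) (Gs t)) x / 2 - \<alpha> * Lap (a t) Gt x"
    unfolding Q0_def[abs_def] Lap_diff_cmult[OF M.Cgrad2[OF CGs] CGt] by simp
  finally have A: "Lap (a t) (grad2 (a t) (Gs t)) x / 2 - \<alpha> * Lap (a t) Gt x \<le> 0" .
  \<comment> \<open>\<nabla>Q = 0 makes the gradient of |\<nabla>f|^2 equal to 2 \<alpha> times that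
    of the time derivative of f; the heat equation then determines the gradient of the
    Laplacian.\<close>
  have pdL: "pd i (Lap (a t) (Gs t)) x = 2 * (1 - \<alpha>) * pd i Gt x" for i
  proof -
    have "pd i Q0 x = pd i (grad2 (a t) (Gs t)) x - pd i (\<lambda>y. (2 * \<alpha>) * Gt y) x"
      unfolding Q0_def[abs_def] by (rule ddir_diff) (intro Cinf_on_differentiable[OF _ x] Cinf_on_cmult M.Cgrad2[OF CGs] CGt)+
    also have "pd i (\<lambda>y. (2 * \<alpha>) * Gt y) x = (2 * \<alpha>) * pd i Gt x"
      by (rule ddir_cmult) (rule Cinf_on_differentiable[OF CGt x])
    finally have g: "pd i (grad2 (a t) (Gs t)) x = 2 * \<alpha> * pd i Gt x"
      using local_max_second_derivative(1)[OF CQ x mQ] by simp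
    have "pd i (Lap (a t) (Gs t)) x = pd i (\<lambda>y. 2 * Gt y - grad2 (a t) (Gs t) y) x"
      by (rule ddir_cong[OF M.U x]) (simp add: heat[OF I(2) tT(1)])
    also have "\<dots> = pd i (\<lambda>y. 2 * Gt y) x - pd i (grad2 (a t) (Gs t)) x"
      by (rule ddir_diff) (intro Cinf_on_differentiable[OF _ x] Cinf_on_cmult M.Cgrad2[OF CGs] CGt)+
    also have "pd i (\<lambda>y. 2 * Gt y) x = 2 * pd i Gt x"
      by (rule ddir_cmult) (rule Cinf_on_differentiable[OF CGt x])
    finally show ?thesis using g by (simp add: algebra_simps)
  qed
  have X2: "(\<Sum>\<Sum>i. Fv i * pd i (Lap (a t) (Gs t)) x) = 2 * (1 - \<alpha>) * X"
    unfolding pdL X_def by (simp add: sum_distrib_left mult_ac)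
  note B1 = M.bochner[OF CGs x, unfolded X2]
  define Gtt where "Gtt = ddir (1, 0) (ddir (1, 0) G) (t, x)"
  have dGt: "((\<lambda>s. ddir (1, 0) G (s, x)) has_real_derivative Gtt) (at t within {0..T})"
    unfolding Gtt_def by (rule dt_slice[OF Cinf_on_ddir[OF G]]) simp
  \<comment> \<open>The heat equation differentiated in time. It holds only for times in [0,T], so
    the second time derivative of the extension is identified through uniqueness of derivatives
    relative to that interval.\<close>
  have tt: "2 * Gtt = (Lap (a t) Gt x - bhbH - DT) + (2 * X - hFF)"
  proof (rule uniq)
    show "((\<lambda>s. 2 * ddir (1, 0) G (s, x)) has_real_derivative 2 * Gtt) (at t within {0..T})"
      by (rule DERIV_cmult[OF dGt])
    obtain d where d: "d > 0" "\<And>s. dist s t < d \<Longrightarrow> s \<in> I" using near_I by blast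
    show "((\<lambda>s. 2 * ddir (1, 0) G (s, x)) has_real_derivative (Lap (a t) Gt x - bhbH - DT) + (2 * X - hFF)) (at t within {0..T})"
      by (rule has_field_derivative_transform_within[OF DERIV_add[OF dt_Lap dt_grad2[folded X_def]] d(1) tT(1)])
         (simp add: heat d(2) x)
  qed
  define Qd where "Qd = (2 * X - hFF) - 2 * \<alpha> * Gtt"
  let ?Q = "\<lambda>s. grad2 (a s) (Gs s) x - 2 * \<alpha> * ddir (1, 0) G (s, x) - B"
  have "(?Q has_real_derivative Qd) (at t within {0..T})"
    using DERIV_diff[OF DERIV_diff[OF dt_grad2[folded X_def] DERIV_cmult[OF dGt, of "2 * \<alpha>"]] DERIV_const[of B]]
    unfolding Qd_def by simp
  from DERIV_mult[OF DERIV_ident this]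
  have "((\<lambda>s. s * ?Q s) has_real_derivative ?Q t + Qd * t) (at t within {0..T})" by simp
  from left_derivative_nonneg[OF this t I mx[OF _ _ x]]
  have "0 \<le> ?Q t + Qd * t" by simp
  then have "?Q t / t + Qd \<ge> 0" using t by (simp add: field_simps)
  moreover have "Qd = 2 * (1 - \<alpha>) * X - (1 - \<alpha>) * hFF - \<alpha> * (Lap (a t) Gt x - bhbH - DT)"
  proof -
    have "2 * \<alpha> * Gtt = \<alpha> * ((Lap (a t) Gt x - bhbH - DT) + (2 * X - hFF))" unfolding tt[symmetric] by simp
    then show ?thesis unfolding Qd_def by (simp add: algebra_simps)
  qed
  ultimately show ?thesis using A B1 by (simp add: algebra_simps)
qed

end

end

section \<open>The quadratic inequality\<close>

text \<open>Here the constants are decided. Multiplication by 2 c, where c = n \<alpha>^2, turns D^2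
  / (2 n) into the square of Q + (\<alpha> - 1) y. Its mixed term absorbs what is linear in y; Q (Q
  - e), with e = 2 c / t, absorbs what is free of y.\<close>

lemma li_yau_scalar:
  fixes \<alpha> n t k1 k2 k3 k4 y Q B D hFF R DT P :: real
  assumes \<alpha>: "\<alpha> > 1" and n: "n > 0" and t: "t > 0"
    and k: "k1 \<ge> 0" "k2 \<ge> 0" "k3 \<ge> 0" "k4 \<ge> 0" and y: "y \<ge> 0"
    and B: "B = n * \<alpha>\<^sup>2 * (max k2 k3 + k3 + sqrt (2 * k4) + (k1 + k4) / (\<alpha> - 1))"
    and main: "(Q - B) / t \<ge> P + R + (1 - \<alpha>) * hFF - \<alpha> * DT"
    and P: "P \<ge> D\<^sup>2 / (2 * n) - \<alpha>\<^sup>2 * n * (max k2 k3)\<^sup>2 / 2"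
    and R: "R \<ge> - k1 * y" and hFF: "hFF \<le> k3 * y" and DT: "\<bar>DT\<bar> \<le> 3 / 2 * sqrt n * k4 * sqrt y"
    and D: "\<alpha> * D = - (Q + (\<alpha> - 1) * y)"
  shows "t * (Q - B) \<le> 2 * n * \<alpha>\<^sup>2"
proof (rule ccontr)
  assume "\<not> ?thesis"
  then have *: "2 * n * \<alpha>\<^sup>2 < t * (Q - B)" by simp
  define K where "K = max k2 k3"
  define C where "C = K + k3 + sqrt (2 * k4) + (k1 + k4) / (\<alpha> - 1)"
  define e where "e = 2 * n * \<alpha>\<^sup>2 / t"
  define c where "c = n * \<alpha>\<^sup>2"
  have K: "K \<ge> 0" using k by (simp add: K_def)
  have c: "c > 0" using n \<alpha> by (simp add: c_def)
  have Bc: "B = c * C" by (simp add: B c_def C_def K_def)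
  have C0: "C \<ge> K + sqrt (2 * k4)" "C \<ge> 0" using k K \<alpha> by (auto simp: C_def)
  have B0: "B \<ge> 0" using Bc c C0 by simp
  have e0: "e > 0" using n \<alpha> t by (simp add: e_def)
  have Qe: "Q - e > B" using * t by (simp add: e_def field_simps)
  then have Q: "Q > B" "Q > 0" using e0 B0 by linarith+
  \<comment> \<open>The denied claim says Q - e > B, so both factors exceed B, which is
    nonnegative.\<close>
  have QQ: "Q * (Q - e) > B * B"
    by (rule mult_strict_mono') (use Qe Q B0 in auto)
  have hF: "(1 - \<alpha>) * hFF \<ge> - ((\<alpha> - 1) * k3 * y)"
    using mult_left_mono[OF hFF, of "\<alpha> - 1"] \<alpha> by (simp add: algebra_simps)
  have dT: "\<alpha> * DT \<le> \<alpha> * (3 / 2 * sqrt n * k4 * sqrt y)"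
    using DT \<alpha> by (intro mult_left_mono) auto
  have "Q / t \<ge> (Q - B) / t" using B0 t by (simp add: divide_right_mono)
  then have m1: "Q / t \<ge> D\<^sup>2 / (2 * n) - \<alpha>\<^sup>2 * n * K\<^sup>2 / 2 - k1 * y - (\<alpha> - 1) * k3 * y - \<alpha> * (3 / 2 * sqrt n * k4 * sqrt y)"
    using main P R hF dT by (simp add: K_def)
  have "2 * c * (D\<^sup>2 / (2 * n) - \<alpha>\<^sup>2 * n * K\<^sup>2 / 2 - k1 * y - (\<alpha> - 1) * k3 * y - \<alpha> * (3 / 2 * sqrt n * k4 * sqrt y)) \<le> 2 * c * (Q / t)"
    by (rule mult_left_mono[OF m1]) (use c in simp)
  moreover have "2 * c * (Q / t) = Q * e" by (simp add: c_def e_def)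
  moreover have "2 * c * (D\<^sup>2 / (2 * n)) = (Q + (\<alpha> - 1) * y)\<^sup>2"
  proof -
    have "2 * c * (D\<^sup>2 / (2 * n)) = (\<alpha> * D)\<^sup>2" using n by (simp add: c_def power_mult_distrib)
    then show ?thesis unfolding D power2_minus .
  qed
  moreover have "2 * c * (\<alpha>\<^sup>2 * n * K\<^sup>2 / 2) = (c * K)\<^sup>2"
    by (simp add: c_def power2_eq_square)
  ultimately have m2: "(Q + (\<alpha> - 1) * y)\<^sup>2 - (c * K)\<^sup>2 - 2 * c * (k1 * y) - 2 * c * ((\<alpha> - 1) * k3 * y) - 2 * c * (\<alpha> * (3 / 2 * sqrt n * k4 * sqrt y)) \<le> Q * e"
    by (simp add: right_diff_distrib)
  have "(Q + (\<alpha> - 1) * y)\<^sup>2 = Q * Q + 2 * ((\<alpha> - 1) * y) * Q + ((\<alpha> - 1) * y)\<^sup>2" by (simp add: power2_eq_square algebra_simps)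
  moreover have "2 * ((\<alpha> - 1) * y) * Q \<ge> 2 * ((\<alpha> - 1) * y) * B"
    using Q \<alpha> y by (intro mult_left_mono) auto
  \<comment> \<open>The summands k3 and (k1 + k4) / (\<alpha> - 1) of the bound are made for this
    line: multiplied by \<alpha> - 1 they supply the required coefficients of y.\<close>
  moreover have "2 * ((\<alpha> - 1) * y) * B \<ge> 2 * c * (((\<alpha> - 1) * k3 + k1 + k4) * y)"
  proof -
    have "(\<alpha> - 1) * C = (\<alpha> - 1) * K + (\<alpha> - 1) * k3 + (\<alpha> - 1) * sqrt (2 * k4) + (k1 + k4)"
      using \<alpha> by (simp add: C_def field_simps)
    then have "(\<alpha> - 1) * C \<ge> (\<alpha> - 1) * k3 + k1 + k4" using \<alpha> K k by simp
    then have "2 * c * (((\<alpha> - 1) * k3 + k1 + k4) * y) \<le> 2 * c * (((\<alpha> - 1) * C) * y)"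
      using c y by (intro mult_left_mono mult_right_mono) auto
    then show ?thesis by (simp add: Bc mult_ac)
  qed
  ultimately have m3: "(Q + (\<alpha> - 1) * y)\<^sup>2 \<ge> Q * Q + 2 * c * (((\<alpha> - 1) * k3 + k1 + k4) * y)"
    using zero_le_power2[of "(\<alpha> - 1) * y"] by linarith
  \<comment> \<open>The summands max k2 k3 and sqrt (2 k4) pay for the terms free of y; the cross
    term of their squared sum is dropped.\<close>
  have BB: "B * B \<ge> (c * K)\<^sup>2 + 2 * c\<^sup>2 * k4"
  proof -
    have "(K + sqrt (2 * k4))\<^sup>2 \<le> C\<^sup>2" using C0 K k by (intro power_mono) auto
    moreover have "(K + sqrt (2 * k4))\<^sup>2 \<ge> K\<^sup>2 + 2 * k4"
      using K k by (simp add: power2_sum)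
    ultimately have "c\<^sup>2 * (K\<^sup>2 + 2 * k4) \<le> c\<^sup>2 * C\<^sup>2" by (intro mult_left_mono) auto
    then show ?thesis by (simp add: Bc power2_eq_square algebra_simps)
  qed
  have "2 * c * (\<alpha> * (3 / 2 * sqrt n * k4 * sqrt y)) \<le> 2 * c\<^sup>2 * k4 + 2 * c * (k4 * y)"
  proof -
    \<comment> \<open>As p^2 = c and q^2 = y, the inequality 3 p q <= 2 p^2 + 2 q^2 splits the term
      with sqrt y into a constant, covered by sqrt (2 k4), and a multiple of y, covered by k4 /
      (\<alpha> - 1).\<close>
    define p q where "p = \<alpha> * sqrt n" and "q = sqrt y"
    have pq: "p\<^sup>2 = c" "q\<^sup>2 = y" using n y by (simp_all add: p_def q_def c_def power_mult_distrib)
    have "3 * (p * q) \<le> 2 * p\<^sup>2 + 2 * q\<^sup>2"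
    proof -
      have "0 \<le> 2 * (p - q)\<^sup>2 + p * q" using \<alpha> n y by (simp add: p_def q_def)
      then show ?thesis by (simp add: power2_eq_square algebra_simps)
    qed
    then have le: "c * k4 * (3 * (p * q)) \<le> c * k4 * (2 * c + 2 * y)"
      unfolding pq using c k by (intro mult_left_mono) auto
    have eq: "2 * c * (\<alpha> * (3 / 2 * sqrt n * k4 * sqrt y)) = c * k4 * (3 * (p * q))"
      by (simp add: p_def q_def)
    show ?thesis unfolding eq using le by (simp add: power2_eq_square algebra_simps)
  qed
  moreover have "Q * (Q - e) = Q * Q - Q * e" by (simp add: right_diff_distrib)
  moreover have "2 * c * (((\<alpha> - 1) * k3 + k1 + k4) * y) = 2 * c * ((\<alpha> - 1) * k3 * y) + 2 * c * (k1 * y) + 2 * c * (k4 * y)"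
    by (simp add: algebra_simps)
  ultimately show False using m2 m3 BB QQ by linarith
qed

context evolving_metric_at
begin

text \<open>The two-sided bound max k2 k3 on h feeds the Frobenius estimate. The constant k3 appears
  once more on its own because h(\<nabla>f, \<nabla>f) has the negative coefficient 1 - \<alpha> and
  is therefore estimated from above.\<close>

lemma max_bound:
  fixes \<alpha> k1 k2 k3 k4 B :: real
  assumes I: "open I" "t \<in> I" and G: "Cinf_on (I \<times> U) G"
    and \<alpha>: "\<alpha> > 1" and k: "k1 \<ge> 0" "k2 \<ge> 0" "k3 \<ge> 0" "k4 \<ge> 0"
    and B: "B = real CARD('n) * \<alpha>\<^sup>2 * (max k2 k3 + k3 + sqrt (2 * k4) + (k1 + k4) / (\<alpha> - 1))"
    and ric: "\<And>v. (\<Sum>\<Sum>j k. (\<Sum>\<Sum>i. Rm (a t) i k i j x) * v j * v k)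
      \<ge> - k1 * (\<Sum>\<Sum>i j. a t x $ i $ j * (v i * v j))"
    and lower: "\<And>v. (\<Sum>\<Sum>i j. h t x $ i $ j * (v i * v j)) \<ge> - k2 * (\<Sum>\<Sum>i j. a t x $ i $ j * (v i * v j))"
    and upper: "\<And>v. (\<Sum>\<Sum>i j. h t x $ i $ j * (v i * v j)) \<le> k3 * (\<Sum>\<Sum>i j. a t x $ i $ j * (v i * v j))"
    and nabla: "sqrt (\<Sum>\<Sum>k i j k' i' j'.
        bb k k' * bb i i' * bb j j' * Ncov (a t) (h t) k i j x * Ncov (a t) (h t) k' i' j' x) \<le> k4"
    and heat: "\<And>s y. s \<in> I \<Longrightarrow> s \<in> {0..T} \<Longrightarrow> y \<in> U \<Longrightarrow>
        2 * ddir (1, 0) G (s, y) = Lap (a s) (\<lambda>y. G (s, y)) y + grad2 (a s) (\<lambda>y. G (s, y)) y"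
    and mx: "\<And>s y. s \<in> I \<Longrightarrow> s \<in> {0..T} \<Longrightarrow> y \<in> U \<Longrightarrow>
        s * (grad2 (a s) (\<lambda>y. G (s, y)) y - 2 * \<alpha> * ddir (1, 0) G (s, y) - B)
        \<le> t * (grad2 (a t) (\<lambda>y. G (t, y)) x - 2 * \<alpha> * ddir (1, 0) G (t, x) - B)"
  shows "t * (grad2 (a t) (\<lambda>y. G (t, y)) x - 2 * \<alpha> * ddir (1, 0) G (t, x) - B) \<le> 2 * real CARD('n) * \<alpha>\<^sup>2"
proof -
  let ?g = "\<lambda>y. G (t, y)"
  have Cg: "Cinf_on U ?g" by (rule slice_Cinf[OF G I(2) M.U])
  note main = max_inequality[OF I G heat mx]
  have aa: "(\<Sum>\<Sum>i j. a t x $ i $ j * (v i * v j)) \<ge> 0" for v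
  proof (cases "v = (\<lambda>_. 0)")
    case False
    from M.a_pos[OF x this] show ?thesis by (simp add: mult_ac)
  qed simp
  have hK: "\<bar>\<Sum>\<Sum>i j. h t x $ i $ j * (v i * v j)\<bar> \<le> max k2 k3 * (\<Sum>\<Sum>i j. a t x $ i $ j * (v i * v j))" for v
  proof -
    have "k2 * (\<Sum>\<Sum>i j. a t x $ i $ j * (v i * v j)) \<le> max k2 k3 * (\<Sum>\<Sum>i j. a t x $ i $ j * (v i * v j))"
      "k3 * (\<Sum>\<Sum>i j. a t x $ i $ j * (v i * v j)) \<le> max k2 k3 * (\<Sum>\<Sum>i j. a t x $ i $ j * (v i * v j))"
      by (intro mult_right_mono aa; simp)+
    then show ?thesis using lower[of v] upper[of v] by linarith
  qed
  have K: "max k2 k3 \<ge> 0" using k by simp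
  note fb = frame_bounds[where a = "\<lambda>i j. a t x $ i $ j" and b = bb and H = "\<lambda>i j. Hs (a t) ?g i j x"
      and h = "\<lambda>i j. h t x $ i $ j" and N = "\<lambda>k i j. Ncov (a t) (h t) k i j x" and f = "\<lambda>i. pd i ?g x"
      and F = "\<lambda>i. gradv (a t) ?g i x",
      OF M.b_facts(4)[OF x] M.b_facts(5)[OF x] M.b_facts(2)[OF x] M.Hs_sym[OF Cg x] h_sym gradv_def K hK k(4) nabla]
  have y: "(\<Sum>\<Sum>i. pd i ?g x * gradv (a t) ?g i x) = grad2 (a t) ?g x" unfolding grad2_def ..
  show ?thesis
  proof (rule li_yau_scalar[OF \<alpha> _ t(1) k _ B _ fb(3) _ _ fb(4)])
    show "0 \<le> (\<Sum>\<Sum>i. pd i ?g x * gradv (a t) ?g i x)" by (rule fb(1))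
    show "(\<Sum>\<Sum>i j. h t x $ i $ j * (gradv (a t) ?g i x * gradv (a t) ?g j x)) \<le> k3 * (\<Sum>\<Sum>i. pd i ?g x * gradv (a t) ?g i x)"
      using upper[of "\<lambda>i. gradv (a t) ?g i x"] unfolding fb(2) .
    show "- k1 * (\<Sum>\<Sum>i. pd i ?g x * gradv (a t) ?g i x) \<le> (\<Sum>\<Sum>j k. (\<Sum>\<Sum>i. Rm (a t) i k i j x) * gradv (a t) ?g j x * gradv (a t) ?g k x)"
      using ric[of "\<lambda>i. gradv (a t) ?g i x"] unfolding fb(2) .
    \<comment> \<open>The heat equation trades the time derivative in Q for the Laplacian, so the
      trace of the Hessian becomes a combination of Q and y.\<close>
    show "\<alpha> * (\<Sum>\<Sum>i j. bb i j * Hs (a t) ?g i j x)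
      = - (grad2 (a t) ?g x - 2 * \<alpha> * ddir (1, 0) G (t, x) + (\<alpha> - 1) * (\<Sum>\<Sum>i. pd i ?g x * gradv (a t) ?g i x))"
    proof -
      have e: "(\<Sum>\<Sum>i j. bb i j * Hs (a t) ?g i j x) = 2 * ddir (1, 0) G (t, x) - grad2 (a t) ?g x"
        using heat[OF I(2) tT(1) x] unfolding Lap_def by simp
      show ?thesis unfolding y e by (simp add: algebra_simps)
    qed
  qed (use main in \<open>simp_all add: Wm_def\<close>)
qed

end

section \<open>Tensors on a manifold in coordinates\<close>

lemma is_chartD:
  assumes "is_chart c"
  shows "open (fst c)" "open (snd c ` fst c)" "continuous_on (fst c) (snd c)" "continuous_on (snd c ` fst c) (chart_inv c)"
    "\<And>p. p \<in> fst c \<Longrightarrow> chart_inv c (snd c p) = p"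
    "\<And>y. y \<in> snd c ` fst c \<Longrightarrow> chart_inv c y \<in> fst c" "\<And>y. y \<in> snd c ` fst c \<Longrightarrow> snd c (chart_inv c y) = y"
  using assms unfolding is_chart_def homeomorphism_def by auto

lemma chart_image_open:
  assumes c: "is_chart c" and N: "open N"
  shows "open (snd c ` (fst c \<inter> N))"
proof -
  have "snd c ` (fst c \<inter> N) = chart_inv c -` N \<inter> snd c ` fst c"
    using is_chartD(5,6,7)[OF c] by (auto simp: image_iff)
  moreover have "open (chart_inv c -` N \<inter> snd c ` fst c)"
    using is_chartD(2,4)[OF c] N by (metis continuous_on_open_vimage)
  ultimately show ?thesis by simp
qed

lemma chart_partial_pd: "chart_partial c i f p = pd i (f \<circ> chart_inv c) (snd c p)"
  by (simp add: chart_partial_def)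

locale smooth_manifold =
  fixes A :: "('m::t2_space, 'n::finite) chart set"
  assumes atlas: "smooth_atlas A"
begin

lemma chart: "c \<in> A \<Longrightarrow> is_chart c"
  using atlas by (auto simp: smooth_atlas_def)

lemma transition:
  assumes "c \<in> A" "d \<in> A"
  shows "Cinf_on (snd c ` (fst c \<inter> fst d)) (snd d \<circ> chart_inv c)"
  using atlas assms chart_image_open[OF chart[OF assms(1)] is_chartD(1)[OF chart[OF assms(2)]]]
  by (auto simp: smooth_atlas_def intro: Cinf_on_smooth_on)

lemma smooth_near_iff:
  "smooth_near A p f \<longleftrightarrow> (\<exists>N. open N \<and> p \<in> N \<and> (\<forall>c\<in>A. Cinf_on (snd c ` (fst c \<inter> N)) (f \<circ> chart_inv c)))"
  unfolding smooth_near_def smooth_fun_on_def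
  using smooth_on_Cinf Cinf_on_smooth_on chart_image_open[OF chart] by metis

lemma smooth_near_combine:
  assumes "smooth_near A p f" "smooth_near A p h"
    and "\<And>S (c :: ('m, 'n) chart). Cinf_on S (f \<circ> chart_inv c) \<Longrightarrow> Cinf_on S (h \<circ> chart_inv c) \<Longrightarrow> Cinf_on S (k \<circ> chart_inv c)"
  shows "smooth_near A p k"
proof -
  obtain N where N: "open N" "p \<in> N" "\<forall>c\<in>A. Cinf_on (snd c ` (fst c \<inter> N)) (f \<circ> chart_inv c)"
    using assms(1) smooth_near_iff by blast
  obtain N' where N': "open N'" "p \<in> N'" "\<forall>c\<in>A. Cinf_on (snd c ` (fst c \<inter> N')) (h \<circ> chart_inv c)"
    using assms(2) smooth_near_iff by blast
  have "Cinf_on (snd c ` (fst c \<inter> (N \<inter> N'))) (k \<circ> chart_inv c)" if c: "c \<in> A" for c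
  proof (rule assms(3))
    have op: "open (snd c ` (fst c \<inter> (N \<inter> N')))" by (rule chart_image_open[OF chart[OF c]]) (use N N' in auto)
    show "Cinf_on (snd c ` (fst c \<inter> (N \<inter> N'))) (f \<circ> chart_inv c)"
      by (rule Cinf_on_subset[OF N(3)[rule_format, OF c] op]) auto
    show "Cinf_on (snd c ` (fst c \<inter> (N \<inter> N'))) (h \<circ> chart_inv c)"
      by (rule Cinf_on_subset[OF N'(3)[rule_format, OF c] op]) auto
  qed
  then show ?thesis unfolding smooth_near_iff using N N' by (intro exI[of _ "N \<inter> N'"]) auto
qed

lemma smooth_near_lincomb:
  assumes "smooth_near A p f" "smooth_near A p h"
  shows "smooth_near A p (\<lambda>q. a * f q + b * h q)"
  by (rule smooth_near_combine[OF assms]) (simp add: o_def Cinf_on_add Cinf_on_cmult)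

lemma smooth_near_mult:
  assumes "smooth_near A p f" "smooth_near A p h"
  shows "smooth_near A p (\<lambda>q. f q * h q)"
  by (rule smooth_near_combine[OF assms]) (simp add: o_def Cinf_on_mult)

lemma smooth_near_differentiable:
  assumes "smooth_near A p f" "c \<in> A" "p \<in> fst c"
  shows "(f \<circ> chart_inv c) differentiable (at (snd c p))"
  using assms unfolding smooth_near_iff by (auto intro: Cinf_on_differentiable)

text \<open>Coordinates have arbitrary values outside the chart domain; the domain itself serves as
  the neighbourhood, and there smoothness is that of the transition maps.\<close>

lemma smooth_near_coord:
  assumes "c \<in> A" "p \<in> fst c"
  shows "smooth_near A p (\<lambda>q. snd c q $ j)"
  unfolding smooth_near_iff
proof (intro exI[of _ "fst c"] conjI ballI)
  show "open (fst c)" "p \<in> fst c" using is_chartD(1)[OF chart] assms by auto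
  fix d assume "d \<in> A"
  have "bounded_linear (\<lambda>y :: real ^ 'n. y $ j)" by (rule bounded_linear_vec_nth)
  from Ck_on_bounded_linear[OF this, where f = "snd c \<circ> chart_inv d"] transition[OF \<open>d \<in> A\<close> assms(1)]
  have "open (snd d ` (fst d \<inter> fst c)) \<and> Ck_on k (snd d ` (fst d \<inter> fst c)) (\<lambda>y. (snd c \<circ> chart_inv d) y $ j)" for k
    unfolding Cinf_on_def by metis
  then show "Cinf_on (snd d ` (fst d \<inter> fst c)) ((\<lambda>q. snd c q $ j) \<circ> chart_inv d)"
    unfolding Cinf_on_def by (simp add: o_def)
qed

lemma coord_vec_tangent:
  assumes c: "c \<in> A" "p \<in> fst c"
  shows "coord_vec A c p i \<in> tangent_space A p"
proof -
  note d = smooth_near_differentiable[OF _ c, unfolded o_def]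
  have "chart_partial c i (\<lambda>q. a * f q + b * h q) p = a * chart_partial c i f p + b * chart_partial c i h p"
    if f: "smooth_near A p f" and h: "smooth_near A p h" for f h a b
  proof -
    have "pd i (\<lambda>y. a * f (chart_inv c y) + b * h (chart_inv c y)) (snd c p)
      = pd i (\<lambda>y. a * f (chart_inv c y)) (snd c p) + pd i (\<lambda>y. b * h (chart_inv c y)) (snd c p)"
      by (rule ddir_add; intro differentiable_mult differentiable_const d f h)
    also have "\<dots> = a * pd i (\<lambda>y. f (chart_inv c y)) (snd c p) + b * pd i (\<lambda>y. h (chart_inv c y)) (snd c p)"
      by (simp add: ddir_cmult[OF d[OF f]] ddir_cmult[OF d[OF h]])
    finally show ?thesis by (simp add: chart_partial_def o_def)
  qed
  moreover have "chart_partial c i (\<lambda>q. f q * h q) p = chart_partial c i f p * h p + f p * chart_partial c i h p"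
    if f: "smooth_near A p f" and h: "smooth_near A p h" for f h
    using ddir_mult[OF d[OF f] d[OF h], of "axis i 1"] is_chartD(5)[OF chart[OF c(1)] c(2)]
    by (simp add: chart_partial_def o_def)
  ultimately show ?thesis
    unfolding tangent_space_def coord_vec_def using smooth_near_lincomb smooth_near_mult by simp
qed

text \<open>Evaluation on coordinate functions recovers components. This gives linear independence
  of the coordinate vectors, and it is how the Ricci tensor reads its arguments.\<close>

lemma coord_vec_coord:
  assumes c: "c \<in> A" "p \<in> fst c"
  shows "coord_vec A c p i (\<lambda>q. snd c q $ j) = (if i = j then 1 else 0)"
proof -
  note ch = chart[OF c(1)]
  have "pd i ((\<lambda>q. snd c q $ j) \<circ> chart_inv c) (snd c p) = pd i (\<lambda>y. y $ j) (snd c p)"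
    by (rule ddir_cong[OF is_chartD(2)[OF ch]]) (use c is_chartD(7)[OF ch] in auto)
  also have "\<dots> = axis i 1 $ j"
    by (rule ddir_eqI) (rule bounded_linear_imp_has_derivative[OF bounded_linear_vec_nth])
  finally show ?thesis using smooth_near_coord[OF c] by (simp add: coord_vec_def chart_partial_def axis_def)
qed

text \<open>The hypotheses of the theorem speak about all tangent vectors; inserting these
  combinations turns them into inequalities between quadratic forms in v.\<close>

definition tvec_of :: "('m, 'n) chart \<Rightarrow> 'm \<Rightarrow> ('n \<Rightarrow> real) \<Rightarrow> 'm tvec" where
  "tvec_of c p v = (\<lambda>\<phi>. \<Sum>\<Sum>i. v i * coord_vec A c p i \<phi>)"

lemma tangent_space_lincomb:
  assumes "X \<in> tangent_space A p" "Y \<in> tangent_space A p"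
  shows "(\<lambda>\<phi>. a * X \<phi> + b * Y \<phi>) \<in> tangent_space A p"
  using assms unfolding tangent_space_def by (simp add: algebra_simps)

lemma tangent_space_sum:
  assumes "\<And>i. X i \<in> tangent_space A p" "finite S"
  shows "(\<lambda>\<phi>. \<Sum>i\<in>S. v i * X i \<phi>) \<in> tangent_space A p"
  using assms(2)
proof (induction S)
  case empty
  then show ?case by (simp add: tangent_space_def)
next
  case (insert s S)
  have "(\<lambda>\<phi>. v s * X s \<phi> + 1 * (\<Sum>i\<in>S. v i * X i \<phi>)) \<in> tangent_space A p"
    by (rule tangent_space_lincomb[OF assms(1) insert.IH])
  then show ?case using insert.hyps by simp
qed

lemma tvec_of_tangent: "c \<in> A \<Longrightarrow> p \<in> fst c \<Longrightarrow> tvec_of c p v \<in> tangent_space A p"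
  unfolding tvec_of_def by (intro tangent_space_sum coord_vec_tangent) auto

lemma tvec_of_coord:
  assumes c: "c \<in> A" "p \<in> fst c"
  shows "tvec_of c p v (\<lambda>q. snd c q $ j) = v j"
  unfolding tvec_of_def by (simp add: coord_vec_coord[OF c] if_distrib[of "\<lambda>x. _ * x"] cong: if_cong)

lemma tensor_sum_left:
  assumes h: "symmetric_tensor2 A h" and X: "\<And>i. X i \<in> tangent_space A p" and Z: "Z \<in> tangent_space A p" and S: "finite S"
  shows "h p (\<lambda>\<phi>. \<Sum>i\<in>S. v i * X i \<phi>) Z = (\<Sum>i\<in>S. v i * h p (X i) Z)"
proof -
  have lin: "h p (\<lambda>f. a * X f + b * Y f) Z = a * h p X Z + b * h p Y Z"
    if "X \<in> tangent_space A p" "Y \<in> tangent_space A p" for X Y a b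
    using h Z that unfolding symmetric_tensor2_def by blast
  show ?thesis using S
proof (induction S)
  case empty
  \<comment> \<open>The empty sum is the zero functional; writing it as 0 Z + 0 Z lets linearity
    give the value 0.\<close>
  have "h p (\<lambda>f. 0 * Z f + 0 * Z f) Z = 0 * h p Z Z + 0 * h p Z Z"
    by (rule lin[OF Z Z])
  then show ?case by simp
next
  case (insert s S)
  have "h p (\<lambda>\<phi>. v s * X s \<phi> + 1 * (\<Sum>i\<in>S. v i * X i \<phi>)) Z = v s * h p (X s) Z + 1 * h p (\<lambda>\<phi>. \<Sum>i\<in>S. v i * X i \<phi>) Z"
    by (rule lin[OF X tangent_space_sum[OF X insert.hyps(1)]])
  then show ?case using insert by simp
qed
qed

lemma tensor_tvec_of_left:
  assumes h: "symmetric_tensor2 A h" and c: "c \<in> A" "p \<in> fst c" and Z: "Z \<in> tangent_space A p"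
  shows "h p (tvec_of c p v) Z = (\<Sum>\<Sum>i. v i * h p (coord_vec A c p i) Z)"
  unfolding tvec_of_def by (rule tensor_sum_left[OF h coord_vec_tangent[OF c] Z]) simp

lemma tensor_sym: "symmetric_tensor2 A h \<Longrightarrow> X \<in> tangent_space A p \<Longrightarrow> Y \<in> tangent_space A p \<Longrightarrow> h p X Y = h p Y X"
  unfolding symmetric_tensor2_def by blast

lemma tensor_tvec_of:
  assumes h: "symmetric_tensor2 A h" and c: "c \<in> A" "p \<in> fst c"
  shows "h p (tvec_of c p v) (tvec_of c p w) = (\<Sum>\<Sum>i j. comps A c h p $ i $ j * (v i * w j))"
proof -
  have "h p (coord_vec A c p i) (tvec_of c p w) = (\<Sum>\<Sum>j. w j * comps A c h p $ i $ j)" for i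
  proof -
    have "h p (coord_vec A c p i) (tvec_of c p w) = h p (tvec_of c p w) (coord_vec A c p i)"
      by (rule tensor_sym[OF h coord_vec_tangent[OF c] tvec_of_tangent[OF c]])
    also have "\<dots> = (\<Sum>\<Sum>j. w j * h p (coord_vec A c p j) (coord_vec A c p i))"
      by (rule tensor_tvec_of_left[OF h c coord_vec_tangent[OF c]])
    also have "\<dots> = (\<Sum>\<Sum>j. w j * comps A c h p $ i $ j)"
      by (intro sum.cong refl) (simp add: comps_def tensor_sym[OF h coord_vec_tangent[OF c] coord_vec_tangent[OF c], of _ i])
    finally show ?thesis .
  qed
  then show ?thesis
    unfolding tensor_tvec_of_left[OF h c tvec_of_tangent[OF c]] by (simp add: sum_distrib_left mult_ac)
qed

lemma comps_sym:
  assumes h: "symmetric_tensor2 A h" and c: "c \<in> A" "p \<in> fst c"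
  shows "comps A c h p $ i $ j = comps A c h p $ j $ i"
  unfolding comps_def using tensor_sym[OF h coord_vec_tangent[OF c] coord_vec_tangent[OF c]] by simp

lemma metric_local:
  assumes h: "riemannian_metric A h" and c: "c \<in> A"
  shows "local_metric (snd c ` fst c) (\<lambda>y. comps A c h (chart_inv c y))"
proof
  note ch = chart[OF c]
  have sym: "symmetric_tensor2 A h" using h by (simp add: riemannian_metric_def)
  show op: "open (snd c ` fst c)" by (rule is_chartD(2)[OF ch])
  show "Cinf_on (snd c ` fst c) (\<lambda>x. comps A c h (chart_inv c x) $ i $ j)" for i j
  proof -
    have "smooth_on (snd c ` (fst c \<inter> fst c)) ((\<lambda>p. comps A c h p $ i $ j) \<circ> chart_inv c)"
      using h c unfolding riemannian_metric_def smooth_fun_on_def by blast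
    then show ?thesis using Cinf_on_smooth_on[OF _ op] by (simp add: o_def)
  qed
  fix x i j assume "x \<in> snd c ` fst c"
  then show "comps A c h (chart_inv c x) $ i $ j = comps A c h (chart_inv c x) $ j $ i"
    by (intro comps_sym[OF sym c] is_chartD(6)[OF ch])
next
  fix x and v :: "'n \<Rightarrow> real" assume x: "x \<in> snd c ` fst c" and v: "v \<noteq> (\<lambda>_. 0)"
  note ch = chart[OF c]
  have sym: "symmetric_tensor2 A h" using h by (simp add: riemannian_metric_def)
  let ?p = "chart_inv c x"
  have p: "?p \<in> fst c" by (rule is_chartD(6)[OF ch x])
  \<comment> \<open>Positivity is known for nonzero derivations, and a combination with a nonzero
    coefficient is detected by a coordinate function.\<close>
  have "tvec_of c ?p v \<noteq> (\<lambda>f. 0)"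
  proof
    assume "tvec_of c ?p v = (\<lambda>f. 0)"
    then have "v j = 0" for j using tvec_of_coord[OF c p, of v j] by simp
    then show False using v by auto
  qed
  then have "h ?p (tvec_of c ?p v) (tvec_of c ?p v) > 0"
    using h tvec_of_tangent[OF c p] unfolding riemannian_metric_def by blast
  then show "0 < (\<Sum>\<Sum>i j. v i * v j * comps A c h ?p $ i $ j)"
    unfolding tensor_tvec_of[OF sym c p] by (simp add: mult_ac)
qed

text \<open>\<open>J\<close> is the Jacobian of the transition map from d to c. The chain rule holds
  for every f differentiable in c; the equality of derivations follows because coordinate vectors
  are 0 by convention on functions that are not smooth near p.\<close>

lemma coord_vec_change:
  assumes c: "c \<in> A" "p \<in> fst c" and d: "d \<in> A" "p \<in> fst d"
  shows "\<exists>J. (\<forall>f j. (f \<circ> chart_inv c) differentiable (at (snd c p)) \<longrightarrow>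
      chart_partial d j f p = (\<Sum>\<Sum>i. J j i * chart_partial c i f p)) \<and>
    (\<forall>j. coord_vec A d p j = tvec_of c p (J j))"
proof -
  let ?S = "snd d ` (fst d \<inter> fst c)" and ?\<tau> = "snd c \<circ> chart_inv d"
  note chc = chart[OF c(1)] and chd = chart[OF d(1)]
  have pS: "snd d p \<in> ?S" using c d by blast
  have \<tau>p: "?\<tau> (snd d p) = snd c p" using is_chartD(5)[OF chd d(2)] by simp
  have opS: "open ?S" by (rule chart_image_open[OF chd is_chartD(1)[OF chc]])
  have der\<tau>: "(?\<tau> has_derivative (\<lambda>v. ddir v ?\<tau> (snd d p))) (at (snd d p))"
    by (rule has_derivative_ddir[OF Cinf_on_differentiable[OF transition[OF d(1) c(1)] pS]])
  define J where "J j i = ddir (axis j 1) ?\<tau> (snd d p) $ i" for j i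
  have J: "chart_partial d j f p = (\<Sum>\<Sum>i. J j i * chart_partial c i f p)"
    if f: "(f \<circ> chart_inv c) differentiable (at (snd c p))" for f j
  proof -
    have "((f \<circ> chart_inv c) \<circ> ?\<tau> has_derivative (\<lambda>w. ddir w (f \<circ> chart_inv c) (snd c p)) \<circ> (\<lambda>v. ddir v ?\<tau> (snd d p))) (at (snd d p))"
      by (rule diff_chain_at[OF der\<tau>]) (unfold \<tau>p, rule has_derivative_ddir[OF f])
    from ddir_eqI[OF this, of "axis j 1"]
    have "ddir (axis j 1) ((f \<circ> chart_inv c) \<circ> ?\<tau>) (snd d p) = ddir (ddir (axis j 1) ?\<tau> (snd d p)) (f \<circ> chart_inv c) (snd c p)"
      by simp
    moreover have "ddir (axis j 1) (f \<circ> chart_inv d) (snd d p) = ddir (axis j 1) ((f \<circ> chart_inv c) \<circ> ?\<tau>) (snd d p)"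
    proof (rule ddir_cong[OF opS pS])
      fix y assume "y \<in> ?S"
      then obtain q where q: "q \<in> fst d" "q \<in> fst c" "y = snd d q" by blast
      show "(f \<circ> chart_inv d) y = ((f \<circ> chart_inv c) \<circ> ?\<tau>) y"
        unfolding q(3) o_def is_chartD(5)[OF chd q(1)] is_chartD(5)[OF chc q(2)] ..
    qed
    moreover have "ddir (ddir (axis j 1) ?\<tau> (snd d p)) (f \<circ> chart_inv c) (snd c p) = (\<Sum>\<Sum>i. J j i * chart_partial c i f p)"
      unfolding chart_partial_def J_def by (rule linear_ddir_axis[OF f])
    ultimately show ?thesis
      unfolding chart_partial_pd by (simp only:)
  qed
  moreover have "coord_vec A d p j = tvec_of c p (J j)" for j
  proof
    fix f show "coord_vec A d p j f = tvec_of c p (J j) f"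
      using J[OF smooth_near_differentiable[OF _ c], of f j] by (cases "smooth_near A p f") (auto simp: coord_vec_def tvec_of_def)
  qed
  ultimately show ?thesis by (intro exI[of _ J] conjI allI impI)
qed

lemma grad_tvec_of:
  assumes c: "c \<in> A" "p \<in> fst c"
  shows "grad A c h f p = tvec_of c p (\<lambda>i. gradv (\<lambda>y. comps A c h (chart_inv c y)) (f \<circ> chart_inv c) i (snd c p))"
  unfolding grad_def tvec_of_def gradv_def cometric_def chart_partial_def
  by (simp add: is_chartD(5)[OF chart[OF c(1)] c(2)])

lemma metric_grad_coord:
  assumes h: "riemannian_metric A h" and c: "c \<in> A" "p \<in> fst c"
  shows "h p (grad A c h f p) (coord_vec A c p i) = chart_partial c i f p"
proof -
  note ch = chart[OF c(1)]
  have sym: "symmetric_tensor2 A h" using h by (simp add: riemannian_metric_def)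
  have x: "snd c p \<in> snd c ` fst c" using c by simp
  interpret local_metric "snd c ` fst c" "\<lambda>y. comps A c h (chart_inv c y)" by (rule metric_local[OF h c(1)])
  let ?a = "comps A c h p" and ?f = "\<lambda>i. chart_partial c i f p"
  have p: "chart_inv c (snd c p) = p" by (rule is_chartD(5)[OF ch c(2)])
  have "h p (grad A c h f p) (coord_vec A c p i) = (\<Sum>\<Sum>j. (\<Sum>\<Sum>k. matrix_inv ?a $ j $ k * ?f k) * ?a $ j $ i)"
    unfolding grad_tvec_of[OF c] tensor_tvec_of_left[OF sym c coord_vec_tangent[OF c]]
    by (simp add: gradv_def p comps_def chart_partial_def)
  also have "\<dots> = (\<Sum>\<Sum>j k. ?a $ i $ j * matrix_inv ?a $ j $ k * ?f k)"
    unfolding sum_distrib_right by (simp add: comps_sym[OF sym c, of i] mult_ac)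
  also have "\<dots> = (\<Sum>\<Sum>k. (\<Sum>\<Sum>j. ?a $ i $ j * matrix_inv ?a $ j $ k) * ?f k)"
    by (subst sum.swap) (simp add: sum_distrib_right)
  also have "\<dots> = ?f i"
    using b_facts(2)[OF x] by (simp add: p if_distrib[of "\<lambda>x. x * _"] cong: if_cong)
  finally show ?thesis .
qed

lemma grad_norm_eq:
  assumes h: "riemannian_metric A h" and c: "c \<in> A" "p \<in> fst c"
  shows "(tvec_norm h p (grad A c h f p))\<^sup>2 = h p (grad A c h f p) (grad A c h f p)"
    "h p (grad A c h f p) (grad A c h f p) = grad2 (\<lambda>y. comps A c h (chart_inv c y)) (f \<circ> chart_inv c) (snd c p)"
proof -
  have sym: "symmetric_tensor2 A h" using h by (simp add: riemannian_metric_def)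
  have gt: "grad A c h f p \<in> tangent_space A p" unfolding grad_tvec_of[OF c] by (rule tvec_of_tangent[OF c])
  \<comment> \<open>Positivity is assumed off the zero vector only, so the value at zero comes from
    linearity.\<close>
  have "h p (\<lambda>f. 0) (\<lambda>f. 0) = 0"
    using tensor_sum_left[OF sym gt gt, of "{}"] tensor_sum_left[OF sym gt, of "\<lambda>f. 0" "{}"] tangent_space_sum[OF gt, of "{}"] by simp
  then have "h p (grad A c h f p) (grad A c h f p) \<ge> 0"
    using h gt unfolding riemannian_metric_def by (cases "grad A c h f p = (\<lambda>f. 0)") (auto simp: less_imp_le)
  then show "(tvec_norm h p (grad A c h f p))\<^sup>2 = h p (grad A c h f p) (grad A c h f p)"
    unfolding tvec_norm_def by simp
  have "h p (grad A c h f p) (grad A c h f p) = h p (tvec_of c p (\<lambda>i. gradv (\<lambda>y. comps A c h (chart_inv c y)) (f \<circ> chart_inv c) i (snd c p))) (grad A c h f p)"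
    by (simp only: grad_tvec_of[OF c])
  also have "\<dots> = (\<Sum>\<Sum>i. gradv (\<lambda>y. comps A c h (chart_inv c y)) (f \<circ> chart_inv c) i (snd c p) * h p (coord_vec A c p i) (grad A c h f p))"
    by (rule tensor_tvec_of_left[OF sym c gt])
  also have "\<dots> = grad2 (\<lambda>y. comps A c h (chart_inv c y)) (f \<circ> chart_inv c) (snd c p)"
    unfolding grad2_def tensor_sym[OF sym coord_vec_tangent[OF c] gt] metric_grad_coord[OF h c]
    by (simp add: chart_partial_def mult_ac)
  finally show "h p (grad A c h f p) (grad A c h f p) = grad2 (\<lambda>y. comps A c h (chart_inv c y)) (f \<circ> chart_inv c) (snd c p)" .
qed

text \<open>Both gradients represent \<open>df\<close>, so each of their squared norms equals their inner product.\<close>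

lemma grad_norm_chart_independent:
  assumes h: "riemannian_metric A h" and c: "c \<in> A" "p \<in> fst c" and d: "d \<in> A" "p \<in> fst d"
    and fc: "(f \<circ> chart_inv c) differentiable (at (snd c p))" and fd: "(f \<circ> chart_inv d) differentiable (at (snd d p))"
  shows "h p (grad A c h f p) (grad A c h f p) = h p (grad A d h f p) (grad A d h f p)"
proof -
  have sym: "symmetric_tensor2 A h" using h by (simp add: riemannian_metric_def)
  have gt: "grad A c h f p \<in> tangent_space A p" if "c \<in> A" "p \<in> fst c" for c
    unfolding grad_tvec_of[OF that] by (rule tvec_of_tangent[OF that])
  have *: "h p (grad A d h f p) (grad A c h f p) = h p (grad A d h f p) (grad A d h f p)"
    if c: "c \<in> A" "p \<in> fst c" and d: "d \<in> A" "p \<in> fst d" and fc: "(f \<circ> chart_inv c) differentiable (at (snd c p))" for c d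
  proof -
    obtain J where J: "\<forall>f j. (f \<circ> chart_inv c) differentiable (at (snd c p)) \<longrightarrow> chart_partial d j f p = (\<Sum>\<Sum>i. J j i * chart_partial c i f p)"
      "\<forall>j. coord_vec A d p j = tvec_of c p (J j)" using coord_vec_change[OF c d] by (elim exE conjE)
    have eq: "h p (coord_vec A d p j) (grad A c h f p) = h p (coord_vec A d p j) (grad A d h f p)" for j
    proof -
      have "h p (coord_vec A d p j) (grad A c h f p) = (\<Sum>\<Sum>i. J j i * h p (coord_vec A c p i) (grad A c h f p))"
        unfolding J(2)[rule_format] by (rule tensor_tvec_of_left[OF sym c gt[OF c]])
      also have "\<dots> = chart_partial d j f p"
        unfolding tensor_sym[OF sym coord_vec_tangent[OF c] gt[OF c]] metric_grad_coord[OF h c] J(1)[rule_format, OF fc] ..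
      also have "\<dots> = h p (coord_vec A d p j) (grad A d h f p)"
        unfolding tensor_sym[OF sym coord_vec_tangent[OF d] gt[OF d]] metric_grad_coord[OF h d] ..
      finally show ?thesis .
    qed
    obtain v where v: "grad A d h f p = tvec_of d p v" using grad_tvec_of[OF d] by blast
    have "h p (tvec_of d p v) (grad A c h f p) = h p (tvec_of d p v) (grad A d h f p)"
      unfolding tensor_tvec_of_left[OF sym d gt[OF c]] tensor_tvec_of_left[OF sym d gt[OF d]] eq ..
    then show ?thesis using v by simp
  qed
  show ?thesis
    using *[OF c d fc] *[OF d c fd] tensor_sym[OF sym gt[OF c] gt[OF d]] by simp
qed

end

lemma Lap_cong:
  assumes "open V" "y \<in> V" "\<And>z. z \<in> V \<Longrightarrow> f z = f' z"
  shows "Lap a f y = Lap a f' y"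
proof -
  have 1: "pd j f z = pd j f' z" if "z \<in> V" for j z by (rule ddir_cong[OF assms(1) that assms(3)])
  have "pd i (pd j f) y = pd i (pd j f') y" for i j by (rule ddir_cong[OF assms(1,2) 1])
  then show ?thesis unfolding Lap_def Hs_def using 1[OF assms(2)] by simp
qed

lemma grad2_cong:
  assumes "open V" "y \<in> V" "\<And>z. z \<in> V \<Longrightarrow> f z = f' z"
  shows "grad2 a f y = grad2 a f' y"
proof -
  have "pd j f y = pd j f' y" for j by (rule ddir_cong[OF assms])
  then show ?thesis unfolding grad2_def gradv_def by simp
qed

text \<open>The sum of the two left-hand sides is \<Delta>f / f, which turns the heat equation for u
  into the equation 2 v_t = \<Delta>v + |\<nabla>v|^2 for v = ln u.\<close>

lemma (in local_metric) Lap_ln: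
  assumes f: "Cinf_on U f" and pos: "\<And>y. y \<in> U \<Longrightarrow> f y > 0" and x: "x \<in> U"
  shows "grad2 a (\<lambda>y. ln (f y)) x = grad2 a f x / (f x)\<^sup>2"
    and "Lap a (\<lambda>y. ln (f y)) x = Lap a f x / f x - grad2 a f x / (f x)\<^sup>2"
proof -
  have nz: "f y \<noteq> 0" if "y \<in> U" for y using pos[OF that] by simp
  have d1: "pd j (\<lambda>y. ln (f y)) y = pd j f y * (1 / f y)" if "y \<in> U" for j y
    by (rule ddir_ln(1)[OF dif[OF f that] pos[OF that]])
  have d2: "pd i (pd j (\<lambda>y. ln (f y))) x = pd i (pd j f) x / f x - pd i f x * pd j f x / (f x)\<^sup>2" for i j
  proof -
    have "pd i (pd j (\<lambda>y. ln (f y))) x = pd i (\<lambda>y. pd j f y * (1 / f y)) x"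
      by (rule ddir_cong[OF U x d1])
    also have "\<dots> = pd j f x * pd i (\<lambda>y. 1 / f y) x + pd i (pd j f) x * (1 / f x)"
      by (rule ddir_mult) (intro dif[OF _ x] Cinf_on_ddir Cinf_on_recip f nz, assumption?)+
    also have "pd i (\<lambda>y. 1 / f y) x = - pd i f x * (1 / f x) * (1 / f x)"
      by (rule ddir_inverse[OF dif[OF f x] nz[OF x]])
    finally show ?thesis by (simp add: power2_eq_square)
  qed
  show "grad2 a (\<lambda>y. ln (f y)) x = grad2 a f x / (f x)\<^sup>2"
    unfolding grad2_def gradv_def d1[OF x]
    by (simp add: sum_distrib_left sum_divide_distrib power2_eq_square mult_ac)
  have Hl: "Hs a (\<lambda>y. ln (f y)) i j x = Hs a f i j x / f x - pd i f x * pd j f x / (f x)\<^sup>2" for i j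
    unfolding Hs_def d2 d1[OF x] by (simp add: diff_divide_distrib sum_divide_distrib)
  have "Lap a (\<lambda>y. ln (f y)) x = (\<Sum>\<Sum>i j. b i j x * Hs a f i j x / f x)
     - (\<Sum>\<Sum>i j. b i j x * (pd i f x * pd j f x / (f x)\<^sup>2))"
    unfolding Lap_def Hl by (simp add: right_diff_distrib sum_subtractf)
  then show "Lap a (\<lambda>y. ln (f y)) x = Lap a f x / f x - grad2 a f x / (f x)\<^sup>2"
    unfolding Lap_def grad2_def gradv_def by (simp add: sum_distrib_left sum_divide_distrib mult_ac)
qed

section \<open>Joint continuity in time and space\<close>

text \<open>The definition of the metric family provides continuity in space at each time and a
  jointly continuous time derivative. Near a given point this derivative is bounded, so the
  functions are Lipschitz in time uniformly in y, and joint continuity follows.\<close>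

lemma continuous_on_C1_in_time:
  fixes \<alpha> \<eta> :: "real \<Rightarrow> 'a::metric_space \<Rightarrow> real"
  assumes sp: "\<And>t. t \<in> {0..T} \<Longrightarrow> continuous_on U (\<alpha> t)"
    and dt: "\<And>t y. t \<in> {0..T} \<Longrightarrow> y \<in> U \<Longrightarrow> ((\<lambda>s. \<alpha> s y) has_real_derivative \<eta> t y) (at t within {0..T})"
    and \<eta>: "continuous_on ({0..T} \<times> U) (\<lambda>(t, y). \<eta> t y)"
  shows "continuous_on ({0..T} \<times> U) (\<lambda>(t, y). \<alpha> t y)"
  unfolding continuous_on_iff
proof (intro ballI allI impI)
  fix p :: "real \<times> 'a" and e :: real assume p: "p \<in> {0..T} \<times> U" and e: "e > 0"
  obtain t0 y0 where p0: "p = (t0, y0)" "t0 \<in> {0..T}" "y0 \<in> U" using p by auto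
  obtain d where d: "d > 0" "\<And>q. q \<in> {0..T} \<times> U \<Longrightarrow> dist q (t0, y0) < d \<Longrightarrow> dist ((\<lambda>(t, y). \<eta> t y) q) (\<eta> t0 y0) < 1"
    using \<eta>[unfolded continuous_on_iff, rule_format, of "(t0, y0)" 1] p0 by auto
  \<comment> \<open>A bound for \<open>\<eta>\<close> within distance d of the base point, from
    continuity with tolerance 1.\<close>
  define M where "M = \<bar>\<eta> t0 y0\<bar> + 1"
  have M: "M > 0" by (simp add: M_def)
  obtain d' where d': "d' > 0" "\<And>y. y \<in> U \<Longrightarrow> dist y y0 < d' \<Longrightarrow> dist (\<alpha> t0 y) (\<alpha> t0 y0) < e / 2"
    using sp[OF p0(2), unfolded continuous_on_iff, rule_format, OF p0(3), of "e/2"] e by auto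
  define r where "r = min (min (d / 2) d') (e / (2 * M))"
  have r: "r > 0" "r \<le> d / 2" "r \<le> d'" "r \<le> e / (2 * M)" using d d' e M by (auto simp: r_def)
  show "\<exists>\<delta>>0. \<forall>q\<in>{0..T} \<times> U. dist q p < \<delta> \<longrightarrow> dist ((\<lambda>(t, y). \<alpha> t y) q) ((\<lambda>(t, y). \<alpha> t y) p) < e"
  proof (intro exI[of _ r] conjI ballI impI)
    show "r > 0" by fact
    fix q assume q: "q \<in> {0..T} \<times> U" "dist q p < r"
    obtain t y where ty: "q = (t, y)" "t \<in> {0..T}" "y \<in> U" using q by auto
    have dd: "dist t t0 < r" "dist y y0 < r"
      using q(2) dist_fst_le[of q p] dist_snd_le[of q p] by (auto simp: ty p0)
    have "norm (\<alpha> t y - \<alpha> t0 y) \<le> M * norm (t - t0)"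
    proof (rule field_differentiable_bound[where S = "{0..T} \<inter> ball t0 r" and f = "\<lambda>s. \<alpha> s y" and f' = "\<lambda>s. \<eta> s y"])
      show "convex ({0..T} \<inter> ball t0 r)" by (intro convex_Int convex_ball) simp
      show "t \<in> {0..T} \<inter> ball t0 r" "t0 \<in> {0..T} \<inter> ball t0 r" using ty p0 dd r by (auto simp: dist_commute)
      fix s assume s: "s \<in> {0..T} \<inter> ball t0 r"
      show "((\<lambda>s. \<alpha> s y) has_real_derivative \<eta> s y) (at s within {0..T} \<inter> ball t0 r)"
        by (rule DERIV_subset[OF dt]) (use s ty in auto)
      have "dist (s, y) (t0, y0) \<le> dist s t0 + dist y y0" by (simp add: dist_Pair_Pair sqrt_sum_squares_le_sum)
      then have "dist (s, y) (t0, y0) < d" using s dd r by (simp add: dist_commute)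
      from d(2)[OF _ this] s ty show "norm (\<eta> s y) \<le> M" by (auto simp: dist_real_def M_def)
    qed
    also have "\<dots> < M * (e / (2 * M))" using dd r M by (intro mult_strict_left_mono) (auto simp: dist_real_def)
    finally have "\<bar>\<alpha> t y - \<alpha> t0 y\<bar> < e / 2" using M by simp
    moreover have "dist (\<alpha> t0 y) (\<alpha> t0 y0) < e / 2" using d'(2)[OF ty(3)] dd r by simp
    ultimately show "dist ((\<lambda>(t, y). \<alpha> t y) q) ((\<lambda>(t, y). \<alpha> t y) p) < e"
      by (simp only: ty p0 dist_real_def split_conv)
  qed
qed

lemma continuous_on_chart_inv:
  assumes c: "is_chart c" and V: "V \<subseteq> snd c ` fst c" and F: "continuous_on (S \<times> fst c) (\<lambda>(t, p). F t p)"
  shows "continuous_on (S \<times> V) (\<lambda>(t, y). F t (chart_inv c y))"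
proof -
  have "continuous_on (S \<times> V) (\<lambda>q. chart_inv c (snd q))"
    by (rule continuous_on_compose2[OF continuous_on_subset[OF is_chartD(4)[OF c] V] continuous_on_snd[OF continuous_on_id]]) auto
  then have 1: "continuous_on (S \<times> V) (\<lambda>q. (fst q, chart_inv c (snd q)))"
    by (rule continuous_on_Pair[OF continuous_on_fst[OF continuous_on_id]])
  have "(\<lambda>q. (fst q, chart_inv c (snd q))) ` (S \<times> V) \<subseteq> S \<times> fst c"
    using V is_chartD(6)[OF c] by force
  from continuous_on_compose2[OF F 1 this] show ?thesis by (simp add: split_beta)
qed

section \<open>The geometric quantities in a chart\<close>

context smooth_manifold
begin

context
  fixes c p
  assumes c: "c \<in> A" "p \<in> fst c"
begin

lemma christoffel_Gam: "christoffel A c h k i j p = Gam (\<lambda>y. comps A c h (chart_inv c y)) k i j (snd c p)"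
  unfolding christoffel_def Gam_def cometric_def chart_partial_def
  by (simp add: is_chartD(5)[OF chart[OF c(1)] c(2)] o_def)

lemma chart_partial_cong:
  assumes "\<And>y. y \<in> snd c ` fst c \<Longrightarrow> f (chart_inv c y) = f' y"
  shows "chart_partial c i f p = pd i f' (snd c p)"
  unfolding chart_partial_def
  by (rule ddir_cong[OF is_chartD(2)[OF chart[OF c(1)]]]) (use assms c in auto)

end

text \<open>The symbols as functions of the coordinates y on the whole chart image, as needed to
  differentiate them in the curvature.\<close>

lemma christoffel_Gam_inv:
  assumes "c \<in> A" "y \<in> snd c ` fst c"
  shows "christoffel A c h k i j (chart_inv c y) = Gam (\<lambda>y. comps A c h (chart_inv c y)) k i j y"
  using christoffel_Gam[OF assms(1) is_chartD(6)[OF chart[OF assms(1)] assms(2)]]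
  by (simp add: is_chartD(7)[OF chart[OF assms(1)] assms(2)])

context
  fixes c p
  assumes c: "c \<in> A" "p \<in> fst c"
begin

lemma riemann_Rm: "riemann A c h l k i j p = Rm (\<lambda>y. comps A c h (chart_inv c y)) l k i j (snd c p)"
proof -
  have "chart_partial c i (christoffel A c h l j k) p = pd i (Gam (\<lambda>y. comps A c h (chart_inv c y)) l j k) (snd c p)" for i l j k
    by (rule chart_partial_cong[OF c]) (rule christoffel_Gam_inv[OF c(1)])
  then show ?thesis unfolding riemann_def Rm_def christoffel_Gam[OF c] by simp
qed

lemma laplacian_Lap: "laplacian A c h f p = Lap (\<lambda>y. comps A c h (chart_inv c y)) (f \<circ> chart_inv c) (snd c p)"
proof -
  have "chart_partial c i (chart_partial c j f) p = pd i (pd j (f \<circ> chart_inv c)) (snd c p)" for i j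
    by (rule chart_partial_cong[OF c]) (simp add: chart_partial_def is_chartD(7)[OF chart[OF c(1)]])
  then show ?thesis
    unfolding laplacian_def Lap_def Hs_def cometric_def christoffel_Gam[OF c] chart_partial_pd
    by (simp add: is_chartD(5)[OF chart[OF c(1)] c(2)])
qed

lemma ricci_tvec_of: "ricci A c h p (tvec_of c p v) (tvec_of c p v)
    = (\<Sum>\<Sum>j k. (\<Sum>\<Sum>i. Rm (\<lambda>y. comps A c h (chart_inv c y)) i k i j (snd c p)) * v j * v k)"
  unfolding ricci_def riemann_Rm tvec_of_coord[OF c] ..

lemma cov_deriv2_Ncov: "cov_deriv2 A c h b k i j p
    = Ncov (\<lambda>y. comps A c h (chart_inv c y)) (\<lambda>y. comps A c b (chart_inv c y)) k i j (snd c p)"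
  unfolding cov_deriv2_def Ncov_def christoffel_Gam[OF c] chart_partial_pd
  by (simp add: is_chartD(5)[OF chart[OF c(1)] c(2)] o_def)

end

end

locale metric_flow = smooth_manifold A
  for A :: "('m::t2_space, 'n::finite) chart set" +
  fixes T :: real and g :: "real \<Rightarrow> 'm tensor2"
  assumes T: "T > 0" and metrics: "C1_metric_family A T g"
begin

lemma metric: "t \<in> {0..T} \<Longrightarrow> riemannian_metric A (g t)"
  using metrics by (simp add: C1_metric_family_def)

lemma metric_tensor: "t \<in> {0..T} \<Longrightarrow> symmetric_tensor2 A (g t)"
  using metric by (simp add: riemannian_metric_def)

lemma dt_comps:
  assumes t: "t \<in> {0..T}" and c: "c \<in> A" "p \<in> fst c"
  shows "((\<lambda>s. comps A c (g s) p $ i $ j) has_real_derivative comps A c (dt_tensor T g t) p $ i $ j) (at t within {0..T})"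
proof -
  have "(\<lambda>s. g s p (coord_vec A c p i) (coord_vec A c p j)) differentiable (at t within {0..T})"
    using metrics coord_vec_tangent[OF c] t unfolding C1_metric_family_def by blast
  then show ?thesis
    unfolding comps_def dt_tensor_def has_real_derivative_iff_has_vector_derivative
    by (simp add: vector_derivative_works[symmetric])
qed

text \<open>The time derivative is defined separately for each pair of vectors. Its bilinear
  expression is inherited from that of the metric by differentiating under the finite sums.\<close>

lemma dt_tensor_tvec_of:
  assumes t: "t \<in> {0..T}" and c: "c \<in> A" "p \<in> fst c"
  shows "dt_tensor T g t p (tvec_of c p v) (tvec_of c p v) = (\<Sum>\<Sum>i j. comps A c (dt_tensor T g t) p $ i $ j * (v i * v j))"
proof -
  have "((\<lambda>s. \<Sum>\<Sum>i j. comps A c (g s) p $ i $ j * (v i * v j)) has_real_derivative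
     (\<Sum>\<Sum>i j. comps A c (dt_tensor T g t) p $ i $ j * (v i * v j))) (at t within {0..T})"
    by (intro DERIV_sum DERIV_cmult_right dt_comps[OF t c])
  then have "((\<lambda>s. g s p (tvec_of c p v) (tvec_of c p v)) has_real_derivative
     (\<Sum>\<Sum>i j. comps A c (dt_tensor T g t) p $ i $ j * (v i * v j))) (at t within {0..T})"
    by (rule has_field_derivative_transform_within[of _ _ _ _ 1]) (use t tensor_tvec_of[OF metric_tensor c] in auto)
  then show ?thesis
    unfolding dt_tensor_def has_real_derivative_iff_has_vector_derivative
    using vector_derivative_within_cbox[of 0 T t] T t by simp
qed

lemma evolving:
  assumes c: "c \<in> A" and V: "open V" "V \<subseteq> snd c ` fst c"
  shows "evolving_metric V (\<lambda>t y. comps A c (g t) (chart_inv c y)) (\<lambda>t y. comps A c (dt_tensor T g t) (chart_inv c y)) T"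
proof (rule evolving_metric.intro)
  note ch = chart[OF c]
  show "local_metric V (\<lambda>y. comps A c (g t) (chart_inv c y))" if "t \<in> {0..T}" for t
    by (rule local_metric_subset[OF metric_local[OF metric[OF that] c] V])
  show "((\<lambda>s. comps A c (g s) (chart_inv c x) $ i $ j) has_real_derivative comps A c (dt_tensor T g t) (chart_inv c x) $ i $ j) (at t within {0..T})"
    if "t \<in> {0..T}" "x \<in> V" for t x i j
    by (rule dt_comps[OF that(1) c is_chartD(6)[OF ch]]) (use that V in auto)
  show "(\<lambda>y. comps A c (dt_tensor T g t) (chart_inv c y) $ i $ j) differentiable (at x)" if "t \<in> {0..T}" "x \<in> V" for t x i j
  proof -
    have "Ck_on 1 (snd c ` fst c) ((\<lambda>p. comps A c (dt_tensor T g t) p $ i $ j) \<circ> chart_inv c)"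
      using metrics c that unfolding C1_metric_family_def by blast
    then have "\<forall>x\<in>snd c ` fst c. ((\<lambda>p. comps A c (dt_tensor T g t) p $ i $ j) \<circ> chart_inv c) differentiable (at x)"
      unfolding One_nat_def Ck_on.simps(2) by (rule conjunct1)
    then show ?thesis using that V unfolding o_def by blast
  qed
  show "continuous_on ({0..T} \<times> V) (\<lambda>(t, x). pd k (\<lambda>y. comps A c (dt_tensor T g t) (chart_inv c y) $ i $ j) x)" for i j k
  proof -
    have "continuous_on ({0..T} \<times> fst c) (\<lambda>(t, p). chart_partial c k (\<lambda>q. comps A c (dt_tensor T g t) q $ i $ j) p)"
      using metrics c unfolding C1_metric_family_def by blast
    from continuous_on_chart_inv[OF ch V(2) this]
    have "continuous_on ({0..T} \<times> V) (\<lambda>(t, y). chart_partial c k (\<lambda>q. comps A c (dt_tensor T g t) q $ i $ j) (chart_inv c y))" .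
    then show ?thesis
      by (rule continuous_on_eq) (use V(2) is_chartD(7)[OF ch] in \<open>auto simp: chart_partial_def o_def\<close>)
  qed
qed

lemma comps_continuous:
  assumes c: "c \<in> A"
  shows "continuous_on ({0..T} \<times> snd c ` fst c) (\<lambda>(t, y). comps A c (g t) (chart_inv c y) $ i $ j)"
proof (rule continuous_on_C1_in_time[where \<eta> = "\<lambda>t y. comps A c (dt_tensor T g t) (chart_inv c y) $ i $ j"])
  note ch = chart[OF c]
  show "continuous_on (snd c ` fst c) (\<lambda>y. comps A c (g t) (chart_inv c y) $ i $ j)" if "t \<in> {0..T}" for t
    by (rule Cinf_on_continuous_on[OF local_metric.a[OF metric_local[OF metric[OF that] c]]])
  show "((\<lambda>s. comps A c (g s) (chart_inv c y) $ i $ j) has_real_derivative comps A c (dt_tensor T g t) (chart_inv c y) $ i $ j) (at t within {0..T})"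
    if "t \<in> {0..T}" "y \<in> snd c ` fst c" for t y
    by (rule dt_comps[OF that(1) c is_chartD(6)[OF ch that(2)]])
  show "continuous_on ({0..T} \<times> snd c ` fst c) (\<lambda>(t, y). comps A c (dt_tensor T g t) (chart_inv c y) $ i $ j)"
    by (rule continuous_on_chart_inv[OF ch subset_refl]) (use metrics c in \<open>simp add: C1_metric_family_def\<close>)
qed

end

section \<open>Global maximum principle\<close>

locale heat_flow = metric_flow A T g
  for A :: "('m::t2_space, 'n::finite) chart set" and T :: real and g :: "real \<Rightarrow> 'm tensor2" +
  fixes u :: "real \<Rightarrow> 'm \<Rightarrow> real"
  assumes u_smooth: "smooth_spacetime A T u"
    and u_pos: "\<And>t p. t \<in> {0..T} \<Longrightarrow> u t p > 0"
    and heat: "\<And>t c p. t \<in> {0..T} \<Longrightarrow> c \<in> A \<Longrightarrow> p \<in> fst c \<Longrightarrow>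
      ((\<lambda>s. u s p) has_real_derivative (1/2) * laplacian A c (g t) (u t) p) (at t within {0..T})"
begin

lemma vector_derivative_time:
  fixes \<phi> :: "real \<Rightarrow> real"
  assumes "t \<in> {0..T}" "(\<phi> has_real_derivative D) (at t within {0..T})"
  shows "vector_derivative \<phi> (at t within {0..T}) = D"
proof -
  have "(\<phi> has_vector_derivative D) (at t within cbox 0 T)"
    using assms(2) by (simp only: has_real_derivative_iff_has_vector_derivative cbox_interval)
  from vector_derivative_within_cbox[OF T _ this] assms(1) show ?thesis by (simp only: cbox_interval)
qed

text \<open>The extension supplied by smoothness is shrunk to a product neighbourhood on which it is
  positive, so that its logarithm is smooth there, also at times outside [0,T]. It agrees with u
  only for times in [0,T].\<close>

lemma extension:
  assumes c: "c \<in> A" and t: "t \<in> {0..T}" and x: "x \<in> snd c ` fst c"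
  shows "\<exists>I V E. open I \<and> t \<in> I \<and> open V \<and> x \<in> V \<and> V \<subseteq> snd c ` fst c \<and> Cinf_on (I \<times> V) E \<and>
    (\<forall>z\<in>I \<times> V. E z > 0) \<and> (\<forall>s\<in>I \<inter> {0..T}. \<forall>y\<in>V. E (s, y) = u s (chart_inv c y))"
proof -
  let ?U = "snd c ` fst c"
  have opU: "open ?U" by (rule is_chartD(2)[OF chart[OF c]])
  have "smooth_on ({0..T} \<times> ?U) (\<lambda>(t, x). u t (chart_inv c x))"
    using u_smooth c by (simp add: smooth_spacetime_def)
  then have "\<exists>W E. open W \<and> (t, x) \<in> W \<and> (\<forall>k. Ck_on k W E) \<and> (\<forall>y\<in>({0..T} \<times> ?U) \<inter> W. E y = (\<lambda>(t, x). u t (chart_inv c x)) y)"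
    using t x unfolding smooth_on_def by (elim ballE[of _ _ "(t, x)"]) auto
  then obtain W E where W: "open W" "(t, x) \<in> W" "\<forall>k. Ck_on k W E" "\<forall>y\<in>({0..T} \<times> ?U) \<inter> W. E y = (\<lambda>(t, x). u t (chart_inv c x)) y"
    by (elim exE conjE)
  have CE: "Cinf_on W E" using W(1,3) unfolding Cinf_on_def by (rule conjI)
  have opP: "open (E -` {0<..} \<inter> W)"
    using Cinf_on_continuous_on[OF CE] W(1) by (metis continuous_on_open_vimage open_greaterThan)
  define W' where "W' = (E -` {0<..} \<inter> W) \<inter> (UNIV \<times> ?U)"
  have opW': "open W'" unfolding W'_def by (intro open_Int opP open_Times open_UNIV opU)
  have inW': "(t, x) \<in> W'"
    using W(2,4) t x u_pos[OF t] by (simp add: W'_def)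
  from open_prod_elim[OF opW' inW'] obtain I V where "open I" "open V" "(t, x) \<in> I \<times> V" "I \<times> V \<subseteq> W'" .
  then have IV: "open I" "open V" "t \<in> I" "x \<in> V" "I \<times> V \<subseteq> W'" by auto
  have "V \<subseteq> ?U" using IV by (auto simp: W'_def)
  moreover have "Cinf_on (I \<times> V) E"
    by (rule Cinf_on_subset[OF CE open_Times[OF IV(1,2)]]) (use IV in \<open>auto simp: W'_def\<close>)
  moreover have "\<forall>z\<in>I \<times> V. E z > 0" using IV(5) by (auto simp: W'_def)
  moreover have "E (s, y) = u s (chart_inv c y)" if "s \<in> I \<inter> {0..T}" "y \<in> V" for s y
  proof -
    have "(s, y) \<in> W'" using that IV(5) by auto
    then have "(s, y) \<in> ({0..T} \<times> ?U) \<inter> W" using that by (auto simp: W'_def)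
    with W(4) show ?thesis by (metis (mono_tags, lifting) case_prod_conv)
  qed
  ultimately show ?thesis using IV by (intro exI[of _ I] exI[of _ V] exI[of _ E] conjI ballI) auto
qed

lemma u_differentiable:
  assumes c: "c \<in> A" "p \<in> fst c" and t: "t \<in> {0..T}"
  shows "(u t \<circ> chart_inv c) differentiable (at (snd c p))"
proof -
  obtain I V E where E: "open I" "t \<in> I" "open V" "snd c p \<in> V" "Cinf_on (I \<times> V) E" "\<forall>s\<in>I \<inter> {0..T}. \<forall>y\<in>V. E (s, y) = u s (chart_inv c y)"
    using extension[OF c(1) t imageI[OF c(2)]] by (elim exE conjE)
  have "(\<lambda>y. E (t, y)) differentiable (at (snd c p))"
    by (rule Cinf_on_differentiable[OF slice_Cinf[OF E(5,2,3)] E(4)])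
  then show ?thesis
    by (rule differentiable_cong_open[OF E(3,4), rotated]) (use E(2,6) t in auto)
qed

text \<open>The maximum principle needs one function on all of M, while a gradient is computed in a
  chart; \<open>grad_sq_eq\<close> shows that the choice made here is immaterial.\<close>

definition chart_at :: "'m \<Rightarrow> ('m, 'n) chart" where
  "chart_at p = (SOME c. c \<in> A \<and> p \<in> fst c)"

definition grad_sq :: "real \<Rightarrow> 'm \<Rightarrow> real" where
  "grad_sq t p = g t p (grad A (chart_at p) (g t) (u t) p) (grad A (chart_at p) (g t) (u t) p)"

text \<open>By the heat equation this is half the Laplacian computed in any chart; the time
  derivative itself involves no chart.\<close>

definition udot :: "real \<Rightarrow> 'm \<Rightarrow> real" where
  "udot t p = vector_derivative (\<lambda>s. u s p) (at t within {0..T})"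

definition harnack :: "real \<Rightarrow> real \<Rightarrow> 'm \<Rightarrow> real" where
  "harnack \<alpha> t p = grad_sq t p / (u t p)\<^sup>2 - 2 * \<alpha> * (udot t p / u t p)"

lemma chart_at: "chart_at p \<in> A" "p \<in> fst (chart_at p)"
proof -
  have "\<exists>c. c \<in> A \<and> p \<in> fst c" using atlas unfolding smooth_atlas_def by blast
  then have "chart_at p \<in> A \<and> p \<in> fst (chart_at p)" unfolding chart_at_def by (rule someI_ex)
  then show "chart_at p \<in> A" "p \<in> fst (chart_at p)" by auto
qed

lemma grad_sq_eq:
  assumes c: "c \<in> A" "p \<in> fst c" and t: "t \<in> {0..T}"
  shows "grad_sq t p = g t p (grad A c (g t) (u t) p) (grad A c (g t) (u t) p)"
  unfolding grad_sq_def
  by (rule grad_norm_chart_independent[OF metric[OF t] chart_at c u_differentiable[OF chart_at t] u_differentiable[OF c t]])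

lemma udot_eq:
  assumes c: "c \<in> A" "p \<in> fst c" and t: "t \<in> {0..T}"
  shows "udot t p = (1/2) * laplacian A c (g t) (u t) p"
  unfolding udot_def by (rule vector_derivative_time[OF t heat[OF t c]])

abbreviation gmat :: "('m, 'n) chart \<Rightarrow> real \<Rightarrow> real ^ 'n \<Rightarrow> real ^ 'n ^ 'n" where
  "gmat c s \<equiv> \<lambda>y. comps A c (g s) (chart_inv c y)"

text \<open>The local model for both remaining arguments: continuity of the Harnack quantity and the
  inequality at its maximum. \<open>G\<close> is the logarithm of the extension of u.\<close>

lemma local_logarithm:
  assumes c: "c \<in> A" and t: "t \<in> {0..T}" and x: "x \<in> snd c ` fst c"
  shows "\<exists>I V G. open I \<and> t \<in> I \<and> open V \<and> x \<in> V \<and> V \<subseteq> snd c ` fst c \<and> Cinf_on (I \<times> V) G \<and>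
    (\<forall>s\<in>I \<inter> {0..T}. \<forall>y\<in>V.
      2 * ddir (1, 0) G (s, y) = Lap (gmat c s) (\<lambda>y. G (s, y)) y + grad2 (gmat c s) (\<lambda>y. G (s, y)) y \<and>
      (\<forall>\<alpha>. harnack \<alpha> s (chart_inv c y) = grad2 (gmat c s) (\<lambda>y. G (s, y)) y - 2 * \<alpha> * ddir (1, 0) G (s, y)))"
proof -
  obtain I V E where I: "open I" "t \<in> I" and V: "open V" "x \<in> V" "V \<subseteq> snd c ` fst c" and E: "Cinf_on (I \<times> V) E"
    and pos: "\<forall>z\<in>I \<times> V. E z > 0" and Eu: "\<forall>s\<in>I \<inter> {0..T}. \<forall>y\<in>V. E (s, y) = u s (chart_inv c y)"
    using extension[OF c t x] by (elim exE conjE)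
  define G where "G z = ln (E z)" for z
  have CG: "Cinf_on (I \<times> V) G" unfolding G_def[abs_def] using E pos by (intro Cinf_on_ln) auto
  note ch = chart[OF c]
  have main: "2 * ddir (1, 0) G (s, y) = Lap (gmat c s) (\<lambda>y. G (s, y)) y + grad2 (gmat c s) (\<lambda>y. G (s, y)) y \<and>
      harnack \<alpha> s (chart_inv c y) = grad2 (gmat c s) (\<lambda>y. G (s, y)) y - 2 * \<alpha> * ddir (1, 0) G (s, y)"
    if s: "s \<in> I" "s \<in> {0..T}" and y: "y \<in> V" for s y \<alpha>
  proof -
    interpret L: local_metric V "gmat c s" by (rule local_metric_subset[OF metric_local[OF metric[OF s(2)] c] V(1,3)])
    define q where "q = chart_inv c y"
    have yU: "y \<in> snd c ` fst c" using y V by auto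
    have q: "q \<in> fst c" "snd c q = y" unfolding q_def using is_chartD(6,7)[OF ch yU] by auto
    have Es: "Cinf_on V (\<lambda>y. E (s, y))" by (rule slice_Cinf[OF E s(1) V(1)])
    have Epos: "E (s, z) > 0" if "z \<in> V" for z using pos s that by auto
    have uE: "E (s, z) = (u s \<circ> chart_inv c) z" if "z \<in> V" for z using Eu s that by auto
    have Edif: "E differentiable (at (s, y))" by (rule Cinf_on_differentiable[OF E]) (use s y in auto)
    \<comment> \<open>The extension agrees with u for times in [0,T] only; the derivative relative
      to this interval already determines its time derivative.\<close>
    have ED: "ddir (1, 0) E (s, y) = udot s q"
    proof -
      obtain d where d: "d > 0" "ball s d \<subseteq> I" using I s open_contains_ball by blast
      have "((\<lambda>r. u r q) has_real_derivative ddir (1, 0) E (s, y)) (at s within {0..T})"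
      proof (rule has_field_derivative_transform_within[OF slice_time[OF Edif] d(1) s(2)])
        fix r assume r: "r \<in> {0..T}" "dist r s < d"
        then have "r \<in> I" using d(2) by (auto simp: dist_commute)
        then show "E (r, y) = u r q" using Eu r(1) y by (simp add: q_def)
      qed
      then show ?thesis unfolding udot_def by (rule vector_derivative_time[OF s(2), symmetric])
    qed
    have GD: "ddir (1, 0) G (s, y) = udot s q / E (s, y)"
      unfolding G_def[abs_def] using ddir_ln(1)[OF Edif Epos[OF y], of "(1, 0)"] ED by simp
    have lap: "2 * udot s q = Lap (gmat c s) (\<lambda>y. E (s, y)) y"
    proof -
      have "2 * udot s q = Lap (gmat c s) (u s \<circ> chart_inv c) y"
        using udot_eq[OF c q(1) s(2)] laplacian_Lap[OF c q(1)] q(2) by simp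
      also have "\<dots> = Lap (gmat c s) (\<lambda>y. E (s, y)) y"
        by (rule Lap_cong[OF V(1) y]) (simp add: uE)
      finally show ?thesis .
    qed
    have gs: "grad_sq s q = grad2 (gmat c s) (\<lambda>y. E (s, y)) y"
    proof -
      have "grad_sq s q = grad2 (gmat c s) (u s \<circ> chart_inv c) y"
        using grad_sq_eq[OF c q(1) s(2)] grad_norm_eq(2)[OF metric[OF s(2)] c q(1)] q(2) by simp
      also have "\<dots> = grad2 (gmat c s) (\<lambda>y. E (s, y)) y"
        by (rule grad2_cong[OF V(1) y]) (simp add: uE)
      finally show ?thesis .
    qed
    have ln: "grad2 (gmat c s) (\<lambda>y. G (s, y)) y = grad2 (gmat c s) (\<lambda>y. E (s, y)) y / (E (s, y))\<^sup>2"
      "Lap (gmat c s) (\<lambda>y. G (s, y)) y = Lap (gmat c s) (\<lambda>y. E (s, y)) y / E (s, y) - grad2 (gmat c s) (\<lambda>y. E (s, y)) y / (E (s, y))\<^sup>2"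
      unfolding G_def using L.Lap_ln[OF Es Epos y] by simp_all
    have uq: "u s q = E (s, y)" using uE[OF y] by (simp add: q_def)
    show ?thesis
      unfolding harnack_def q_def[symmetric] ln GD gs uq lap[symmetric] by simp
  qed
  show ?thesis
    by (rule exI[of _ I], rule exI[of _ V], rule exI[of _ G]) (use I V CG main in blast)
qed

text \<open>Provides the maximum over [0,T] times the compact manifold. In the local model every
  ingredient is jointly continuous, the cometric because the metric coefficients are.\<close>

lemma harnack_continuous: "continuous_on ({0..T} \<times> UNIV) (\<lambda>(t, p). harnack \<alpha> t p)"
  unfolding continuous_on_eq_continuous_within
proof
  fix z assume z: "z \<in> {0..T} \<times> (UNIV :: 'm set)"
  obtain t p where tp: "z = (t, p)" "t \<in> {0..T}" using z by auto
  define c where "c = chart_at p"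
  have c: "c \<in> A" "p \<in> fst c" using chart_at[of p] by (auto simp: c_def)
  note ch = chart[OF c(1)]
  obtain I V G where I: "open I" "t \<in> I" and V: "open V" "snd c p \<in> V" "V \<subseteq> snd c ` fst c" and CG: "Cinf_on (I \<times> V) G"
    and eq: "\<forall>s\<in>I \<inter> {0..T}. \<forall>y\<in>V. 2 * ddir (1, 0) G (s, y) = Lap (gmat c s) (\<lambda>y. G (s, y)) y + grad2 (gmat c s) (\<lambda>y. G (s, y)) y \<and>
      (\<forall>\<alpha>. harnack \<alpha> s (chart_inv c y) = grad2 (gmat c s) (\<lambda>y. G (s, y)) y - 2 * \<alpha> * ddir (1, 0) G (s, y))"
    using local_logarithm[OF c(1) tp(2) imageI[OF c(2)]] by (elim exE conjE)
  let ?S = "(I \<inter> {0..T}) \<times> V"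
  have sub: "?S \<subseteq> I \<times> V" "?S \<subseteq> {0..T} \<times> snd c ` fst c" using V by auto
  have contD: "continuous_on ?S (\<lambda>(s, y). ddir v G (s, y))" for v
    using continuous_on_subset[OF Cinf_on_continuous_on[OF Cinf_on_ddir[OF CG]] sub(1)] by (simp add: split_beta)
  have contpd: "continuous_on ?S (\<lambda>z. pd i (\<lambda>y. G (fst z, y)) (snd z))" for i
    by (rule continuous_on_eq[OF contD[of "(0, axis i 1)"]])
       (use slice_ddir[OF Cinf_on_differentiable[OF CG]] in auto)
  have contm: "continuous_on ?S (\<lambda>z. gmat c (fst z) (snd z) $ i $ j)" for i j
    using continuous_on_subset[OF comps_continuous[OF c(1)] sub(2)] by (simp add: split_beta)
  have contb: "continuous_on ?S (\<lambda>z. matrix_inv (gmat c (fst z) (snd z)) $ i $ j)" for i j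
    by (rule continuous_on_matrix_inv[OF contm])
       (use local_metric.b_facts(1)[OF metric_local[OF metric c(1)]] V in auto)
  have contQ: "continuous_on ?S (\<lambda>z. grad2 (gmat c (fst z)) (\<lambda>y. G (fst z, y)) (snd z) - 2 * \<alpha> * ddir (1, 0) G z)"
    unfolding grad2_def gradv_def using contD[of "(1, 0)"]
    by (intro continuous_on_diff continuous_on_sum continuous_on_mult continuous_on_const contpd contb) (simp add: split_beta)
  define N where "N = snd c -` V \<inter> fst c"
  have opN: "open N" unfolding N_def using is_chartD(1,3)[OF ch] V(1) by (metis continuous_on_open_vimage)
  have pN: "p \<in> N" using c V by (simp add: N_def)
  have "continuous_on ((I \<inter> {0..T}) \<times> N) (\<lambda>z. snd c (snd z))"
    by (rule continuous_on_compose2[OF is_chartD(3)[OF ch] continuous_on_snd[OF continuous_on_id]]) (auto simp: N_def)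
  then have "continuous_on ((I \<inter> {0..T}) \<times> N) (\<lambda>z. (fst z, snd c (snd z)))"
    by (rule continuous_on_Pair[OF continuous_on_fst[OF continuous_on_id]])
  moreover have "(\<lambda>z. (fst z, snd c (snd z))) ` ((I \<inter> {0..T}) \<times> N) \<subseteq> ?S" by (auto simp: N_def)
  ultimately have "continuous_on ((I \<inter> {0..T}) \<times> N) (\<lambda>z. grad2 (gmat c (fst z)) (\<lambda>y. G (fst z, y)) (snd c (snd z)) - 2 * \<alpha> * ddir (1, 0) G (fst z, snd c (snd z)))"
    using continuous_on_compose2[OF contQ, of "(I \<inter> {0..T}) \<times> N" "\<lambda>z. (fst z, snd c (snd z))"] by simp
  then have "continuous_on ((I \<inter> {0..T}) \<times> N) (\<lambda>(t, p). harnack \<alpha> t p)"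
  proof (rule continuous_on_eq)
    fix w assume w: "w \<in> (I \<inter> {0..T}) \<times> N"
    then have "chart_inv c (snd c (snd w)) = snd w" using is_chartD(5)[OF ch] by (auto simp: N_def)
    moreover have "fst w \<in> I \<inter> {0..T}" "snd c (snd w) \<in> V" using w by (auto simp: N_def)
    ultimately have "harnack \<alpha> (fst w) (snd w) = grad2 (gmat c (fst w)) (\<lambda>y. G (fst w, y)) (snd c (snd w)) - 2 * \<alpha> * ddir (1, 0) G (fst w, snd c (snd w))"
      using eq by metis
    then show "grad2 (gmat c (fst w)) (\<lambda>y. G (fst w, y)) (snd c (snd w)) - 2 * \<alpha> * ddir (1, 0) G (fst w, snd c (snd w)) = (\<lambda>(t, p). harnack \<alpha> t p) w"
      by (simp add: split_beta)
  qed
  then have "continuous (at z within (I \<inter> {0..T}) \<times> N) (\<lambda>(t, p). harnack \<alpha> t p)"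
    unfolding continuous_on_eq_continuous_within using tp I pN by auto
  \<comment> \<open>I and N are open neighbourhoods, so continuity relative to the smaller set is
    continuity relative to the whole.\<close>
  moreover have "(at z within (I \<inter> {0..T}) \<times> N) = (at z within {0..T} \<times> UNIV)"
    by (rule at_within_nhd[of _ "I \<times> N"]) (use tp I pN opN in \<open>auto intro: open_Times\<close>)
  ultimately show "continuous (at z within {0..T} \<times> UNIV) (\<lambda>(t, p). harnack \<alpha> t p)" by simp
qed

lemma harnack_bound:
  fixes \<alpha> k1 k2 k3 k4 :: real
  assumes compact: "compact (UNIV :: 'm set)" and \<alpha>: "\<alpha> > 1"
    and k: "k1 \<ge> 0" "k2 \<ge> 0" "k3 \<ge> 0" "k4 \<ge> 0"
    and ricci_bound: "\<forall>t\<in>{0..T}. \<forall>c\<in>A. \<forall>p\<in>fst c. \<forall>X\<in>tangent_space A p. ricci A c (g t) p X X \<ge> - k1 * g t p X X"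
    and dt_lower: "\<forall>t\<in>{0..T}. \<forall>p. \<forall>X\<in>tangent_space A p. dt_tensor T g t p X X \<ge> - k2 * g t p X X"
    and dt_upper: "\<forall>t\<in>{0..T}. \<forall>p. \<forall>X\<in>tangent_space A p. dt_tensor T g t p X X \<le> k3 * g t p X X"
    and nabla_dt: "\<forall>t\<in>{0..T}. \<forall>c\<in>A. \<forall>p\<in>fst c. norm_cov_deriv2 A c (g t) (dt_tensor T g t) p \<le> k4"
    and t: "t \<in> {0<..T}"
  shows "harnack \<alpha> t p \<le> real CARD('n) * \<alpha>\<^sup>2 * (2 / t + max k2 k3 + k3 + sqrt (2 * k4) + (k1 + k4) / (\<alpha> - 1))"
proof -
  define B where "B = real CARD('n) * \<alpha>\<^sup>2 * (max k2 k3 + k3 + sqrt (2 * k4) + (k1 + k4) / (\<alpha> - 1))"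
  \<comment> \<open>The factor t makes \<open>\<Phi>\<close> vanish at t = 0, where no estimate of
    the Harnack quantity is available; a maximum at a positive time is covered by
    \<open>max_bound\<close>.\<close>
  define \<Phi> where "\<Phi> = (\<lambda>z. fst z * (harnack \<alpha> (fst z) (snd z) - B))"
  have "continuous_on ({0..T} \<times> (UNIV :: 'm set)) (\<lambda>z. harnack \<alpha> (fst z) (snd z))"
    using harnack_continuous[of \<alpha>] by (simp add: split_beta)
  then have "continuous_on ({0..T} \<times> (UNIV :: 'm set)) \<Phi>"
    unfolding \<Phi>_def by (intro continuous_on_mult continuous_on_fst continuous_on_id continuous_on_diff continuous_on_const)
  moreover have "compact ({0..T} \<times> (UNIV :: 'm set))" by (rule compact_Times[OF compact_Icc compact])
  moreover have "{0..T} \<times> (UNIV :: 'm set) \<noteq> {}" using T by auto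
  ultimately obtain z where z: "z \<in> {0..T} \<times> UNIV" "\<And>w. w \<in> {0..T} \<times> UNIV \<Longrightarrow> \<Phi> w \<le> \<Phi> z"
    using continuous_attains_sup by metis
  obtain t0 p0 where tp: "z = (t0, p0)" "t0 \<in> {0..T}" using z(1) by auto
  have "\<Phi> z \<le> 2 * real CARD('n) * \<alpha>\<^sup>2"
  proof (cases "t0 = 0")
    case True
    then show ?thesis by (simp add: \<Phi>_def tp)
  next
    case False
    then have t0: "0 < t0" "t0 \<le> T" using tp by auto
    define c where "c = chart_at p0"
    have c: "c \<in> A" "p0 \<in> fst c" using chart_at[of p0] by (auto simp: c_def)
    note ch = chart[OF c(1)]
    let ?x = "snd c p0" and ?h = "\<lambda>s y. comps A c (dt_tensor T g s) (chart_inv c y)"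
    have ip: "chart_inv c ?x = p0" by (rule is_chartD(5)[OF ch c(2)])
    obtain I V G where I: "open I" "t0 \<in> I" and V: "open V" "?x \<in> V" "V \<subseteq> snd c ` fst c" and G: "Cinf_on (I \<times> V) G"
      and eq: "\<forall>s\<in>I \<inter> {0..T}. \<forall>y\<in>V. 2 * ddir (1, 0) G (s, y) = Lap (gmat c s) (\<lambda>y. G (s, y)) y + grad2 (gmat c s) (\<lambda>y. G (s, y)) y \<and>
        (\<forall>\<alpha>. harnack \<alpha> s (chart_inv c y) = grad2 (gmat c s) (\<lambda>y. G (s, y)) y - 2 * \<alpha> * ddir (1, 0) G (s, y))"
      using local_logarithm[OF c(1) tp(2) imageI[OF c(2)]] by (elim exE conjE)
    interpret E: evolving_metric_at V "gmat c" ?h T t0 ?x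
      by (rule evolving_metric_at.intro[OF evolving[OF c(1) V(1,3)]])
         (rule evolving_metric_at_axioms.intro[OF t0 V(2)])
    have Geq: "harnack \<alpha> s (chart_inv c y) = grad2 (gmat c s) (\<lambda>y. G (s, y)) y - 2 * \<alpha> * ddir (1, 0) G (s, y)"
      if "s \<in> I" "s \<in> {0..T}" "y \<in> V" for s y using eq that by blast
    have gv: "g t0 p0 (tvec_of c p0 v) (tvec_of c p0 v) = (\<Sum>\<Sum>i j. gmat c t0 ?x $ i $ j * (v i * v j))" for v
      using tensor_tvec_of[OF metric_tensor[OF tp(2)] c] by (simp add: ip)
    have hv: "dt_tensor T g t0 p0 (tvec_of c p0 v) (tvec_of c p0 v) = (\<Sum>\<Sum>i j. ?h t0 ?x $ i $ j * (v i * v j))" for v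
      using dt_tensor_tvec_of[OF tp(2) c] by (simp add: ip)
    have tv: "tvec_of c p0 v \<in> tangent_space A p0" for v by (rule tvec_of_tangent[OF c])
    have "t0 * (grad2 (gmat c t0) (\<lambda>y. G (t0, y)) ?x - 2 * \<alpha> * ddir (1, 0) G (t0, ?x) - B) \<le> 2 * real CARD('n) * \<alpha>\<^sup>2"
    proof (rule E.max_bound[OF I G \<alpha> k B_def])
      show "- k1 * (\<Sum>\<Sum>i j. gmat c t0 ?x $ i $ j * (v i * v j))
         \<le> (\<Sum>\<Sum>j k. (\<Sum>\<Sum>i. Rm (gmat c t0) i k i j ?x) * v j * v k)" for v
        unfolding gv[symmetric] ricci_tvec_of[OF c, symmetric] using ricci_bound tp(2) c tv by blast
      show "- k2 * (\<Sum>\<Sum>i j. gmat c t0 ?x $ i $ j * (v i * v j)) \<le> (\<Sum>\<Sum>i j. ?h t0 ?x $ i $ j * (v i * v j))" for v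
        unfolding gv[symmetric] hv[symmetric] using dt_lower tp(2) tv by blast
      show "(\<Sum>\<Sum>i j. ?h t0 ?x $ i $ j * (v i * v j)) \<le> k3 * (\<Sum>\<Sum>i j. gmat c t0 ?x $ i $ j * (v i * v j))" for v
        unfolding gv[symmetric] hv[symmetric] using dt_upper tp(2) tv by blast
      have "norm_cov_deriv2 A c (g t0) (dt_tensor T g t0) p0 \<le> k4" using nabla_dt tp(2) c by blast
      then show "sqrt (\<Sum>\<Sum>k i j k' i' j'.
        E.bb k k' * E.bb i i' * E.bb j j' * Ncov (gmat c t0) (?h t0) k i j ?x * Ncov (gmat c t0) (?h t0) k' i' j' ?x) \<le> k4"
        unfolding norm_cov_deriv2_def cov_deriv2_Ncov[OF c] cometric_def ip .
      show "2 * ddir (1, 0) G (s, y) = Lap (gmat c s) (\<lambda>y. G (s, y)) y + grad2 (gmat c s) (\<lambda>y. G (s, y)) y"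
        if "s \<in> I" "s \<in> {0..T}" "y \<in> V" for s y using eq that by blast
      show "s * (grad2 (gmat c s) (\<lambda>y. G (s, y)) y - 2 * \<alpha> * ddir (1, 0) G (s, y) - B)
        \<le> t0 * (grad2 (gmat c t0) (\<lambda>y. G (t0, y)) ?x - 2 * \<alpha> * ddir (1, 0) G (t0, ?x) - B)"
        if "s \<in> I" "s \<in> {0..T}" "y \<in> V" for s y
        using z(2)[of "(s, chart_inv c y)"] that Geq[OF that] Geq[OF I(2) tp(2) V(2)] by (simp add: \<Phi>_def tp ip)
    qed
    then show ?thesis using Geq[OF I(2) tp(2) V(2)] by (simp add: \<Phi>_def tp ip)
  qed
  moreover have "\<Phi> (t, p) \<le> \<Phi> z" by (rule z(2)) (use t in auto)
  ultimately have "t * (harnack \<alpha> t p - B) \<le> 2 * real CARD('n) * \<alpha>\<^sup>2" by (simp add: \<Phi>_def)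
  \<comment> \<open>Division by t converts the bound 2 n \<alpha>^2 on \<open>\<Phi>\<close> into
    the term 2/t.\<close>
  then have "harnack \<alpha> t p \<le> 2 * real CARD('n) * \<alpha>\<^sup>2 / t + B" using t by (simp add: field_simps)
  also have "\<dots> = real CARD('n) * \<alpha>\<^sup>2 * (2 / t + max k2 k3 + k3 + sqrt (2 * k4) + (k1 + k4) / (\<alpha> - 1))"
    unfolding B_def by (simp add: distrib_left)
  finally show ?thesis .
qed

end

theorem theorem3p3:
  fixes A :: "('m::t2_space, 'n::finite) chart set"
    and T k1 k2 k3 k4 :: real
    and g :: "real \<Rightarrow> 'm tensor2"
    and u :: "real \<Rightarrow> 'm \<Rightarrow> real"
  assumes manifold: "compact (UNIV :: 'm set)" "smooth_atlas A"
    and T: "T > 0"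
    and metrics: "C1_metric_family A T g"
    and nonneg: "k1 \<ge> 0" "k2 \<ge> 0" "k3 \<ge> 0" "k4 \<ge> 0"
    and ricci_bound: "\<forall>t\<in>{0..T}. \<forall>c\<in>A. \<forall>p\<in>fst c. \<forall>X\<in>tangent_space A p.
          ricci A c (g t) p X X \<ge> - k1 * g t p X X"
    and dt_lower: "\<forall>t\<in>{0..T}. \<forall>p. \<forall>X\<in>tangent_space A p.
          dt_tensor T g t p X X \<ge> - k2 * g t p X X"
    and dt_upper: "\<forall>t\<in>{0..T}. \<forall>p. \<forall>X\<in>tangent_space A p.
          dt_tensor T g t p X X \<le> k3 * g t p X X"
    and nabla_dt: "\<forall>t\<in>{0..T}. \<forall>c\<in>A. \<forall>p\<in>fst c.
          norm_cov_deriv2 A c (g t) (dt_tensor T g t) p \<le> k4"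
    and u_smooth: "smooth_spacetime A T u"
    and u_pos: "\<forall>t\<in>{0..T}. \<forall>p. u t p > 0"
    and heat: "\<forall>t\<in>{0..T}. \<forall>c\<in>A. \<forall>p\<in>fst c.
          ((\<lambda>s. u s p) has_real_derivative (1/2) * laplacian A c (g t) (u t) p) (at t within {0..T})"
  shows "\<forall>\<alpha>>1. \<forall>t\<in>{0<..T}. \<forall>c\<in>A. \<forall>p\<in>fst c.
          (tvec_norm (g t) p (grad A c (g t) (u t) p))\<^sup>2 / (u t p)\<^sup>2
            - \<alpha> * (laplacian A c (g t) (u t) p / u t p)
          \<le> real CARD('n) * \<alpha>\<^sup>2 *
             (2 / t + max k2 k3 + k3 + sqrt (2 * k4) + (k1 + k4) / (\<alpha> - 1))"
proof (intro allI impI ballI)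
  fix \<alpha> t :: real and c :: "('m, 'n) chart" and p
  assume \<alpha>: "\<alpha> > 1" and t: "t \<in> {0<..T}" and c: "c \<in> A" "p \<in> fst c"
  interpret heat_flow A T g u
    by unfold_locales (use manifold T metrics u_smooth u_pos heat in auto)
  have t': "t \<in> {0..T}" using t by auto
  \<comment> \<open>The factor 2 \<alpha> in \<open>harnack\<close> meets the 1/2 of the heat
    equation.\<close>
  have "(tvec_norm (g t) p (grad A c (g t) (u t) p))\<^sup>2 / (u t p)\<^sup>2 - \<alpha> * (laplacian A c (g t) (u t) p / u t p) = harnack \<alpha> t p"
    unfolding harnack_def grad_sq_eq[OF c t'] udot_eq[OF c t'] grad_norm_eq(1)[OF metric[OF t'] c] by simp
  then show "(tvec_norm (g t) p (grad A c (g t) (u t) p))\<^sup>2 / (u t p)\<^sup>2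
            - \<alpha> * (laplacian A c (g t) (u t) p / u t p)
          \<le> real CARD('n) * \<alpha>\<^sup>2 *
             (2 / t + max k2 k3 + k3 + sqrt (2 * k4) + (k1 + k4) / (\<alpha> - 1))"
    using harnack_bound[OF manifold(1) \<alpha> nonneg ricci_bound dt_lower dt_upper nabla_dt t] by simp
qed

end
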